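(* The syntactic cwf $\mathcal T^{\mathrm I,\mathrm N_1,\Sigma,\Pi}$ is the free democratic cwf supporting $\mathrm I,\Sigma,\Pi$ on one object (base type): for every democratic cwf $\mathcal C$ supporting extensional identity types, $\Sigma$-types and $\Pi$-types, and every $o_{\mathcal C}\in\mathrm{Ty}_{\mathcal C}(1_{\mathcal C})$, there is a unique strict cwf-morphism $\mathcal T^{\mathrm I,\mathrm N_1,\Sigma,\Pi}\to\mathcal C$ which preserves the structure for $\mathrm I,\mathrm N_1,\Sigma,\Pi$ on the nose and maps $o$ to $o_{\mathcal C}$.
   Context: **Cwf.** A category with families (cwf) $\mathcal C$ consists of: a category with set of objects $\mathrm{Ctx}_{\mathcal C}$ (contexts) and hom-sets $\mathrm{Sub}_{\mathcal C}(\Gamma,\Delta)$ (substitutions); for each context $\Gamma$ a set $\mathrm{Ty}_{\mathcal C}(\Gamma)$ of types and for each $A\in\mathrm{Ty}_{\mathcal C}(\Gamma)$ a set $\mathrm{Tm}_{\mathcal C}(\Gamma,A)$ of terms; for $\gamma\in\mathrm{Sub}_{\mathcal C}(\Gamma,\Delta)$ maps $A\mapsto A[\gamma]$, $\mathrm{Ty}(\Delta)\to\mathrm{Ty}(\Gamma)$, and $a\mapsto a[\gamma]$, $\mathrm{Tm}(\Delta,A)\to\mathrm{Tm}(\Gamma,A[\gamma])$, functorial in $\gamma$; a chosen terminal object $1$; for each $\Delta$ and $A\in\mathrm{Ty}(\Delta)$ a chosen context $\Delta.A$ with $\mathrm p_A\in\mathrm{Sub}(\Delta.A,\Delta)$ and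 $\mathrm q_A\in\mathrm{Tm}(\Delta.A,A[\mathrm p_A])$ such that for all $\gamma\in\mathrm{Sub}(\Gamma,\Delta)$, $a\in\mathrm{Tm}(\Gamma,A[\gamma])$ there is a unique $\langle\gamma,a\rangle\in\mathrm{Sub}(\Gamma,\Delta.A)$ with $\mathrm p_A\circ\langle\gamma,a\rangle=\gamma$ and $\mathrm q_A[\langle\gamma,a\rangle]=a$. For $\gamma:\Delta\to\Gamma$ and $A\in\mathrm{Ty}(\Gamma)$, $\gamma^+=\langle\gamma\circ\mathrm p,\mathrm q\rangle:\Delta.A[\gamma]\to\Gamma.A$. **Democratic**: for each context $\Gamma$ there is given a type $\bar\Gamma\in\mathrm{Ty}_{\mathcal C}(1)$ and an isomorphism $\gamma_\Gamma:\Gamma\cong 1.\bar\Gamma$. A democratic cwf is regarded as supporting $\mathrm N_1$ via $\mathrm N_1=\bar 1$, $0_1=\mathrm q[\gamma_1]\in\mathrm{Tm}(1,\bar 1)$. **Support for type formers.** *Extensional identity types*: for $a,a'\in\mathrm{Tm}(\Gamma,A)$ a type $\mathrm I(A,a,a')\in\mathrm{Ty}(\Gamma)$; for $a\in\mathrm{Tm}(\Gamma,A)$ a term $\mathrm r(a)\in\mathrm{Tm}(\Gamma,\mathrm I(A,a,a))$; if $c\in\mathrm{Tm}(\Gamma,\mathrm I(A,a,a'))$ then $a=a'$ and $c=\mathrm r(a)$; $\mathrm I(A,a,a')[\gamma]=\mathrm I(A[\gamma],a[\gamma],a'[\gamma])$, $\mathrm r(a)[\gamma]=\mathrm r(a[\gamma])$.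 *$\Sigma$-types*: for $A\in\mathrm{Ty}(\Gamma)$, $B\in\mathrm{Ty}(\Gamma.A)$ a type $\Sigma(A,B)\in\mathrm{Ty}(\Gamma)$; $\mathrm{pair}(a,b)\in\mathrm{Tm}(\Gamma,\Sigma(A,B))$ for $a\in\mathrm{Tm}(\Gamma,A)$, $b\in\mathrm{Tm}(\Gamma,B[\langle\mathrm{id},a\rangle])$; for $c\in\mathrm{Tm}(\Gamma,\Sigma(A,B))$, $\mathrm{fst}(c)\in\mathrm{Tm}(\Gamma,A)$, $\mathrm{snd}(c)\in\mathrm{Tm}(\Gamma,B[\langle\mathrm{id},\mathrm{fst}(c)\rangle])$; $\mathrm{fst}(\mathrm{pair}(a,b))=a$, $\mathrm{snd}(\mathrm{pair}(a,b))=b$, $\mathrm{pair}(\mathrm{fst}(c),\mathrm{snd}(c))=c$; $\Sigma(A,B)[\gamma]=\Sigma(A[\gamma],B[\gamma^+])$ and $\mathrm{pair},\mathrm{fst},\mathrm{snd}$ commute with substitution. *$\Pi$-types*: $\Pi(A,B)\in\mathrm{Ty}(\Gamma)$; $\lambda(b)\in\mathrm{Tm}(\Gamma,\Pi(A,B))$ for $b\in\mathrm{Tm}(\Gamma.A,B)$; $\mathrm{app}(c,a)\in\mathrm{Tm}(\Gamma,B[\langle\mathrm{id},a\rangle])$ for $c\in\mathrm{Tm}(\Gamma,\Pi(A,B))$, $a\in\mathrm{Tm}(\Gamma,A)$; $\mathrm{app}(\lambda(b),a)=b[\langle\mathrm{id},a\rangle]$, $\lambda(\mathrm{app}(c[\mathrm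 p],\mathrm q))=c$; $\Pi(A,B)[\gamma]=\Pi(A[\gamma],B[\gamma^+])$, $\lambda(b)[\gamma]=\lambda(b[\gamma^+])$, $\mathrm{app}(c,a)[\gamma]=\mathrm{app}(c[\gamma],a[\gamma])$. **Strict cwf-morphism** $F$: a functor together with maps $\mathrm{Ty}_{\mathcal C}(\Gamma)\to\mathrm{Ty}_{\mathcal D}(F\Gamma)$ and $\mathrm{Tm}_{\mathcal C}(\Gamma,A)\to\mathrm{Tm}_{\mathcal D}(F\Gamma,FA)$ preserving all cwf-structure on the nose. Preserving type formers on the nose means that type formers and all associated operations are preserved strictly, e.g. $F(\Sigma(A,B))=\Sigma(FA,FB)$, $F(\mathrm{pair}(a,b))=\mathrm{pair}(Fa,Fb)$. **Raw syntax** (contexts, substitutions, types, terms): $\Gamma::=1\mid\Gamma.A$; $\gamma::=\gamma\circ\gamma\mid\mathrm{id}_\Gamma\mid\langle\rangle_\Gamma\mid\mathrm p_A\mid\langle\gamma,a\rangle_A$; $A::=o\mid A[\gamma]\mid\mathrm I(A,a,a)\mid\mathrm N_1\mid\Sigma(A,A)\mid\Pi(A,A)$; $a::=a[\gamma]\mid\mathrm q_A\mid\mathrm r(a)\mid 0_1\mid\mathrm{fst}(A,a)\mid\mathrm{snd}(A,A,a)\mid\mathrm{pair}(A,A,a,a)\mid\mathrm{app}(A,A,a,a)\mid\lambda(A,a)$. **Judgments**, defined simultaneously inductively: $\Gamma=\Gamma'\vdash$, $\Delta\vdash\gamma=\gamma':\Gamma$, $\Gamma\vdash A=A'$, $\Gamma\vdash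 a=a':A$. Reflexive instances are abbreviated $\Gamma\vdash$, $\Delta\vdash\gamma:\Gamma$, $\Gamma\vdash A$, $\Gamma\vdash a:A$. Syntactically $\gamma^+=\langle\gamma\circ\mathrm p_{A[\gamma]},\mathrm q_{A[\gamma]}\rangle_A$. *Per rules*: each of the four relations is symmetric and transitive. *Preservation*: if $\Gamma=\Gamma'\vdash$, $\Delta=\Delta'\vdash$, $\Gamma\vdash\gamma=\gamma':\Delta$ then $\Gamma'\vdash\gamma=\gamma':\Delta'$; if $\Gamma=\Gamma'\vdash$, $\Gamma\vdash A=A'$ then $\Gamma'\vdash A=A'$; if $\Gamma=\Gamma'\vdash$, $\Gamma\vdash A=A'$, $\Gamma\vdash a=a':A$ then $\Gamma'\vdash a=a':A'$. *Congruence*: $1=1\vdash$; $1\vdash o=o$; if $\Gamma=\Gamma'\vdash$ and $\Gamma\vdash A=A'$ then $\Gamma.A=\Gamma'.A'\vdash$; if $\Gamma\vdash A=A'$ and $\Delta\vdash\gamma=\gamma':\Gamma$ then $\Delta\vdash A[\gamma]=A'[\gamma']$; if $\Gamma=\Gamma'\vdash$ then $\Gamma\vdash\mathrm{id}_\Gamma=\mathrm{id}_{\Gamma'}:\Gamma$ and $\Gamma\vdash\langle\rangle_\Gamma=\langle\rangle_{\Gamma'}:1$; if $\Gamma\vdash\delta=\delta':\Delta$ and $\Delta\vdash\gamma=\gamma':\Theta$ then $\Gamma\vdash\gamma\circ\delta=\gamma'\circ\delta':\Theta$; if $\Gamma\vdash A=A'$ then $\Gamma.A\vdash\mathrm p_A=\mathrm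 p_{A'}:\Gamma$ and $\Gamma.A\vdash\mathrm q_A=\mathrm q_{A'}:A[\mathrm p_A]$; if $\Gamma\vdash A=A'$, $\Delta\vdash\gamma=\gamma':\Gamma$, $\Delta\vdash a=a':A[\gamma]$ then $\Delta\vdash\langle\gamma,a\rangle_A=\langle\gamma',a'\rangle_{A'}:\Gamma.A$; if $\Gamma\vdash a=a':A$, $\Delta\vdash\gamma=\gamma':\Gamma$ then $\Delta\vdash a[\gamma]=a'[\gamma']:A[\gamma]$. *Conversion* (whenever the constituents are well-typed): $(\theta\circ\delta)\circ\gamma=\theta\circ(\delta\circ\gamma)$; $\gamma=\mathrm{id}\circ\gamma$; $\gamma=\gamma\circ\mathrm{id}$; $A[\gamma\circ\delta]=A[\gamma][\delta]$; $A[\mathrm{id}]=A$; $a[\gamma\circ\delta]=a[\gamma][\delta]$; $a[\mathrm{id}]=a$; $\gamma=\langle\rangle_\Gamma$ if $\Gamma\vdash\gamma:1$; $\mathrm p_A\circ\langle\gamma,a\rangle_A=\gamma$; $\mathrm q_A[\langle\gamma,a\rangle_A]=a$; $\gamma=\langle\mathrm p_A\circ\gamma,\mathrm q_A[\gamma]\rangle_A$ if $\Delta\vdash\gamma:\Gamma.A$. *Identity types*: if $\Gamma\vdash A=A'$, $\Gamma\vdash a=a':A$, $\Gamma\vdash b=b':A$ then $\Gamma\vdash\mathrm I(A,a,b)=\mathrm I(A',a',b')$; if $\Gamma\vdash a=a':A$ then $\Gamma\vdash\mathrm r(a)=\mathrm r(a'):\mathrm I(A,a,a')$; if $\Gamma\vdash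 c:\mathrm I(A,a,a')$ then $\Gamma\vdash a=a':A$ and $\Gamma\vdash c=\mathrm r(a):\mathrm I(A,a,a')$; $\mathrm I(A,a,a')[\gamma]=\mathrm I(A[\gamma],a[\gamma],a'[\gamma])$. *Unit type*: $1\vdash\mathrm N_1=\mathrm N_1$; $1\vdash 0_1=0_1:\mathrm N_1$; if $1\vdash a:\mathrm N_1$ then $1\vdash a=0_1:\mathrm N_1$. *$\Sigma$-types*, for $\Gamma\vdash A$, $\Gamma.A\vdash B$: all operations respect equality of all their arguments; typing $\Gamma\vdash\Sigma(A,B)$; $\Gamma\vdash\mathrm{pair}(A,B,a,b):\Sigma(A,B)$ for $\Gamma\vdash a:A$, $\Gamma\vdash b:B[\langle\mathrm{id}_\Gamma,a\rangle_A]$; for $\Gamma\vdash c:\Sigma(A,B)$, $\Gamma\vdash\mathrm{fst}(A,c):A$ and $\Gamma\vdash\mathrm{snd}(A,B,c):B[\langle\mathrm{id}_\Gamma,\mathrm{fst}(A,c)\rangle_A]$; equations $\mathrm{fst}(A,\mathrm{pair}(A,B,a,b))=a$, $\mathrm{snd}(A,B,\mathrm{pair}(A,B,a,b))=b$, $c=\mathrm{pair}(A,B,\mathrm{fst}(A,c),\mathrm{snd}(A,B,c))$; $\Sigma(A,B)[\gamma]=\Sigma(A[\gamma],B[\gamma^+])$, $\mathrm{fst}(A,c)[\gamma]=\mathrm{fst}(A[\gamma],c[\gamma])$, $\mathrm{snd}(A,B,c)[\gamma]=\mathrm{snd}(A[\gamma],B[\gamma^+],c[\gamma])$, $\mathrm{pair}(A,B,a,b)[\gamma]=\mathrm{pair}(A[\gamma],B[\gamma^+],a[\gamma],b[\gamma])$.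 *$\Pi$-types*, for $\Gamma\vdash A$, $\Gamma.A\vdash B$: all operations respect equality of all their arguments; typing $\Gamma\vdash\Pi(A,B)$; $\Gamma\vdash\lambda(A,b):\Pi(A,B)$ for $\Gamma.A\vdash b:B$; $\Gamma\vdash\mathrm{app}(A,B,c,a):B[\langle\mathrm{id}_\Gamma,a\rangle_A]$ for $\Gamma\vdash c:\Pi(A,B)$, $\Gamma\vdash a:A$; equations $\mathrm{app}(A,B,\lambda(A,b),a)=b[\langle\mathrm{id}_\Gamma,a\rangle_A]$, $\lambda(A,\mathrm{app}(A[\mathrm p_A],B[\mathrm p_A^+],c[\mathrm p_A],\mathrm q_A))=c$; $\Pi(A,B)[\gamma]=\Pi(A[\gamma],B[\gamma^+])$, $\lambda(A,b)[\gamma]=\lambda(A[\gamma],b[\gamma^+])$, $\mathrm{app}(A,B,c,a)[\gamma]=\mathrm{app}(A[\gamma],B[\gamma^+],c[\gamma],a[\gamma])$. **The cwf $\mathcal T^{\mathrm I,\mathrm N_1,\Sigma,\Pi}$**: contexts, substitutions $\Gamma\to\Delta$, types over $\Gamma$, terms of type $A$ over $\Gamma$ are the raw $\Gamma$ with $\Gamma\vdash$, $\gamma$ with $\Gamma\vdash\gamma:\Delta$, $A$ with $\Gamma\vdash A$, $a$ with $\Gamma\vdash a:A$ respectively, each modulo derivable equality; all operations (cwf-structure, $\mathrm I,\mathrm N_1,\Sigma,\Pi$) are induced by the syntactic constructors. It is democratic, with $\bar 1=\mathrm N_1$ and $\overline{\Gamma.A}=\Sigma(\bar\Gamma,A[\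gamma_\Gamma^{-1}])$.
   Formalization: With uniqueness of N_1-terms only in the empty context, T is not democratic via bar 1 = N_1; democracy is proved for the calculus where any term of N_1 in any context equals 0_1. The universal property is proved for both calculi. *)

theory Defs
  imports Main
begin

section \<open>Categories with families\<close>

text \<open>
  The families of hom-sets, types and terms are carrier sets indexed by contexts (and types).
  They are not assumed to be disjoint, so every operation takes all its implicit indices as
  arguments; only its values on the carriers matter. With \<open>\<gamma>\<close> from \<open>\<Gamma>\<close> to \<open>\<Delta>\<close>, \<open>\<delta>\<close> from \<open>\<Xi>\<close> to \<open>\<Gamma>\<close>
  and \<open>A\<close> a type over \<open>\<Delta>\<close>,
  \<^item> \<open>comp_sub C \<Xi> \<Gamma> \<Delta> \<gamma> \<delta>\<close> is the composite of \<open>\<gamma>\<close> after \<open>\<delta>\<close>,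
  \<^item> \<open>ty_sub C \<Gamma> \<Delta> A \<gamma>\<close> is \<open>A[\<gamma>]\<close>,
  \<^item> \<open>tm_sub C \<Gamma> \<Delta> A a \<gamma>\<close> is \<open>a[\<gamma>]\<close>, for a term \<open>a\<close> of type \<open>A\<close>,
  \<^item> \<open>ext C \<Delta> A\<close>, \<open>pr C \<Delta> A\<close>, \<open>vr C \<Delta> A\<close> are \<open>\<Delta>.A\<close>, \<open>p\<close> and \<open>q\<close>.
\<close>

record ('c, 's, 't, 'e) cwf =
  Ctx :: "'c set"
  Sub :: "'c \<Rightarrow> 'c \<Rightarrow> 's set"
  Ty :: "'c \<Rightarrow> 't set"
  Tm :: "'c \<Rightarrow> 't \<Rightarrow> 'e set"
  id_sub :: "'c \<Rightarrow> 's"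
  comp_sub :: "'c \<Rightarrow> 'c \<Rightarrow> 'c \<Rightarrow> 's \<Rightarrow> 's \<Rightarrow> 's"
  ty_sub :: "'c \<Rightarrow> 'c \<Rightarrow> 't \<Rightarrow> 's \<Rightarrow> 't"
  tm_sub :: "'c \<Rightarrow> 'c \<Rightarrow> 't \<Rightarrow> 'e \<Rightarrow> 's \<Rightarrow> 'e"
  unit_ctx :: "'c"
  ext :: "'c \<Rightarrow> 't \<Rightarrow> 'c"
  pr :: "'c \<Rightarrow> 't \<Rightarrow> 's"
  vr :: "'c \<Rightarrow> 't \<Rightarrow> 'e"

locale cwf =
  fixes C :: "('c, 's, 't, 'e, 'm) cwf_scheme"
  assumes id_sub: "\<Gamma> \<in> Ctx C \<Longrightarrow> id_sub C \<Gamma> \<in> Sub C \<Gamma> \<Gamma>"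
    and comp_sub: "\<lbrakk>\<Xi> \<in> Ctx C; \<Gamma> \<in> Ctx C; \<Delta> \<in> Ctx C; \<delta> \<in> Sub C \<Xi> \<Gamma>; \<gamma> \<in> Sub C \<Gamma> \<Delta>\<rbrakk>
      \<Longrightarrow> comp_sub C \<Xi> \<Gamma> \<Delta> \<gamma> \<delta> \<in> Sub C \<Xi> \<Delta>"
    and comp_assoc: "\<lbrakk>\<Xi> \<in> Ctx C; \<Gamma> \<in> Ctx C; \<Delta> \<in> Ctx C; \<Theta> \<in> Ctx C;
        \<gamma> \<in> Sub C \<Xi> \<Gamma>; \<delta> \<in> Sub C \<Gamma> \<Delta>; \<theta> \<in> Sub C \<Delta> \<Theta>\<rbrakk>
      \<Longrightarrow> comp_sub C \<Xi> \<Gamma> \<Theta> (comp_sub C \<Gamma> \<Delta> \<Theta> \<theta> \<delta>) \<gamma>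
        = comp_sub C \<Xi> \<Delta> \<Theta> \<theta> (comp_sub C \<Xi> \<Gamma> \<Delta> \<delta> \<gamma>)"
    and comp_id_left: "\<lbrakk>\<Gamma> \<in> Ctx C; \<Delta> \<in> Ctx C; \<gamma> \<in> Sub C \<Gamma> \<Delta>\<rbrakk>
      \<Longrightarrow> comp_sub C \<Gamma> \<Delta> \<Delta> (id_sub C \<Delta>) \<gamma> = \<gamma>"
    and comp_id_right: "\<lbrakk>\<Gamma> \<in> Ctx C; \<Delta> \<in> Ctx C; \<gamma> \<in> Sub C \<Gamma> \<Delta>\<rbrakk>
      \<Longrightarrow> comp_sub C \<Gamma> \<Gamma> \<Delta> \<gamma> (id_sub C \<Gamma>) = \<gamma>"
    and ty_sub: "\<lbrakk>\<Gamma> \<in> Ctx C; \<Delta> \<in> Ctx C; \<gamma> \<in> Sub C \<Gamma> \<Delta>; A \<in> Ty C \<Delta>\<rbrakk>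
      \<Longrightarrow> ty_sub C \<Gamma> \<Delta> A \<gamma> \<in> Ty C \<Gamma>"
    and ty_sub_id: "\<lbrakk>\<Gamma> \<in> Ctx C; A \<in> Ty C \<Gamma>\<rbrakk> \<Longrightarrow> ty_sub C \<Gamma> \<Gamma> A (id_sub C \<Gamma>) = A"
    and ty_sub_comp: "\<lbrakk>\<Xi> \<in> Ctx C; \<Gamma> \<in> Ctx C; \<Delta> \<in> Ctx C;
        \<delta> \<in> Sub C \<Xi> \<Gamma>; \<gamma> \<in> Sub C \<Gamma> \<Delta>; A \<in> Ty C \<Delta>\<rbrakk>
      \<Longrightarrow> ty_sub C \<Xi> \<Delta> A (comp_sub C \<Xi> \<Gamma> \<Delta> \<gamma> \<delta>) = ty_sub C \<Xi> \<Gamma> (ty_sub C \<Gamma> \<Delta> A \<gamma>) \<delta>"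
    and tm_sub: "\<lbrakk>\<Gamma> \<in> Ctx C; \<Delta> \<in> Ctx C; \<gamma> \<in> Sub C \<Gamma> \<Delta>; A \<in> Ty C \<Delta>; a \<in> Tm C \<Delta> A\<rbrakk>
      \<Longrightarrow> tm_sub C \<Gamma> \<Delta> A a \<gamma> \<in> Tm C \<Gamma> (ty_sub C \<Gamma> \<Delta> A \<gamma>)"
    and tm_sub_id: "\<lbrakk>\<Gamma> \<in> Ctx C; A \<in> Ty C \<Gamma>; a \<in> Tm C \<Gamma> A\<rbrakk>
      \<Longrightarrow> tm_sub C \<Gamma> \<Gamma> A a (id_sub C \<Gamma>) = a"
    and tm_sub_comp: "\<lbrakk>\<Xi> \<in> Ctx C; \<Gamma> \<in> Ctx C; \<Delta> \<in> Ctx C;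
        \<delta> \<in> Sub C \<Xi> \<Gamma>; \<gamma> \<in> Sub C \<Gamma> \<Delta>; A \<in> Ty C \<Delta>; a \<in> Tm C \<Delta> A\<rbrakk>
      \<Longrightarrow> tm_sub C \<Xi> \<Delta> A a (comp_sub C \<Xi> \<Gamma> \<Delta> \<gamma> \<delta>)
        = tm_sub C \<Xi> \<Gamma> (ty_sub C \<Gamma> \<Delta> A \<gamma>) (tm_sub C \<Gamma> \<Delta> A a \<gamma>) \<delta>"
    and unit_ctx: "unit_ctx C \<in> Ctx C"
    and unit_ctx_terminal: "\<Gamma> \<in> Ctx C \<Longrightarrow> \<exists>!\<gamma>. \<gamma> \<in> Sub C \<Gamma> (unit_ctx C)"
    and ext: "\<lbrakk>\<Delta> \<in> Ctx C; A \<in> Ty C \<Delta>\<rbrakk> \<Longrightarrow> ext C \<Delta> A \<in> Ctx C"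
    and pr: "\<lbrakk>\<Delta> \<in> Ctx C; A \<in> Ty C \<Delta>\<rbrakk> \<Longrightarrow> pr C \<Delta> A \<in> Sub C (ext C \<Delta> A) \<Delta>"
    and vr: "\<lbrakk>\<Delta> \<in> Ctx C; A \<in> Ty C \<Delta>\<rbrakk>
      \<Longrightarrow> vr C \<Delta> A \<in> Tm C (ext C \<Delta> A) (ty_sub C (ext C \<Delta> A) \<Delta> A (pr C \<Delta> A))"
    and ext_universal: "\<lbrakk>\<Gamma> \<in> Ctx C; \<Delta> \<in> Ctx C; A \<in> Ty C \<Delta>; \<gamma> \<in> Sub C \<Gamma> \<Delta>;
        a \<in> Tm C \<Gamma> (ty_sub C \<Gamma> \<Delta> A \<gamma>)\<rbrakk>
      \<Longrightarrow> \<exists>!\<theta>. \<theta> \<in> Sub C \<Gamma> (ext C \<Delta> A) \<and>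
            comp_sub C \<Gamma> (ext C \<Delta> A) \<Delta> (pr C \<Delta> A) \<theta> = \<gamma> \<and>
            tm_sub C \<Gamma> (ext C \<Delta> A) (ty_sub C (ext C \<Delta> A) \<Delta> A (pr C \<Delta> A)) (vr C \<Delta> A) \<theta> = a"

text \<open>\<open>sub_ext C \<Gamma> \<Delta> A \<gamma> a\<close> is \<open>\<langle>\<gamma>, a\<rangle>\<close> from \<open>\<Gamma>\<close> to \<open>\<Delta>.A\<close>; \<open>lift C \<Gamma> \<Delta> A \<gamma>\<close> is \<open>\<gamma>\<^sup>+\<close> from
  \<open>\<Gamma>.A[\<gamma>]\<close> to \<open>\<Delta>.A\<close>; \<open>inst C \<Gamma> A a\<close> is \<open>\<langle>id, a\<rangle>\<close> from \<open>\<Gamma>\<close> to \<open>\<Gamma>.A\<close>.\<close>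

definition sub_ext :: "('c, 's, 't, 'e, 'm) cwf_scheme \<Rightarrow> 'c \<Rightarrow> 'c \<Rightarrow> 't \<Rightarrow> 's \<Rightarrow> 'e \<Rightarrow> 's" where
  "sub_ext C \<Gamma> \<Delta> A \<gamma> a = (THE \<theta>. \<theta> \<in> Sub C \<Gamma> (ext C \<Delta> A) \<and>
     comp_sub C \<Gamma> (ext C \<Delta> A) \<Delta> (pr C \<Delta> A) \<theta> = \<gamma> \<and>
     tm_sub C \<Gamma> (ext C \<Delta> A) (ty_sub C (ext C \<Delta> A) \<Delta> A (pr C \<Delta> A)) (vr C \<Delta> A) \<theta> = a)"

definition lift :: "('c, 's, 't, 'e, 'm) cwf_scheme \<Rightarrow> 'c \<Rightarrow> 'c \<Rightarrow> 't \<Rightarrow> 's \<Rightarrow> 's" where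
  "lift C \<Gamma> \<Delta> A \<gamma> =
     (let A' = ty_sub C \<Gamma> \<Delta> A \<gamma>
      in sub_ext C (ext C \<Gamma> A') \<Delta> A (comp_sub C (ext C \<Gamma> A') \<Gamma> \<Delta> \<gamma> (pr C \<Gamma> A')) (vr C \<Gamma> A'))"

definition inst :: "('c, 's, 't, 'e, 'm) cwf_scheme \<Rightarrow> 'c \<Rightarrow> 't \<Rightarrow> 'e \<Rightarrow> 's" where
  "inst C \<Gamma> A a = sub_ext C \<Gamma> \<Gamma> A (id_sub C \<Gamma>) a"

definition is_iso :: "('c, 's, 't, 'e, 'm) cwf_scheme \<Rightarrow> 'c \<Rightarrow> 'c \<Rightarrow> 's \<Rightarrow> bool" where
  "is_iso C \<Gamma> \<Delta> \<gamma> \<longleftrightarrow> \<gamma> \<in> Sub C \<Gamma> \<Delta> \<and>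
     (\<exists>\<delta> \<in> Sub C \<Delta> \<Gamma>. comp_sub C \<Gamma> \<Delta> \<Gamma> \<delta> \<gamma> = id_sub C \<Gamma> \<and> comp_sub C \<Delta> \<Gamma> \<Delta> \<gamma> \<delta> = id_sub C \<Delta>)"


section \<open>Type formers and democracy\<close>

text \<open>As above, the operations carry all their indices: for instance
  \<open>fst_tm C \<Gamma> A B c\<close> is \<open>fst(c)\<close> for \<open>c\<close> of type \<open>\<Sigma>(A, B)\<close> over \<open>\<Gamma>\<close>. No injectivity of the type
  formers is assumed, so \<open>fst\<close> is allowed to depend on \<open>B\<close>.\<close>

record ('c, 's, 't, 'e) tcwf = "('c, 's, 't, 'e) cwf" +
  id_ty :: "'c \<Rightarrow> 't \<Rightarrow> 'e \<Rightarrow> 'e \<Rightarrow> 't"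
  refl_tm :: "'c \<Rightarrow> 't \<Rightarrow> 'e \<Rightarrow> 'e"
  n1_ty :: "'t"
  zero_tm :: "'e"
  sigma_ty :: "'c \<Rightarrow> 't \<Rightarrow> 't \<Rightarrow> 't"
  pair_tm :: "'c \<Rightarrow> 't \<Rightarrow> 't \<Rightarrow> 'e \<Rightarrow> 'e \<Rightarrow> 'e"
  fst_tm :: "'c \<Rightarrow> 't \<Rightarrow> 't \<Rightarrow> 'e \<Rightarrow> 'e"
  snd_tm :: "'c \<Rightarrow> 't \<Rightarrow> 't \<Rightarrow> 'e \<Rightarrow> 'e"
  pi_ty :: "'c \<Rightarrow> 't \<Rightarrow> 't \<Rightarrow> 't"
  lam_tm :: "'c \<Rightarrow> 't \<Rightarrow> 't \<Rightarrow> 'e \<Rightarrow> 'e"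
  app_tm :: "'c \<Rightarrow> 't \<Rightarrow> 't \<Rightarrow> 'e \<Rightarrow> 'e \<Rightarrow> 'e"

locale supports_I = cwf C for C :: "('c, 's, 't, 'e, 'm) tcwf_scheme" +
  assumes id_ty: "\<lbrakk>\<Gamma> \<in> Ctx C; A \<in> Ty C \<Gamma>; a \<in> Tm C \<Gamma> A; a' \<in> Tm C \<Gamma> A\<rbrakk>
      \<Longrightarrow> id_ty C \<Gamma> A a a' \<in> Ty C \<Gamma>"
    and refl_tm: "\<lbrakk>\<Gamma> \<in> Ctx C; A \<in> Ty C \<Gamma>; a \<in> Tm C \<Gamma> A\<rbrakk>
      \<Longrightarrow> refl_tm C \<Gamma> A a \<in> Tm C \<Gamma> (id_ty C \<Gamma> A a a)"
    and reflection: "\<lbrakk>\<Gamma> \<in> Ctx C; A \<in> Ty C \<Gamma>; a \<in> Tm C \<Gamma> A; a' \<in> Tm C \<Gamma> A;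
        c \<in> Tm C \<Gamma> (id_ty C \<Gamma> A a a')\<rbrakk> \<Longrightarrow> a = a' \<and> c = refl_tm C \<Gamma> A a"
    and id_ty_sub: "\<lbrakk>\<Gamma> \<in> Ctx C; \<Delta> \<in> Ctx C; \<gamma> \<in> Sub C \<Gamma> \<Delta>;
        A \<in> Ty C \<Delta>; a \<in> Tm C \<Delta> A; a' \<in> Tm C \<Delta> A\<rbrakk>
      \<Longrightarrow> ty_sub C \<Gamma> \<Delta> (id_ty C \<Delta> A a a') \<gamma>
        = id_ty C \<Gamma> (ty_sub C \<Gamma> \<Delta> A \<gamma>) (tm_sub C \<Gamma> \<Delta> A a \<gamma>) (tm_sub C \<Gamma> \<Delta> A a' \<gamma>)"
    and refl_tm_sub: "\<lbrakk>\<Gamma> \<in> Ctx C; \<Delta> \<in> Ctx C; \<gamma> \<in> Sub C \<Gamma> \<Delta>; A \<in> Ty C \<Delta>; a \<in> Tm C \<Delta> A\<rbrakk>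
      \<Longrightarrow> tm_sub C \<Gamma> \<Delta> (id_ty C \<Delta> A a a) (refl_tm C \<Delta> A a) \<gamma>
        = refl_tm C \<Gamma> (ty_sub C \<Gamma> \<Delta> A \<gamma>) (tm_sub C \<Gamma> \<Delta> A a \<gamma>)"

locale supports_N1 = cwf C for C :: "('c, 's, 't, 'e, 'm) tcwf_scheme" +
  assumes n1_ty: "n1_ty C \<in> Ty C (unit_ctx C)"
    and zero_tm: "zero_tm C \<in> Tm C (unit_ctx C) (n1_ty C)"
    and n1_unique: "a \<in> Tm C (unit_ctx C) (n1_ty C) \<Longrightarrow> a = zero_tm C"

locale supports_Sigma = cwf C for C :: "('c, 's, 't, 'e, 'm) tcwf_scheme" +
  assumes sigma_ty: "\<lbrakk>\<Gamma> \<in> Ctx C; A \<in> Ty C \<Gamma>; B \<in> Ty C (ext C \<Gamma> A)\<rbrakk>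
      \<Longrightarrow> sigma_ty C \<Gamma> A B \<in> Ty C \<Gamma>"
    and pair_tm: "\<lbrakk>\<Gamma> \<in> Ctx C; A \<in> Ty C \<Gamma>; B \<in> Ty C (ext C \<Gamma> A); a \<in> Tm C \<Gamma> A;
        b \<in> Tm C \<Gamma> (ty_sub C \<Gamma> (ext C \<Gamma> A) B (inst C \<Gamma> A a))\<rbrakk>
      \<Longrightarrow> pair_tm C \<Gamma> A B a b \<in> Tm C \<Gamma> (sigma_ty C \<Gamma> A B)"
    and fst_tm: "\<lbrakk>\<Gamma> \<in> Ctx C; A \<in> Ty C \<Gamma>; B \<in> Ty C (ext C \<Gamma> A);
        c \<in> Tm C \<Gamma> (sigma_ty C \<Gamma> A B)\<rbrakk> \<Longrightarrow> fst_tm C \<Gamma> A B c \<in> Tm C \<Gamma> A"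
    and snd_tm: "\<lbrakk>\<Gamma> \<in> Ctx C; A \<in> Ty C \<Gamma>; B \<in> Ty C (ext C \<Gamma> A);
        c \<in> Tm C \<Gamma> (sigma_ty C \<Gamma> A B)\<rbrakk>
      \<Longrightarrow> snd_tm C \<Gamma> A B c \<in> Tm C \<Gamma> (ty_sub C \<Gamma> (ext C \<Gamma> A) B (inst C \<Gamma> A (fst_tm C \<Gamma> A B c)))"
    and fst_pair: "\<lbrakk>\<Gamma> \<in> Ctx C; A \<in> Ty C \<Gamma>; B \<in> Ty C (ext C \<Gamma> A); a \<in> Tm C \<Gamma> A;
        b \<in> Tm C \<Gamma> (ty_sub C \<Gamma> (ext C \<Gamma> A) B (inst C \<Gamma> A a))\<rbrakk>
      \<Longrightarrow> fst_tm C \<Gamma> A B (pair_tm C \<Gamma> A B a b) = a"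
    and snd_pair: "\<lbrakk>\<Gamma> \<in> Ctx C; A \<in> Ty C \<Gamma>; B \<in> Ty C (ext C \<Gamma> A); a \<in> Tm C \<Gamma> A;
        b \<in> Tm C \<Gamma> (ty_sub C \<Gamma> (ext C \<Gamma> A) B (inst C \<Gamma> A a))\<rbrakk>
      \<Longrightarrow> snd_tm C \<Gamma> A B (pair_tm C \<Gamma> A B a b) = b"
    and pair_fst_snd: "\<lbrakk>\<Gamma> \<in> Ctx C; A \<in> Ty C \<Gamma>; B \<in> Ty C (ext C \<Gamma> A);
        c \<in> Tm C \<Gamma> (sigma_ty C \<Gamma> A B)\<rbrakk>
      \<Longrightarrow> pair_tm C \<Gamma> A B (fst_tm C \<Gamma> A B c) (snd_tm C \<Gamma> A B c) = c"
    and sigma_ty_sub: "\<lbrakk>\<Gamma> \<in> Ctx C; \<Delta> \<in> Ctx C; \<gamma> \<in> Sub C \<Gamma> \<Delta>; A \<in> Ty C \<Delta>; B \<in> Ty C (ext C \<Delta> A)\<rbrakk>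
      \<Longrightarrow> ty_sub C \<Gamma> \<Delta> (sigma_ty C \<Delta> A B) \<gamma>
        = sigma_ty C \<Gamma> (ty_sub C \<Gamma> \<Delta> A \<gamma>)
            (ty_sub C (ext C \<Gamma> (ty_sub C \<Gamma> \<Delta> A \<gamma>)) (ext C \<Delta> A) B (lift C \<Gamma> \<Delta> A \<gamma>))"
    and pair_tm_sub: "\<lbrakk>\<Gamma> \<in> Ctx C; \<Delta> \<in> Ctx C; \<gamma> \<in> Sub C \<Gamma> \<Delta>; A \<in> Ty C \<Delta>; B \<in> Ty C (ext C \<Delta> A);
        a \<in> Tm C \<Delta> A; b \<in> Tm C \<Delta> (ty_sub C \<Delta> (ext C \<Delta> A) B (inst C \<Delta> A a))\<rbrakk>
      \<Longrightarrow> tm_sub C \<Gamma> \<Delta> (sigma_ty C \<Delta> A B) (pair_tm C \<Delta> A B a b) \<gamma>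
        = pair_tm C \<Gamma> (ty_sub C \<Gamma> \<Delta> A \<gamma>)
            (ty_sub C (ext C \<Gamma> (ty_sub C \<Gamma> \<Delta> A \<gamma>)) (ext C \<Delta> A) B (lift C \<Gamma> \<Delta> A \<gamma>))
            (tm_sub C \<Gamma> \<Delta> A a \<gamma>)
            (tm_sub C \<Gamma> \<Delta> (ty_sub C \<Delta> (ext C \<Delta> A) B (inst C \<Delta> A a)) b \<gamma>)"
    and fst_tm_sub: "\<lbrakk>\<Gamma> \<in> Ctx C; \<Delta> \<in> Ctx C; \<gamma> \<in> Sub C \<Gamma> \<Delta>; A \<in> Ty C \<Delta>; B \<in> Ty C (ext C \<Delta> A);
        c \<in> Tm C \<Delta> (sigma_ty C \<Delta> A B)\<rbrakk>
      \<Longrightarrow> tm_sub C \<Gamma> \<Delta> A (fst_tm C \<Delta> A B c) \<gamma>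
        = fst_tm C \<Gamma> (ty_sub C \<Gamma> \<Delta> A \<gamma>)
            (ty_sub C (ext C \<Gamma> (ty_sub C \<Gamma> \<Delta> A \<gamma>)) (ext C \<Delta> A) B (lift C \<Gamma> \<Delta> A \<gamma>))
            (tm_sub C \<Gamma> \<Delta> (sigma_ty C \<Delta> A B) c \<gamma>)"
    and snd_tm_sub: "\<lbrakk>\<Gamma> \<in> Ctx C; \<Delta> \<in> Ctx C; \<gamma> \<in> Sub C \<Gamma> \<Delta>; A \<in> Ty C \<Delta>; B \<in> Ty C (ext C \<Delta> A);
        c \<in> Tm C \<Delta> (sigma_ty C \<Delta> A B)\<rbrakk>
      \<Longrightarrow> tm_sub C \<Gamma> \<Delta> (ty_sub C \<Delta> (ext C \<Delta> A) B (inst C \<Delta> A (fst_tm C \<Delta> A B c)))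
            (snd_tm C \<Delta> A B c) \<gamma>
        = snd_tm C \<Gamma> (ty_sub C \<Gamma> \<Delta> A \<gamma>)
            (ty_sub C (ext C \<Gamma> (ty_sub C \<Gamma> \<Delta> A \<gamma>)) (ext C \<Delta> A) B (lift C \<Gamma> \<Delta> A \<gamma>))
            (tm_sub C \<Gamma> \<Delta> (sigma_ty C \<Delta> A B) c \<gamma>)"

locale supports_Pi = cwf C for C :: "('c, 's, 't, 'e, 'm) tcwf_scheme" +
  assumes pi_ty: "\<lbrakk>\<Gamma> \<in> Ctx C; A \<in> Ty C \<Gamma>; B \<in> Ty C (ext C \<Gamma> A)\<rbrakk> \<Longrightarrow> pi_ty C \<Gamma> A B \<in> Ty C \<Gamma>"
    and lam_tm: "\<lbrakk>\<Gamma> \<in> Ctx C; A \<in> Ty C \<Gamma>; B \<in> Ty C (ext C \<Gamma> A); b \<in> Tm C (ext C \<Gamma> A) B\<rbrakk>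
      \<Longrightarrow> lam_tm C \<Gamma> A B b \<in> Tm C \<Gamma> (pi_ty C \<Gamma> A B)"
    and app_tm: "\<lbrakk>\<Gamma> \<in> Ctx C; A \<in> Ty C \<Gamma>; B \<in> Ty C (ext C \<Gamma> A);
        c \<in> Tm C \<Gamma> (pi_ty C \<Gamma> A B); a \<in> Tm C \<Gamma> A\<rbrakk>
      \<Longrightarrow> app_tm C \<Gamma> A B c a \<in> Tm C \<Gamma> (ty_sub C \<Gamma> (ext C \<Gamma> A) B (inst C \<Gamma> A a))"
    and beta: "\<lbrakk>\<Gamma> \<in> Ctx C; A \<in> Ty C \<Gamma>; B \<in> Ty C (ext C \<Gamma> A);
        b \<in> Tm C (ext C \<Gamma> A) B; a \<in> Tm C \<Gamma> A\<rbrakk>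
      \<Longrightarrow> app_tm C \<Gamma> A B (lam_tm C \<Gamma> A B b) a = tm_sub C \<Gamma> (ext C \<Gamma> A) B b (inst C \<Gamma> A a)"
    and eta: "\<lbrakk>\<Gamma> \<in> Ctx C; A \<in> Ty C \<Gamma>; B \<in> Ty C (ext C \<Gamma> A); c \<in> Tm C \<Gamma> (pi_ty C \<Gamma> A B)\<rbrakk>
      \<Longrightarrow> lam_tm C \<Gamma> A B
            (app_tm C (ext C \<Gamma> A) (ty_sub C (ext C \<Gamma> A) \<Gamma> A (pr C \<Gamma> A))
              (ty_sub C (ext C (ext C \<Gamma> A) (ty_sub C (ext C \<Gamma> A) \<Gamma> A (pr C \<Gamma> A))) (ext C \<Gamma> A) B
                (lift C (ext C \<Gamma> A) \<Gamma> A (pr C \<Gamma> A)))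
              (tm_sub C (ext C \<Gamma> A) \<Gamma> (pi_ty C \<Gamma> A B) c (pr C \<Gamma> A))
              (vr C \<Gamma> A)) = c"
    and pi_ty_sub: "\<lbrakk>\<Gamma> \<in> Ctx C; \<Delta> \<in> Ctx C; \<gamma> \<in> Sub C \<Gamma> \<Delta>; A \<in> Ty C \<Delta>; B \<in> Ty C (ext C \<Delta> A)\<rbrakk>
      \<Longrightarrow> ty_sub C \<Gamma> \<Delta> (pi_ty C \<Delta> A B) \<gamma>
        = pi_ty C \<Gamma> (ty_sub C \<Gamma> \<Delta> A \<gamma>)
            (ty_sub C (ext C \<Gamma> (ty_sub C \<Gamma> \<Delta> A \<gamma>)) (ext C \<Delta> A) B (lift C \<Gamma> \<Delta> A \<gamma>))"
    and lam_tm_sub: "\<lbrakk>\<Gamma> \<in> Ctx C; \<Delta> \<in> Ctx C; \<gamma> \<in> Sub C \<Gamma> \<Delta>; A \<in> Ty C \<Delta>; B \<in> Ty C (ext C \<Delta> A);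
        b \<in> Tm C (ext C \<Delta> A) B\<rbrakk>
      \<Longrightarrow> tm_sub C \<Gamma> \<Delta> (pi_ty C \<Delta> A B) (lam_tm C \<Delta> A B b) \<gamma>
        = lam_tm C \<Gamma> (ty_sub C \<Gamma> \<Delta> A \<gamma>)
            (ty_sub C (ext C \<Gamma> (ty_sub C \<Gamma> \<Delta> A \<gamma>)) (ext C \<Delta> A) B (lift C \<Gamma> \<Delta> A \<gamma>))
            (tm_sub C (ext C \<Gamma> (ty_sub C \<Gamma> \<Delta> A \<gamma>)) (ext C \<Delta> A) B b (lift C \<Gamma> \<Delta> A \<gamma>))"
    and app_tm_sub: "\<lbrakk>\<Gamma> \<in> Ctx C; \<Delta> \<in> Ctx C; \<gamma> \<in> Sub C \<Gamma> \<Delta>; A \<in> Ty C \<Delta>; B \<in> Ty C (ext C \<Delta> A);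
        c \<in> Tm C \<Delta> (pi_ty C \<Delta> A B); a \<in> Tm C \<Delta> A\<rbrakk>
      \<Longrightarrow> tm_sub C \<Gamma> \<Delta> (ty_sub C \<Delta> (ext C \<Delta> A) B (inst C \<Delta> A a)) (app_tm C \<Delta> A B c a) \<gamma>
        = app_tm C \<Gamma> (ty_sub C \<Gamma> \<Delta> A \<gamma>)
            (ty_sub C (ext C \<Gamma> (ty_sub C \<Gamma> \<Delta> A \<gamma>)) (ext C \<Delta> A) B (lift C \<Gamma> \<Delta> A \<gamma>))
            (tm_sub C \<Gamma> \<Delta> (pi_ty C \<Delta> A B) c \<gamma>)
            (tm_sub C \<Gamma> \<Delta> A a \<gamma>)"

text \<open>A democratic cwf comes with \<open>bar \<Gamma>\<close> and \<open>dem \<Gamma> : \<Gamma> \<cong> 1.bar \<Gamma>\<close>. The last two assumptions are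
  the convention by which it is regarded as supporting \<open>N\<^sub>1\<close>: \<open>N\<^sub>1 = bar 1\<close> and \<open>0\<^sub>1 = q[dem 1]\<close>.\<close>

locale democratic_cwf = cwf C for C :: "('c, 's, 't, 'e, 'm) tcwf_scheme" +
  fixes bar :: "'c \<Rightarrow> 't" and dem :: "'c \<Rightarrow> 's"
  assumes bar: "\<Gamma> \<in> Ctx C \<Longrightarrow> bar \<Gamma> \<in> Ty C (unit_ctx C)"
    and dem: "\<Gamma> \<in> Ctx C \<Longrightarrow> is_iso C \<Gamma> (ext C (unit_ctx C) (bar \<Gamma>)) (dem \<Gamma>)"
    and n1_ty_eq: "n1_ty C = bar (unit_ctx C)"
    and zero_tm_eq: "zero_tm C =
      (let X = ext C (unit_ctx C) (bar (unit_ctx C));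
           p = pr C (unit_ctx C) (bar (unit_ctx C))
       in tm_sub C (unit_ctx C) X (ty_sub C X (unit_ctx C) (bar (unit_ctx C)) p)
            (vr C (unit_ctx C) (bar (unit_ctx C))) (dem (unit_ctx C)))"


section \<open>Strict morphisms\<close>

record ('c, 's, 't, 'e, 'c2, 's2, 't2, 'e2) cwf_map =
  FCtx :: "'c \<Rightarrow> 'c2"
  FSub :: "'c \<Rightarrow> 'c \<Rightarrow> 's \<Rightarrow> 's2"
  FTy :: "'c \<Rightarrow> 't \<Rightarrow> 't2"
  FTm :: "'c \<Rightarrow> 't \<Rightarrow> 'e \<Rightarrow> 'e2"

text \<open>A map of cwfs is a family of functions on the carriers; as usual these are represented by
  total functions with the value \<^const>\<open>undefined\<close> outside the carriers, so that equality of
  morphisms is equality in HOL.\<close>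

locale strict_cwf_morphism = dom: cwf C + cod: cwf D
  for C :: "('c, 's, 't, 'e, 'm) cwf_scheme" and D :: "('c2, 's2, 't2, 'e2, 'm2) cwf_scheme" +
  fixes F :: "('c, 's, 't, 'e, 'c2, 's2, 't2, 'e2) cwf_map"
  assumes FCtx: "\<Gamma> \<in> Ctx C \<Longrightarrow> FCtx F \<Gamma> \<in> Ctx D"
    and FSub: "\<lbrakk>\<Gamma> \<in> Ctx C; \<Delta> \<in> Ctx C; \<gamma> \<in> Sub C \<Gamma> \<Delta>\<rbrakk>
      \<Longrightarrow> FSub F \<Gamma> \<Delta> \<gamma> \<in> Sub D (FCtx F \<Gamma>) (FCtx F \<Delta>)"
    and FTy: "\<lbrakk>\<Gamma> \<in> Ctx C; A \<in> Ty C \<Gamma>\<rbrakk> \<Longrightarrow> FTy F \<Gamma> A \<in> Ty D (FCtx F \<Gamma>)"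
    and FTm: "\<lbrakk>\<Gamma> \<in> Ctx C; A \<in> Ty C \<Gamma>; a \<in> Tm C \<Gamma> A\<rbrakk>
      \<Longrightarrow> FTm F \<Gamma> A a \<in> Tm D (FCtx F \<Gamma>) (FTy F \<Gamma> A)"
    and FCtx_undefined: "\<Gamma> \<notin> Ctx C \<Longrightarrow> FCtx F \<Gamma> = undefined"
    and FSub_undefined: "\<not> (\<Gamma> \<in> Ctx C \<and> \<Delta> \<in> Ctx C \<and> \<gamma> \<in> Sub C \<Gamma> \<Delta>) \<Longrightarrow> FSub F \<Gamma> \<Delta> \<gamma> = undefined"
    and FTy_undefined: "\<not> (\<Gamma> \<in> Ctx C \<and> A \<in> Ty C \<Gamma>) \<Longrightarrow> FTy F \<Gamma> A = undefined"
    and FTm_undefined: "\<not> (\<Gamma> \<in> Ctx C \<and> A \<in> Ty C \<Gamma> \<and> a \<in> Tm C \<Gamma> A) \<Longrightarrow> FTm F \<Gamma> A a = undefined"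
    and F_id: "\<Gamma> \<in> Ctx C \<Longrightarrow> FSub F \<Gamma> \<Gamma> (id_sub C \<Gamma>) = id_sub D (FCtx F \<Gamma>)"
    and F_comp: "\<lbrakk>\<Xi> \<in> Ctx C; \<Gamma> \<in> Ctx C; \<Delta> \<in> Ctx C; \<delta> \<in> Sub C \<Xi> \<Gamma>; \<gamma> \<in> Sub C \<Gamma> \<Delta>\<rbrakk>
      \<Longrightarrow> FSub F \<Xi> \<Delta> (comp_sub C \<Xi> \<Gamma> \<Delta> \<gamma> \<delta>)
        = comp_sub D (FCtx F \<Xi>) (FCtx F \<Gamma>) (FCtx F \<Delta>) (FSub F \<Gamma> \<Delta> \<gamma>) (FSub F \<Xi> \<Gamma> \<delta>)"
    and F_ty_sub: "\<lbrakk>\<Gamma> \<in> Ctx C; \<Delta> \<in> Ctx C; \<gamma> \<in> Sub C \<Gamma> \<Delta>; A \<in> Ty C \<Delta>\<rbrakk>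
      \<Longrightarrow> FTy F \<Gamma> (ty_sub C \<Gamma> \<Delta> A \<gamma>)
        = ty_sub D (FCtx F \<Gamma>) (FCtx F \<Delta>) (FTy F \<Delta> A) (FSub F \<Gamma> \<Delta> \<gamma>)"
    and F_tm_sub: "\<lbrakk>\<Gamma> \<in> Ctx C; \<Delta> \<in> Ctx C; \<gamma> \<in> Sub C \<Gamma> \<Delta>; A \<in> Ty C \<Delta>; a \<in> Tm C \<Delta> A\<rbrakk>
      \<Longrightarrow> FTm F \<Gamma> (ty_sub C \<Gamma> \<Delta> A \<gamma>) (tm_sub C \<Gamma> \<Delta> A a \<gamma>)
        = tm_sub D (FCtx F \<Gamma>) (FCtx F \<Delta>) (FTy F \<Delta> A) (FTm F \<Delta> A a) (FSub F \<Gamma> \<Delta> \<gamma>)"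
    and F_unit: "FCtx F (unit_ctx C) = unit_ctx D"
    and F_ext: "\<lbrakk>\<Delta> \<in> Ctx C; A \<in> Ty C \<Delta>\<rbrakk>
      \<Longrightarrow> FCtx F (ext C \<Delta> A) = ext D (FCtx F \<Delta>) (FTy F \<Delta> A)"
    and F_pr: "\<lbrakk>\<Delta> \<in> Ctx C; A \<in> Ty C \<Delta>\<rbrakk>
      \<Longrightarrow> FSub F (ext C \<Delta> A) \<Delta> (pr C \<Delta> A) = pr D (FCtx F \<Delta>) (FTy F \<Delta> A)"
    and F_vr: "\<lbrakk>\<Delta> \<in> Ctx C; A \<in> Ty C \<Delta>\<rbrakk>
      \<Longrightarrow> FTm F (ext C \<Delta> A) (ty_sub C (ext C \<Delta> A) \<Delta> A (pr C \<Delta> A)) (vr C \<Delta> A)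
        = vr D (FCtx F \<Delta>) (FTy F \<Delta> A)"
    and F_sub_ext: "\<lbrakk>\<Gamma> \<in> Ctx C; \<Delta> \<in> Ctx C; A \<in> Ty C \<Delta>; \<gamma> \<in> Sub C \<Gamma> \<Delta>;
        a \<in> Tm C \<Gamma> (ty_sub C \<Gamma> \<Delta> A \<gamma>)\<rbrakk>
      \<Longrightarrow> FSub F \<Gamma> (ext C \<Delta> A) (sub_ext C \<Gamma> \<Delta> A \<gamma> a)
        = sub_ext D (FCtx F \<Gamma>) (FCtx F \<Delta>) (FTy F \<Delta> A) (FSub F \<Gamma> \<Delta> \<gamma>)
            (FTm F \<Gamma> (ty_sub C \<Gamma> \<Delta> A \<gamma>) a)"

locale preserves_I = strict_cwf_morphism C D F
  for C :: "('c, 's, 't, 'e, 'm) tcwf_scheme" and D :: "('c2, 's2, 't2, 'e2, 'm2) tcwf_scheme"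
    and F :: "('c, 's, 't, 'e, 'c2, 's2, 't2, 'e2) cwf_map" +
  assumes F_id_ty: "\<lbrakk>\<Gamma> \<in> Ctx C; A \<in> Ty C \<Gamma>; a \<in> Tm C \<Gamma> A; a' \<in> Tm C \<Gamma> A\<rbrakk>
      \<Longrightarrow> FTy F \<Gamma> (id_ty C \<Gamma> A a a')
        = id_ty D (FCtx F \<Gamma>) (FTy F \<Gamma> A) (FTm F \<Gamma> A a) (FTm F \<Gamma> A a')"
    and F_refl_tm: "\<lbrakk>\<Gamma> \<in> Ctx C; A \<in> Ty C \<Gamma>; a \<in> Tm C \<Gamma> A\<rbrakk>
      \<Longrightarrow> FTm F \<Gamma> (id_ty C \<Gamma> A a a) (refl_tm C \<Gamma> A a)
        = refl_tm D (FCtx F \<Gamma>) (FTy F \<Gamma> A) (FTm F \<Gamma> A a)"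

locale preserves_N1 = strict_cwf_morphism C D F
  for C :: "('c, 's, 't, 'e, 'm) tcwf_scheme" and D :: "('c2, 's2, 't2, 'e2, 'm2) tcwf_scheme"
    and F :: "('c, 's, 't, 'e, 'c2, 's2, 't2, 'e2) cwf_map" +
  assumes F_n1_ty: "FTy F (unit_ctx C) (n1_ty C) = n1_ty D"
    and F_zero_tm: "FTm F (unit_ctx C) (n1_ty C) (zero_tm C) = zero_tm D"

locale preserves_Sigma = strict_cwf_morphism C D F
  for C :: "('c, 's, 't, 'e, 'm) tcwf_scheme" and D :: "('c2, 's2, 't2, 'e2, 'm2) tcwf_scheme"
    and F :: "('c, 's, 't, 'e, 'c2, 's2, 't2, 'e2) cwf_map" +
  assumes F_sigma_ty: "\<lbrakk>\<Gamma> \<in> Ctx C; A \<in> Ty C \<Gamma>; B \<in> Ty C (ext C \<Gamma> A)\<rbrakk>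
      \<Longrightarrow> FTy F \<Gamma> (sigma_ty C \<Gamma> A B) = sigma_ty D (FCtx F \<Gamma>) (FTy F \<Gamma> A) (FTy F (ext C \<Gamma> A) B)"
    and F_pair_tm: "\<lbrakk>\<Gamma> \<in> Ctx C; A \<in> Ty C \<Gamma>; B \<in> Ty C (ext C \<Gamma> A); a \<in> Tm C \<Gamma> A;
        b \<in> Tm C \<Gamma> (ty_sub C \<Gamma> (ext C \<Gamma> A) B (inst C \<Gamma> A a))\<rbrakk>
      \<Longrightarrow> FTm F \<Gamma> (sigma_ty C \<Gamma> A B) (pair_tm C \<Gamma> A B a b)
        = pair_tm D (FCtx F \<Gamma>) (FTy F \<Gamma> A) (FTy F (ext C \<Gamma> A) B) (FTm F \<Gamma> A a)
            (FTm F \<Gamma> (ty_sub C \<Gamma> (ext C \<Gamma> A) B (inst C \<Gamma> A a)) b)"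
    and F_fst_tm: "\<lbrakk>\<Gamma> \<in> Ctx C; A \<in> Ty C \<Gamma>; B \<in> Ty C (ext C \<Gamma> A); c \<in> Tm C \<Gamma> (sigma_ty C \<Gamma> A B)\<rbrakk>
      \<Longrightarrow> FTm F \<Gamma> A (fst_tm C \<Gamma> A B c)
        = fst_tm D (FCtx F \<Gamma>) (FTy F \<Gamma> A) (FTy F (ext C \<Gamma> A) B) (FTm F \<Gamma> (sigma_ty C \<Gamma> A B) c)"
    and F_snd_tm: "\<lbrakk>\<Gamma> \<in> Ctx C; A \<in> Ty C \<Gamma>; B \<in> Ty C (ext C \<Gamma> A); c \<in> Tm C \<Gamma> (sigma_ty C \<Gamma> A B)\<rbrakk>
      \<Longrightarrow> FTm F \<Gamma> (ty_sub C \<Gamma> (ext C \<Gamma> A) B (inst C \<Gamma> A (fst_tm C \<Gamma> A B c))) (snd_tm C \<Gamma> A B c)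
        = snd_tm D (FCtx F \<Gamma>) (FTy F \<Gamma> A) (FTy F (ext C \<Gamma> A) B) (FTm F \<Gamma> (sigma_ty C \<Gamma> A B) c)"

locale preserves_Pi = strict_cwf_morphism C D F
  for C :: "('c, 's, 't, 'e, 'm) tcwf_scheme" and D :: "('c2, 's2, 't2, 'e2, 'm2) tcwf_scheme"
    and F :: "('c, 's, 't, 'e, 'c2, 's2, 't2, 'e2) cwf_map" +
  assumes F_pi_ty: "\<lbrakk>\<Gamma> \<in> Ctx C; A \<in> Ty C \<Gamma>; B \<in> Ty C (ext C \<Gamma> A)\<rbrakk>
      \<Longrightarrow> FTy F \<Gamma> (pi_ty C \<Gamma> A B) = pi_ty D (FCtx F \<Gamma>) (FTy F \<Gamma> A) (FTy F (ext C \<Gamma> A) B)"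
    and F_lam_tm: "\<lbrakk>\<Gamma> \<in> Ctx C; A \<in> Ty C \<Gamma>; B \<in> Ty C (ext C \<Gamma> A); b \<in> Tm C (ext C \<Gamma> A) B\<rbrakk>
      \<Longrightarrow> FTm F \<Gamma> (pi_ty C \<Gamma> A B) (lam_tm C \<Gamma> A B b)
        = lam_tm D (FCtx F \<Gamma>) (FTy F \<Gamma> A) (FTy F (ext C \<Gamma> A) B) (FTm F (ext C \<Gamma> A) B b)"
    and F_app_tm: "\<lbrakk>\<Gamma> \<in> Ctx C; A \<in> Ty C \<Gamma>; B \<in> Ty C (ext C \<Gamma> A);
        c \<in> Tm C \<Gamma> (pi_ty C \<Gamma> A B); a \<in> Tm C \<Gamma> A\<rbrakk>
      \<Longrightarrow> FTm F \<Gamma> (ty_sub C \<Gamma> (ext C \<Gamma> A) B (inst C \<Gamma> A a)) (app_tm C \<Gamma> A B c a)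
        = app_tm D (FCtx F \<Gamma>) (FTy F \<Gamma> A) (FTy F (ext C \<Gamma> A) B)
            (FTm F \<Gamma> (pi_ty C \<Gamma> A B) c) (FTm F \<Gamma> A a)"


section \<open>Raw syntax\<close>

text \<open>\<open>SExt \<gamma> a A\<close> is \<open>\<langle>\<gamma>, a\<rangle>\<^sub>A\<close>; the other constructors take their arguments in the order of
  the informal grammar, e.g. \<open>SComp \<gamma> \<delta>\<close> is \<open>\<gamma>\<close> after \<open>\<delta>\<close>.\<close>

datatype rctx = CUnit | CExt rctx rty
  and rsub = SComp rsub rsub | SId rctx | SBang rctx | SProj rty | SExt rsub rtm rty
  and rty = TBase | TSub rty rsub | TId rty rtm rtm | TN1 | TSigma rty rty | TPi rty rty
  and rtm = ESub rtm rsub | EVar rty | ERefl rtm | EZero | EFst rty rtm | ESnd rty rty rtm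
    | EPair rty rty rtm rtm | EApp rty rty rtm rtm | ELam rty rtm

definition slift :: "rty \<Rightarrow> rsub \<Rightarrow> rsub" where
  "slift A \<gamma> = SExt (SComp \<gamma> (SProj (TSub A \<gamma>))) (EVar (TSub A \<gamma>)) A"

definition sinst :: "rctx \<Rightarrow> rty \<Rightarrow> rtm \<Rightarrow> rsub" where
  "sinst \<Gamma> A a = SExt (SId \<Gamma>) a A"


section \<open>Judgments\<close>

text \<open>
  With the uniqueness rule of \<open>N\<^sub>1\<close> imposed on closed terms only (\<open>Closed\<close>), \<open>1.N\<^sub>1\<close> is not
  terminal in the syntactic cwf, so that \<open>bar 1 = N\<^sub>1\<close> does not define a democratic structure on it:
  the rules are sound in the presheaf model over a nontrivial group, with \<open>N\<^sub>1\<close> interpreted by a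
  non-singleton object that has exactly one global element. The parameter \<open>u\<close> of the judgments
  selects between this rule alone and its closure under substitution (\<open>Everywhere\<close>), under which
  \<open>bar 1 = N\<^sub>1\<close> is democratic. All other rules are shared by both calculi.
\<close>

datatype n1_uniqueness = Closed | Everywhere

text \<open>\<open>ctxeq u \<Gamma> \<Gamma>'\<close>, \<open>subeq u \<Delta> \<gamma> \<gamma>' \<Gamma>\<close>, \<open>tyeq u \<Gamma> A A'\<close>, \<open>tmeq u \<Gamma> a a' A\<close> stand for
  \<open>\<Gamma> = \<Gamma>' \<turnstile>\<close>, \<open>\<Delta> \<turnstile> \<gamma> = \<gamma>' : \<Gamma>\<close>, \<open>\<Gamma> \<turnstile> A = A'\<close>, \<open>\<Gamma> \<turnstile> a = a' : A\<close>.\<close>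

inductive ctxeq :: "n1_uniqueness \<Rightarrow> rctx \<Rightarrow> rctx \<Rightarrow> bool"
  and subeq :: "n1_uniqueness \<Rightarrow> rctx \<Rightarrow> rsub \<Rightarrow> rsub \<Rightarrow> rctx \<Rightarrow> bool"
  and tyeq :: "n1_uniqueness \<Rightarrow> rctx \<Rightarrow> rty \<Rightarrow> rty \<Rightarrow> bool"
  and tmeq :: "n1_uniqueness \<Rightarrow> rctx \<Rightarrow> rtm \<Rightarrow> rtm \<Rightarrow> rty \<Rightarrow> bool"
  for u :: n1_uniqueness
where
  \<comment> \<open>partial equivalence relations\<close>
  ctx_sym: "ctxeq u \<Gamma> \<Gamma>' \<Longrightarrow> ctxeq u \<Gamma>' \<Gamma>"
| ctx_trans: "\<lbrakk>ctxeq u \<Gamma> \<Gamma>'; ctxeq u \<Gamma>' \<Gamma>''\<rbrakk> \<Longrightarrow> ctxeq u \<Gamma> \<Gamma>''"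
| sub_sym: "subeq u \<Delta> \<gamma> \<gamma>' \<Gamma> \<Longrightarrow> subeq u \<Delta> \<gamma>' \<gamma> \<Gamma>"
| sub_trans: "\<lbrakk>subeq u \<Delta> \<gamma> \<gamma>' \<Gamma>; subeq u \<Delta> \<gamma>' \<gamma>'' \<Gamma>\<rbrakk> \<Longrightarrow> subeq u \<Delta> \<gamma> \<gamma>'' \<Gamma>"
| ty_sym: "tyeq u \<Gamma> A A' \<Longrightarrow> tyeq u \<Gamma> A' A"
| ty_trans: "\<lbrakk>tyeq u \<Gamma> A A'; tyeq u \<Gamma> A' A''\<rbrakk> \<Longrightarrow> tyeq u \<Gamma> A A''"
| tm_sym: "tmeq u \<Gamma> a a' A \<Longrightarrow> tmeq u \<Gamma> a' a A"
| tm_trans: "\<lbrakk>tmeq u \<Gamma> a a' A; tmeq u \<Gamma> a' a'' A\<rbrakk> \<Longrightarrow> tmeq u \<Gamma> a a'' A"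
  \<comment> \<open>preservation\<close>
| sub_pres: "\<lbrakk>ctxeq u \<Gamma> \<Gamma>'; ctxeq u \<Delta> \<Delta>'; subeq u \<Gamma> \<gamma> \<gamma>' \<Delta>\<rbrakk> \<Longrightarrow> subeq u \<Gamma>' \<gamma> \<gamma>' \<Delta>'"
| ty_pres: "\<lbrakk>ctxeq u \<Gamma> \<Gamma>'; tyeq u \<Gamma> A A'\<rbrakk> \<Longrightarrow> tyeq u \<Gamma>' A A'"
| tm_pres: "\<lbrakk>ctxeq u \<Gamma> \<Gamma>'; tyeq u \<Gamma> A A'; tmeq u \<Gamma> a a' A\<rbrakk> \<Longrightarrow> tmeq u \<Gamma>' a a' A'"
  \<comment> \<open>congruence\<close>
| unit_cong: "ctxeq u CUnit CUnit"
| base_cong: "tyeq u CUnit TBase TBase"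
| ext_cong: "\<lbrakk>ctxeq u \<Gamma> \<Gamma>'; tyeq u \<Gamma> A A'\<rbrakk> \<Longrightarrow> ctxeq u (CExt \<Gamma> A) (CExt \<Gamma>' A')"
| ty_sub_cong: "\<lbrakk>tyeq u \<Gamma> A A'; subeq u \<Delta> \<gamma> \<gamma>' \<Gamma>\<rbrakk> \<Longrightarrow> tyeq u \<Delta> (TSub A \<gamma>) (TSub A' \<gamma>')"
| id_cong: "ctxeq u \<Gamma> \<Gamma>' \<Longrightarrow> subeq u \<Gamma> (SId \<Gamma>) (SId \<Gamma>') \<Gamma>"
| bang_cong: "ctxeq u \<Gamma> \<Gamma>' \<Longrightarrow> subeq u \<Gamma> (SBang \<Gamma>) (SBang \<Gamma>') CUnit"
| comp_cong: "\<lbrakk>subeq u \<Gamma> \<delta> \<delta>' \<Delta>; subeq u \<Delta> \<gamma> \<gamma>' \<Theta>\<rbrakk> \<Longrightarrow> subeq u \<Gamma> (SComp \<gamma> \<delta>) (SComp \<gamma>' \<delta>') \<Theta>"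
| proj_cong: "tyeq u \<Gamma> A A' \<Longrightarrow> subeq u (CExt \<Gamma> A) (SProj A) (SProj A') \<Gamma>"
| var_cong: "tyeq u \<Gamma> A A' \<Longrightarrow> tmeq u (CExt \<Gamma> A) (EVar A) (EVar A') (TSub A (SProj A))"
| sub_ext_cong: "\<lbrakk>tyeq u \<Gamma> A A'; subeq u \<Delta> \<gamma> \<gamma>' \<Gamma>; tmeq u \<Delta> a a' (TSub A \<gamma>)\<rbrakk>
    \<Longrightarrow> subeq u \<Delta> (SExt \<gamma> a A) (SExt \<gamma>' a' A') (CExt \<Gamma> A)"
| tm_sub_cong: "\<lbrakk>tmeq u \<Gamma> a a' A; subeq u \<Delta> \<gamma> \<gamma>' \<Gamma>\<rbrakk>
    \<Longrightarrow> tmeq u \<Delta> (ESub a \<gamma>) (ESub a' \<gamma>') (TSub A \<gamma>)"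
  \<comment> \<open>conversion\<close>
| comp_assoc: "\<lbrakk>subeq u \<Xi> \<gamma> \<gamma> \<Gamma>; subeq u \<Gamma> \<delta> \<delta> \<Delta>; subeq u \<Delta> \<theta> \<theta> \<Theta>\<rbrakk>
    \<Longrightarrow> subeq u \<Xi> (SComp (SComp \<theta> \<delta>) \<gamma>) (SComp \<theta> (SComp \<delta> \<gamma>)) \<Theta>"
| id_left: "subeq u \<Gamma> \<gamma> \<gamma> \<Delta> \<Longrightarrow> subeq u \<Gamma> \<gamma> (SComp (SId \<Delta>) \<gamma>) \<Delta>"
| id_right: "subeq u \<Gamma> \<gamma> \<gamma> \<Delta> \<Longrightarrow> subeq u \<Gamma> \<gamma> (SComp \<gamma> (SId \<Gamma>)) \<Delta>"
| ty_sub_comp: "\<lbrakk>tyeq u \<Theta> A A; subeq u \<Delta> \<gamma> \<gamma> \<Theta>; subeq u \<Gamma> \<delta> \<delta> \<Delta>\<rbrakk>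
    \<Longrightarrow> tyeq u \<Gamma> (TSub A (SComp \<gamma> \<delta>)) (TSub (TSub A \<gamma>) \<delta>)"
| ty_sub_id: "tyeq u \<Gamma> A A \<Longrightarrow> tyeq u \<Gamma> (TSub A (SId \<Gamma>)) A"
| tm_sub_comp: "\<lbrakk>tmeq u \<Theta> a a A; subeq u \<Delta> \<gamma> \<gamma> \<Theta>; subeq u \<Gamma> \<delta> \<delta> \<Delta>\<rbrakk>
    \<Longrightarrow> tmeq u \<Gamma> (ESub a (SComp \<gamma> \<delta>)) (ESub (ESub a \<gamma>) \<delta>) (TSub A (SComp \<gamma> \<delta>))"
| tm_sub_id: "tmeq u \<Gamma> a a A \<Longrightarrow> tmeq u \<Gamma> (ESub a (SId \<Gamma>)) a A"
| bang_unique: "subeq u \<Gamma> \<gamma> \<gamma> CUnit \<Longrightarrow> subeq u \<Gamma> \<gamma> (SBang \<Gamma>) CUnit"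
| proj_sub_ext: "\<lbrakk>tyeq u \<Gamma> A A; subeq u \<Delta> \<gamma> \<gamma> \<Gamma>; tmeq u \<Delta> a a (TSub A \<gamma>)\<rbrakk>
    \<Longrightarrow> subeq u \<Delta> (SComp (SProj A) (SExt \<gamma> a A)) \<gamma> \<Gamma>"
| var_sub_ext: "\<lbrakk>tyeq u \<Gamma> A A; subeq u \<Delta> \<gamma> \<gamma> \<Gamma>; tmeq u \<Delta> a a (TSub A \<gamma>)\<rbrakk>
    \<Longrightarrow> tmeq u \<Delta> (ESub (EVar A) (SExt \<gamma> a A)) a (TSub A \<gamma>)"
| sub_ext_eta: "\<lbrakk>tyeq u \<Gamma> A A; subeq u \<Delta> \<gamma> \<gamma> (CExt \<Gamma> A)\<rbrakk>
    \<Longrightarrow> subeq u \<Delta> \<gamma> (SExt (SComp (SProj A) \<gamma>) (ESub (EVar A) \<gamma>) A) (CExt \<Gamma> A)"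
  \<comment> \<open>identity types\<close>
| idty_cong: "\<lbrakk>tyeq u \<Gamma> A A'; tmeq u \<Gamma> a a' A; tmeq u \<Gamma> b b' A\<rbrakk>
    \<Longrightarrow> tyeq u \<Gamma> (TId A a b) (TId A' a' b')"
| refl_cong: "tmeq u \<Gamma> a a' A \<Longrightarrow> tmeq u \<Gamma> (ERefl a) (ERefl a') (TId A a a')"
| reflection: "tmeq u \<Gamma> c c (TId A a a') \<Longrightarrow> tmeq u \<Gamma> a a' A"
| refl_unique: "tmeq u \<Gamma> c c (TId A a a') \<Longrightarrow> tmeq u \<Gamma> c (ERefl a) (TId A a a')"
| idty_sub: "\<lbrakk>tyeq u \<Gamma> A A; tmeq u \<Gamma> a a A; tmeq u \<Gamma> a' a' A; subeq u \<Delta> \<gamma> \<gamma> \<Gamma>\<rbrakk>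
    \<Longrightarrow> tyeq u \<Delta> (TSub (TId A a a') \<gamma>) (TId (TSub A \<gamma>) (ESub a \<gamma>) (ESub a' \<gamma>))"
  \<comment> \<open>unit type\<close>
| n1_cong: "tyeq u CUnit TN1 TN1"
| zero_cong: "tmeq u CUnit EZero EZero TN1"
| n1_unique: "tmeq u CUnit a a TN1 \<Longrightarrow> tmeq u CUnit a EZero TN1"
| n1_unique_everywhere: "\<lbrakk>u = Everywhere; tmeq u \<Gamma> a a (TSub TN1 (SBang \<Gamma>))\<rbrakk>
    \<Longrightarrow> tmeq u \<Gamma> a (ESub EZero (SBang \<Gamma>)) (TSub TN1 (SBang \<Gamma>))"
  \<comment> \<open>\<open>\<Sigma>\<close>-types\<close>
| sigma_cong: "\<lbrakk>tyeq u \<Gamma> A A'; tyeq u (CExt \<Gamma> A) B B'\<rbrakk> \<Longrightarrow> tyeq u \<Gamma> (TSigma A B) (TSigma A' B')"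
| pair_cong: "\<lbrakk>tyeq u \<Gamma> A A'; tyeq u (CExt \<Gamma> A) B B'; tmeq u \<Gamma> a a' A;
      tmeq u \<Gamma> b b' (TSub B (sinst \<Gamma> A a))\<rbrakk>
    \<Longrightarrow> tmeq u \<Gamma> (EPair A B a b) (EPair A' B' a' b') (TSigma A B)"
| fst_cong: "\<lbrakk>tyeq u \<Gamma> A A'; tyeq u (CExt \<Gamma> A) B B; tmeq u \<Gamma> c c' (TSigma A B)\<rbrakk>
    \<Longrightarrow> tmeq u \<Gamma> (EFst A c) (EFst A' c') A"
| snd_cong: "\<lbrakk>tyeq u \<Gamma> A A'; tyeq u (CExt \<Gamma> A) B B'; tmeq u \<Gamma> c c' (TSigma A B)\<rbrakk>
    \<Longrightarrow> tmeq u \<Gamma> (ESnd A B c) (ESnd A' B' c') (TSub B (sinst \<Gamma> A (EFst A c)))"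
| fst_pair: "\<lbrakk>tyeq u \<Gamma> A A; tyeq u (CExt \<Gamma> A) B B; tmeq u \<Gamma> a a A;
      tmeq u \<Gamma> b b (TSub B (sinst \<Gamma> A a))\<rbrakk>
    \<Longrightarrow> tmeq u \<Gamma> (EFst A (EPair A B a b)) a A"
| snd_pair: "\<lbrakk>tyeq u \<Gamma> A A; tyeq u (CExt \<Gamma> A) B B; tmeq u \<Gamma> a a A;
      tmeq u \<Gamma> b b (TSub B (sinst \<Gamma> A a))\<rbrakk>
    \<Longrightarrow> tmeq u \<Gamma> (ESnd A B (EPair A B a b)) b (TSub B (sinst \<Gamma> A a))"
| pair_eta: "\<lbrakk>tyeq u \<Gamma> A A; tyeq u (CExt \<Gamma> A) B B; tmeq u \<Gamma> c c (TSigma A B)\<rbrakk>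
    \<Longrightarrow> tmeq u \<Gamma> c (EPair A B (EFst A c) (ESnd A B c)) (TSigma A B)"
| sigma_sub: "\<lbrakk>tyeq u \<Gamma> A A; tyeq u (CExt \<Gamma> A) B B; subeq u \<Delta> \<gamma> \<gamma> \<Gamma>\<rbrakk>
    \<Longrightarrow> tyeq u \<Delta> (TSub (TSigma A B) \<gamma>) (TSigma (TSub A \<gamma>) (TSub B (slift A \<gamma>)))"
| fst_sub: "\<lbrakk>tyeq u \<Gamma> A A; tyeq u (CExt \<Gamma> A) B B; tmeq u \<Gamma> c c (TSigma A B); subeq u \<Delta> \<gamma> \<gamma> \<Gamma>\<rbrakk>
    \<Longrightarrow> tmeq u \<Delta> (ESub (EFst A c) \<gamma>) (EFst (TSub A \<gamma>) (ESub c \<gamma>)) (TSub A \<gamma>)"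
| snd_sub: "\<lbrakk>tyeq u \<Gamma> A A; tyeq u (CExt \<Gamma> A) B B; tmeq u \<Gamma> c c (TSigma A B); subeq u \<Delta> \<gamma> \<gamma> \<Gamma>\<rbrakk>
    \<Longrightarrow> tmeq u \<Delta> (ESub (ESnd A B c) \<gamma>) (ESnd (TSub A \<gamma>) (TSub B (slift A \<gamma>)) (ESub c \<gamma>))
          (TSub (TSub B (sinst \<Gamma> A (EFst A c))) \<gamma>)"
| pair_sub: "\<lbrakk>tyeq u \<Gamma> A A; tyeq u (CExt \<Gamma> A) B B; tmeq u \<Gamma> a a A;
      tmeq u \<Gamma> b b (TSub B (sinst \<Gamma> A a)); subeq u \<Delta> \<gamma> \<gamma> \<Gamma>\<rbrakk>
    \<Longrightarrow> tmeq u \<Delta> (ESub (EPair A B a b) \<gamma>)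
          (EPair (TSub A \<gamma>) (TSub B (slift A \<gamma>)) (ESub a \<gamma>) (ESub b \<gamma>)) (TSub (TSigma A B) \<gamma>)"
  \<comment> \<open>\<open>\<Pi>\<close>-types\<close>
| pi_cong: "\<lbrakk>tyeq u \<Gamma> A A'; tyeq u (CExt \<Gamma> A) B B'\<rbrakk> \<Longrightarrow> tyeq u \<Gamma> (TPi A B) (TPi A' B')"
| lam_cong: "\<lbrakk>tyeq u \<Gamma> A A'; tyeq u (CExt \<Gamma> A) B B; tmeq u (CExt \<Gamma> A) b b' B\<rbrakk>
    \<Longrightarrow> tmeq u \<Gamma> (ELam A b) (ELam A' b') (TPi A B)"
| app_cong: "\<lbrakk>tyeq u \<Gamma> A A'; tyeq u (CExt \<Gamma> A) B B'; tmeq u \<Gamma> c c' (TPi A B); tmeq u \<Gamma> a a' A\<rbrakk>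
    \<Longrightarrow> tmeq u \<Gamma> (EApp A B c a) (EApp A' B' c' a') (TSub B (sinst \<Gamma> A a))"
| beta: "\<lbrakk>tyeq u \<Gamma> A A; tyeq u (CExt \<Gamma> A) B B; tmeq u (CExt \<Gamma> A) b b B; tmeq u \<Gamma> a a A\<rbrakk>
    \<Longrightarrow> tmeq u \<Gamma> (EApp A B (ELam A b) a) (ESub b (sinst \<Gamma> A a)) (TSub B (sinst \<Gamma> A a))"
| eta: "\<lbrakk>tyeq u \<Gamma> A A; tyeq u (CExt \<Gamma> A) B B; tmeq u \<Gamma> c c (TPi A B)\<rbrakk>
    \<Longrightarrow> tmeq u \<Gamma> (ELam A (EApp (TSub A (SProj A)) (TSub B (slift A (SProj A)))
          (ESub c (SProj A)) (EVar A))) c (TPi A B)"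
| pi_sub: "\<lbrakk>tyeq u \<Gamma> A A; tyeq u (CExt \<Gamma> A) B B; subeq u \<Delta> \<gamma> \<gamma> \<Gamma>\<rbrakk>
    \<Longrightarrow> tyeq u \<Delta> (TSub (TPi A B) \<gamma>) (TPi (TSub A \<gamma>) (TSub B (slift A \<gamma>)))"
| lam_sub: "\<lbrakk>tyeq u \<Gamma> A A; tyeq u (CExt \<Gamma> A) B B; tmeq u (CExt \<Gamma> A) b b B; subeq u \<Delta> \<gamma> \<gamma> \<Gamma>\<rbrakk>
    \<Longrightarrow> tmeq u \<Delta> (ESub (ELam A b) \<gamma>) (ELam (TSub A \<gamma>) (ESub b (slift A \<gamma>))) (TSub (TPi A B) \<gamma>)"
| app_sub: "\<lbrakk>tyeq u \<Gamma> A A; tyeq u (CExt \<Gamma> A) B B; tmeq u \<Gamma> c c (TPi A B); tmeq u \<Gamma> a a A;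
      subeq u \<Delta> \<gamma> \<gamma> \<Gamma>\<rbrakk>
    \<Longrightarrow> tmeq u \<Delta> (ESub (EApp A B c a) \<gamma>)
          (EApp (TSub A \<gamma>) (TSub B (slift A \<gamma>)) (ESub c \<gamma>) (ESub a \<gamma>))
          (TSub (TSub B (sinst \<Gamma> A a)) \<gamma>)"


section \<open>The syntactic cwf\<close>

definition ctx_cls :: "n1_uniqueness \<Rightarrow> rctx \<Rightarrow> rctx set" where
  "ctx_cls u \<Gamma> = {\<Gamma>'. ctxeq u \<Gamma> \<Gamma>'}"

definition sub_cls :: "n1_uniqueness \<Rightarrow> rctx \<Rightarrow> rsub \<Rightarrow> rctx \<Rightarrow> rsub set" where
  "sub_cls u \<Gamma> \<gamma> \<Delta> = {\<gamma>'. subeq u \<Gamma> \<gamma> \<gamma>' \<Delta>}"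

definition ty_cls :: "n1_uniqueness \<Rightarrow> rctx \<Rightarrow> rty \<Rightarrow> rty set" where
  "ty_cls u \<Gamma> A = {A'. tyeq u \<Gamma> A A'}"

definition tm_cls :: "n1_uniqueness \<Rightarrow> rctx \<Rightarrow> rtm \<Rightarrow> rty \<Rightarrow> rtm set" where
  "tm_cls u \<Gamma> a A = {a'. tmeq u \<Gamma> a a' A}"

definition rep :: "'a set \<Rightarrow> 'a" where
  "rep X = (SOME x. x \<in> X)"

text \<open>The operations apply a syntactic constructor to representatives of equivalence classes;
  by the congruence and preservation rules the resulting class does not depend on their choice.\<close>

definition syn_cwf :: "n1_uniqueness \<Rightarrow> (rctx set, rsub set, rty set, rtm set) tcwf" where
  "syn_cwf u = \<lparr>
     Ctx = {ctx_cls u \<Gamma> | \<Gamma>. ctxeq u \<Gamma> \<Gamma>},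
     Sub = (\<lambda>X Y. {sub_cls u \<Gamma> \<gamma> \<Delta> | \<Gamma> \<gamma> \<Delta>. \<Gamma> \<in> X \<and> \<Delta> \<in> Y \<and> subeq u \<Gamma> \<gamma> \<gamma> \<Delta>}),
     Ty = (\<lambda>X. {ty_cls u \<Gamma> A | \<Gamma> A. \<Gamma> \<in> X \<and> tyeq u \<Gamma> A A}),
     Tm = (\<lambda>X S. {tm_cls u \<Gamma> a A | \<Gamma> a A. \<Gamma> \<in> X \<and> A \<in> S \<and> tmeq u \<Gamma> a a A}),
     id_sub = (\<lambda>X. sub_cls u (rep X) (SId (rep X)) (rep X)),
     comp_sub = (\<lambda>X Y Z g d. sub_cls u (rep X) (SComp (rep g) (rep d)) (rep Z)),
     ty_sub = (\<lambda>X Y S g. ty_cls u (rep X) (TSub (rep S) (rep g))),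
     tm_sub = (\<lambda>X Y S s g. tm_cls u (rep X) (ESub (rep s) (rep g)) (TSub (rep S) (rep g))),
     unit_ctx = ctx_cls u CUnit,
     ext = (\<lambda>X S. ctx_cls u (CExt (rep X) (rep S))),
     pr = (\<lambda>X S. sub_cls u (CExt (rep X) (rep S)) (SProj (rep S)) (rep X)),
     vr = (\<lambda>X S. tm_cls u (CExt (rep X) (rep S)) (EVar (rep S)) (TSub (rep S) (SProj (rep S)))),
     id_ty = (\<lambda>X S s s'. ty_cls u (rep X) (TId (rep S) (rep s) (rep s'))),
     refl_tm = (\<lambda>X S s. tm_cls u (rep X) (ERefl (rep s)) (TId (rep S) (rep s) (rep s))),
     n1_ty = ty_cls u CUnit TN1,
     zero_tm = tm_cls u CUnit EZero TN1,
     sigma_ty = (\<lambda>X S T. ty_cls u (rep X) (TSigma (rep S) (rep T))),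
     pair_tm = (\<lambda>X S T s t. tm_cls u (rep X) (EPair (rep S) (rep T) (rep s) (rep t))
                               (TSigma (rep S) (rep T))),
     fst_tm = (\<lambda>X S T s. tm_cls u (rep X) (EFst (rep S) (rep s)) (rep S)),
     snd_tm = (\<lambda>X S T s. tm_cls u (rep X) (ESnd (rep S) (rep T) (rep s))
                            (TSub (rep T) (sinst (rep X) (rep S) (EFst (rep S) (rep s))))),
     pi_ty = (\<lambda>X S T. ty_cls u (rep X) (TPi (rep S) (rep T))),
     lam_tm = (\<lambda>X S T t. tm_cls u (rep X) (ELam (rep S) (rep t)) (TPi (rep S) (rep T))),
     app_tm = (\<lambda>X S T s t. tm_cls u (rep X) (EApp (rep S) (rep T) (rep s) (rep t))
                              (TSub (rep T) (sinst (rep X) (rep S) (rep t))))\<rparr>"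

definition syn_base :: "n1_uniqueness \<Rightarrow> rty set" where
  "syn_base u = ty_cls u CUnit TBase"

text \<open>\<open>rbar \<Gamma>\<close> and \<open>rdem_inv \<Gamma>\<close> are the type \<open>bar \<Gamma>\<close> and the inverse of \<open>dem \<Gamma>\<close>, from \<open>1.bar \<Gamma>\<close>
  to \<open>\<Gamma>\<close>. For \<open>\<Gamma>.A\<close> the latter sends a pair \<open>z\<close> in \<open>S = \<Sigma>(bar \<Gamma>, A[rdem_inv \<Gamma>])\<close> to
  \<open>\<langle>rdem_inv \<Gamma> \<circ> \<langle>p, fst z\<rangle>, snd z\<rangle>\<close>; \<open>rdem\<close> sends \<open>\<langle>\<gamma>, a\<rangle>\<close> to \<open>(dem \<Gamma> \<circ> \<gamma>, a)\<close>.\<close>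

fun rbar :: "rctx \<Rightarrow> rty" and rdem_inv :: "rctx \<Rightarrow> rsub" where
  "rbar CUnit = TN1"
| "rbar (CExt \<Gamma> A) = TSigma (rbar \<Gamma>) (TSub A (rdem_inv \<Gamma>))"
| "rdem_inv CUnit = SBang (CExt CUnit TN1)"
| "rdem_inv (CExt \<Gamma> A) =
     (let S = TSigma (rbar \<Gamma>) (TSub A (rdem_inv \<Gamma>));
          G = TSub (rbar \<Gamma>) (SProj S);
          B = TSub (TSub A (rdem_inv \<Gamma>)) (slift (rbar \<Gamma>) (SProj S))
      in SExt (SComp (rdem_inv \<Gamma>) (SExt (SProj S) (EFst G (EVar S)) (rbar \<Gamma>)))
           (ESnd G B (EVar S)) A)"

fun rdem :: "rctx \<Rightarrow> rsub" where
  "rdem CUnit = SExt (SId CUnit) EZero TN1"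
| "rdem (CExt \<Gamma> A) =
     (let S = rbar (CExt \<Gamma> A);
          e = SBang (CExt \<Gamma> A)
      in SExt e (EPair (TSub (rbar \<Gamma>) e) (TSub (TSub A (rdem_inv \<Gamma>)) (slift (rbar \<Gamma>) e))
                   (ESub (EVar (rbar \<Gamma>)) (SComp (rdem \<Gamma>) (SProj A))) (EVar A)) S)"

definition syn_bar :: "n1_uniqueness \<Rightarrow> rctx set \<Rightarrow> rty set" where
  "syn_bar u X = ty_cls u CUnit (rbar (rep X))"

definition syn_dem :: "n1_uniqueness \<Rightarrow> rctx set \<Rightarrow> rsub set" where
  "syn_dem u X = sub_cls u (rep X) (rdem (rep X)) (CExt CUnit (rbar (rep X)))"

end

theory Submission
  imports Defs
begin

text \<open>
  A derivable judgment is interpreted in a model by recursion on the raw expressions, and soundness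
  is an induction on derivations. Some raw expressions carry too few annotations for that:
  the context \<open>\<Gamma>\<close> in \<open>p\<^sub>A\<close>, \<open>q\<^sub>A\<close> over \<open>\<Gamma>.A\<close> and the type \<open>B\<close> in \<open>fst(A, c)\<close> are determined by semantic
  data only if context extension and \<open>\<Sigma>\<close> are injective, which is not assumed of a cwf. Therefore a
  cwf \<open>C\<close> is first covered by the cwf of its telescopes, in which contexts are lists of types and
  \<open>\<Sigma>\<close>-types are formal; there the interpretation is functional, and evaluation of telescopes is a
  strict morphism to \<open>C\<close>. This gives existence.

  For uniqueness, the syntax is interpreted in the telescopes over the syntactic cwf itself.
  Evaluating the result gives back the class of the expression, so each class is built up by the
  operations of the cwf, which two morphisms both preserve. Soundness thus replaces the inversion
  lemmas for the judgments.

  If \<open>1.b \<cong> \<Gamma>\<close> via \<open>h\<close>, then \<open>1.\<Sigma>(b, A[h]) \<cong> \<Gamma>.A\<close>. With \<open>1 \<cong> 1.N\<^sub>1\<close>, which holds when \<open>N\<^sub>1\<close> has a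
  unique term in every context, this is democracy of the syntactic cwf.
\<close>

section \<open>Categories with families and strict morphisms\<close>

text \<open>The unit type is the delicate point. In a democratic target N1 is \<open>bar 1\<close>,
  so 1 is isomorphic to 1.N1 and 1.N1 is terminal; a term of N1 over X is a map from X to 1.N1 and
  hence unique over every context. Both uniqueness rules are therefore sound in every democratic
  cwf, and one argument serves both calculi. What separates them is the democracy of the syntax
  itself, in the base case of a recursion over contexts. The interpretation is a relation because
  raw expressions may be meaningless: whether a part has a value depends on the values of the parts
  before it. Determinacy is where the injectivity of telescopes enters; soundness supplies
  existence. Equality of classes in the syntactic cwf and derivable equality are interchangeable. An
  equation proved once in an arbitrary cwf and instantiated at the syntactic one is thus a
  derivation. Conversions of types behind the substitution and eta rules, and the inverse laws of
  democracy, are obtained in this way.\<close>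

definition bang_sub :: "('c, 's, 't, 'e, 'm) cwf_scheme \<Rightarrow> 'c \<Rightarrow> 's" where
  "bang_sub C X = (THE s. s \<in> Sub C X (unit_ctx C))"

section \<open>Pairing, lifting and instantiation in a cwf\<close>

context cwf
begin

lemma sub_ext_char:
  assumes "X \<in> Ctx C" "Y \<in> Ctx C" "A \<in> Ty C Y" "s \<in> Sub C X Y"
    "a \<in> Tm C X (ty_sub C X Y A s)"
  shows "sub_ext C X Y A s a \<in> Sub C X (ext C Y A)"
    and "comp_sub C X (ext C Y A) Y (pr C Y A) (sub_ext C X Y A s a) = s"
    and "tm_sub C X (ext C Y A) (ty_sub C (ext C Y A) Y A (pr C Y A)) (vr C Y A)
      (sub_ext C X Y A s a) = a"
  using theI'[OF ext_universal[OF assms]] unfolding sub_ext_def by blast+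

text \<open>The main way to recognise a pair: the typing of \<open>s\<close> and \<open>a\<close> is
  inherited from \<open>t\<close>, so only the two projections of \<open>t\<close> have to be
  computed.\<close>

lemma sub_ext_eqI:
  assumes "X \<in> Ctx C" "Y \<in> Ctx C" "A \<in> Ty C Y" "t \<in> Sub C X (ext C Y A)"
    "comp_sub C X (ext C Y A) Y (pr C Y A) t = s"
    "tm_sub C X (ext C Y A) (ty_sub C (ext C Y A) Y A (pr C Y A)) (vr C Y A) t = a"
  shows "t = sub_ext C X Y A s a"
proof -
  have g: "s \<in> Sub C X Y" using assms comp_sub ext pr by blast
  have a: "a \<in> Tm C X (ty_sub C X Y A s)"
    using assms tm_sub[OF assms(1) ext[OF assms(2,3)] assms(4) _ vr[OF assms(2,3)]]
      ty_sub_comp[OF assms(1) ext[OF assms(2,3)] assms(2) assms(4) pr[OF assms(2,3)] assms(3)]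
      ty_sub[OF ext[OF assms(2,3)] assms(2) pr[OF assms(2,3)] assms(3)]
    by simp
  show ?thesis unfolding sub_ext_def
    by (rule sym, rule the1_equality[OF ext_universal[OF assms(1-3) g a]]) (use assms in auto)
qed

lemma sub_ext_eta:
  assumes "X \<in> Ctx C" "Y \<in> Ctx C" "A \<in> Ty C Y" "t \<in> Sub C X (ext C Y A)"
  shows "sub_ext C X Y A (comp_sub C X (ext C Y A) Y (pr C Y A) t)
    (tm_sub C X (ext C Y A) (ty_sub C (ext C Y A) Y A (pr C Y A)) (vr C Y A) t) = t"
  using sub_ext_eqI[OF assms refl refl] by simp

lemma sub_ext_comp:
  assumes "W \<in> Ctx C" "X \<in> Ctx C" "Y \<in> Ctx C" "A \<in> Ty C Y" "s \<in> Sub C X Y"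
    "a \<in> Tm C X (ty_sub C X Y A s)" "r \<in> Sub C W X"
  shows "comp_sub C W X (ext C Y A) (sub_ext C X Y A s a) r
    = sub_ext C W Y A (comp_sub C W X Y s r) (tm_sub C W X (ty_sub C X Y A s) a r)"
proof (rule sub_ext_eqI)
  note s = sub_ext_char[OF assms(2-6)]
  note e = ext[OF assms(3,4)]
  note p = pr[OF assms(3,4)]
  show "comp_sub C W X (ext C Y A) (sub_ext C X Y A s a) r \<in> Sub C W (ext C Y A)"
    using assms s e comp_sub by blast
  show "comp_sub C W (ext C Y A) Y (pr C Y A) (comp_sub C W X (ext C Y A) (sub_ext C X Y A s a) r)
    = comp_sub C W X Y s r"
    using comp_assoc[OF assms(1,2) e assms(3) assms(7) s(1) p] s(2) by simp
  have t: "ty_sub C (ext C Y A) Y A (pr C Y A) \<in> Ty C (ext C Y A)"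
    using ty_sub assms e p by blast
  show "tm_sub C W (ext C Y A) (ty_sub C (ext C Y A) Y A (pr C Y A)) (vr C Y A)
     (comp_sub C W X (ext C Y A) (sub_ext C X Y A s a) r)
    = tm_sub C W X (ty_sub C X Y A s) a r"
    using tm_sub_comp[OF assms(1,2) e assms(7) s(1) t vr[OF assms(3,4)]] s(3)
      ty_sub_comp[OF assms(2) e assms(3) s(1) p assms(4)] s(2) by simp
qed (use assms in auto)

lemma lift_char:
  assumes "X \<in> Ctx C" "Y \<in> Ctx C" "A \<in> Ty C Y" "s \<in> Sub C X Y"
  defines "A' \<equiv> ty_sub C X Y A s"
  shows "A' \<in> Ty C X" "ext C X A' \<in> Ctx C"
    "comp_sub C (ext C X A') X Y s (pr C X A') \<in> Sub C (ext C X A') Y"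
    "vr C X A' \<in> Tm C (ext C X A') (ty_sub C (ext C X A') Y A
      (comp_sub C (ext C X A') X Y s (pr C X A')))"
    "lift C X Y A s \<in> Sub C (ext C X A') (ext C Y A)"
proof -
  show t: "A' \<in> Ty C X" unfolding A'_def using ty_sub assms by blast
  show e: "ext C X A' \<in> Ctx C" using ext assms t by blast
  note p = pr[OF assms(1) t]
  show c: "comp_sub C (ext C X A') X Y s (pr C X A') \<in> Sub C (ext C X A') Y"
    using comp_sub assms e p by blast
  show v: "vr C X A' \<in> Tm C (ext C X A') (ty_sub C (ext C X A') Y A
      (comp_sub C (ext C X A') X Y s (pr C X A')))"
    using vr[OF assms(1) t] ty_sub_comp[OF e assms(1,2) p assms(4,3)] unfolding A'_def by simp
  show "lift C X Y A s \<in> Sub C (ext C X A') (ext C Y A)"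
    unfolding lift_def Let_def A'_def[symmetric]
    using sub_ext_char(1)[OF e assms(2,3) c v] .
qed

lemma inst_char:
  assumes "X \<in> Ctx C" "A \<in> Ty C X" "a \<in> Tm C X A"
  shows "inst C X A a \<in> Sub C X (ext C X A)"
    "comp_sub C X (ext C X A) X (pr C X A) (inst C X A a) = id_sub C X"
    "tm_sub C X (ext C X A) (ty_sub C (ext C X A) X A (pr C X A)) (vr C X A) (inst C X A a) = a"
  using sub_ext_char[OF assms(1,1,2) id_sub[OF assms(1)], of a] assms ty_sub_id
  unfolding inst_def by auto

text \<open>Lifting after pairing changes the first component only. The proofs of
  \<open>inst_comp\<close>, \<open>lift_comp\<close> and \<open>lift_pr_inst_vr\<close> all reduce
  to this.\<close>

lemma comp_lift_sub_ext:
  assumes "W \<in> Ctx C" "X \<in> Ctx C" "Y \<in> Ctx C" "A \<in> Ty C Y" "s \<in> Sub C X Y" "r \<in> Sub C W X"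
    "a \<in> Tm C W (ty_sub C W X (ty_sub C X Y A s) r)"
  shows "comp_sub C W (ext C X (ty_sub C X Y A s)) (ext C Y A) (lift C X Y A s)
      (sub_ext C W X (ty_sub C X Y A s) r a)
    = sub_ext C W Y A (comp_sub C W X Y s r) a"
proof -
  note l = lift_char[OF assms(2-5)]
  note s = sub_ext_char[OF assms(1,2) l(1) assms(6,7)]
  note p = pr[OF assms(2) l(1)]
  show ?thesis
    unfolding lift_def Let_def
    using sub_ext_comp[OF assms(1) l(2) assms(3,4) l(3,4) s(1)]
      comp_assoc[OF assms(1) l(2) assms(2,3) s(1) p assms(5)] s(2,3)
      ty_sub_comp[OF l(2) assms(2,3) p assms(5,4)]
    by simp
qed

text \<open>Both sides are the pair of \<open>s\<close> and \<open>a[s]\<close>.\<close>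

lemma inst_comp:
  assumes "X \<in> Ctx C" "Y \<in> Ctx C" "A \<in> Ty C Y" "s \<in> Sub C X Y" "a \<in> Tm C Y A"
  shows "comp_sub C X Y (ext C Y A) (inst C Y A a) s
    = comp_sub C X (ext C X (ty_sub C X Y A s)) (ext C Y A) (lift C X Y A s)
        (inst C X (ty_sub C X Y A s) (tm_sub C X Y A a s))"
proof -
  have t: "ty_sub C X Y A s \<in> Ty C X" using ty_sub assms by blast
  have a: "tm_sub C X Y A a s \<in> Tm C X (ty_sub C X Y A s)" using tm_sub assms by blast
  show ?thesis
    using sub_ext_comp[OF assms(1,2,2,3) id_sub[OF assms(2)] _ assms(4), of a] assms ty_sub_id
      comp_lift_sub_ext[OF assms(1,1-4) id_sub[OF assms(1)], of "tm_sub C X Y A a s"] t a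
      comp_id_left comp_id_right
    unfolding inst_def by simp
qed

text \<open>Makes the substitution laws of \<open>pair\<close>, \<open>snd\<close> and
  \<open>app\<close> well typed: a dependent argument or result lives over \<open>B\<close>
  instantiated at a term, and the substitution has to pass under the binder.\<close>

lemma ty_sub_inst:
  assumes "X \<in> Ctx C" "Y \<in> Ctx C" "A \<in> Ty C Y" "s \<in> Sub C X Y" "a \<in> Tm C Y A"
    "B \<in> Ty C (ext C Y A)"
  shows "ty_sub C X Y (ty_sub C Y (ext C Y A) B (inst C Y A a)) s
    = ty_sub C X (ext C X (ty_sub C X Y A s))
        (ty_sub C (ext C X (ty_sub C X Y A s)) (ext C Y A) B (lift C X Y A s))
        (inst C X (ty_sub C X Y A s) (tm_sub C X Y A a s))"
proof -
  note l = lift_char[OF assms(1-4)]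
  have a: "tm_sub C X Y A a s \<in> Tm C X (ty_sub C X Y A s)" using tm_sub assms by blast
  show ?thesis
    using inst_comp[OF assms(1-5)] ty_sub_comp[OF assms(1,2) ext[OF assms(2,3)] assms(4) inst_char(1)[OF
      assms(2,3,5)] assms(6)]
      ty_sub_comp[OF assms(1) l(2) ext[OF assms(2,3)] inst_char(1)[OF assms(1) l(1) a] l(5) assms(6)]
    by simp
qed

lemma lift_id:
  assumes "X \<in> Ctx C" "A \<in> Ty C X"
  shows "lift C X X A (id_sub C X) = id_sub C (ext C X A)"
proof -
  note e = ext[OF assms] and p = pr[OF assms]
  have t: "ty_sub C (ext C X A) X A (pr C X A) \<in> Ty C (ext C X A)"
    using ty_sub assms e p by blast
  show ?thesis
    using sub_ext_eta[OF e assms id_sub[OF e]] comp_id_right[OF e assms(1) p]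
      comp_id_left[OF e assms(1) p] tm_sub_id[OF e t vr[OF assms]]
    unfolding lift_def Let_def by (simp add: ty_sub_id[OF assms])
qed

lemma lift_comp:
  assumes "W \<in> Ctx C" "X \<in> Ctx C" "Y \<in> Ctx C" "A \<in> Ty C Y" "s \<in> Sub C X Y" "r \<in> Sub C W X"
  shows "lift C W Y A (comp_sub C W X Y s r)
    = comp_sub C (ext C W (ty_sub C W Y A (comp_sub C W X Y s r))) (ext C X (ty_sub C X Y A s)) (ext C Y A)
        (lift C X Y A s) (lift C W X (ty_sub C X Y A s) r)"
proof -
  have t: "ty_sub C X Y A s \<in> Ty C X" using ty_sub assms by blast
  note l = lift_char[OF assms(1,2) t assms(6)]
  show ?thesis
    using comp_lift_sub_ext[OF l(2) assms(2-5) l(3,4)]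
      ty_sub_comp[OF assms(1-3,6,5,4)]
      comp_assoc[OF l(2) assms(1-3) pr[OF assms(1) l(1)] assms(6,5)]
    unfolding lift_def[of C W] Let_def by simp
qed

text \<open>The composite is the pair of p and q, hence the identity. It types the body of the eta
  rule for Pi-types, which lives over \<open>B[p+][<id, q>]\<close>.\<close>

lemma lift_pr_inst_vr:
  assumes "X \<in> Ctx C" "A \<in> Ty C X"
  defines "E \<equiv> ext C X A"
  defines "A' \<equiv> ty_sub C E X A (pr C X A)"
  shows "comp_sub C E (ext C E A') E (lift C E X A (pr C X A)) (inst C E A' (vr C X A)) = id_sub C E"
proof -
  note e = ext[OF assms(1,2), folded E_def] and p = pr[OF assms(1,2), folded E_def]
  have t: "A' \<in> Ty C E"
    unfolding A'_def using ty_sub assms e p by blast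
  have v: "vr C X A \<in> Tm C E (ty_sub C E E A' (id_sub C E))"
    using vr[OF assms(1,2)] ty_sub_id[OF e t] unfolding A'_def E_def by simp
  show ?thesis
    using comp_lift_sub_ext[OF e e assms(1,2) p id_sub[OF e] v[unfolded A'_def]]
      comp_id_right[OF e assms(1) p]
      sub_ext_eta[of E X A, folded E_def, OF e assms(1,2) id_sub[OF e]]
      tm_sub_id[OF e t] v ty_sub_id[OF e t]
    unfolding inst_def A'_def E_def[symmetric] by simp
qed

lemma to_unit_eq:
  assumes "X \<in> Ctx C" "s \<in> Sub C X (unit_ctx C)" "r \<in> Sub C X (unit_ctx C)"
  shows "s = r"
  using unit_ctx_terminal assms by blast

lemma bang_sub: "X \<in> Ctx C \<Longrightarrow> bang_sub C X \<in> Sub C X (unit_ctx C)"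
  unfolding bang_sub_def by (rule theI', rule unit_ctx_terminal)

end

section \<open>The unit type of a democratic cwf\<close>

text \<open>A context isomorphic to a terminal one is terminal: compose \<open>s\<close> with the
  identity in the form \<open>f\<close> after its inverse, and the inverse after \<open>s\<close> is
  forced.\<close>

lemma iso_to_unit_unique:
  assumes "cwf C" "X \<in> Ctx C" "Y \<in> Ctx C" "is_iso C (unit_ctx C) Y f" "s \<in> Sub C X Y"
  shows "s = comp_sub C X (unit_ctx C) Y f (bang_sub C X)"
proof -
  interpret cwf C by fact
  obtain g where f: "f \<in> Sub C (unit_ctx C) Y" and g: "g \<in> Sub C Y (unit_ctx C)"
    and fg: "comp_sub C Y (unit_ctx C) Y f g = id_sub C Y"
    using assms(4) unfolding is_iso_def by blast
  have "s = comp_sub C X Y Y (comp_sub C Y (unit_ctx C) Y f g) s"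
    using fg comp_id_left[OF assms(2,3,5)] by simp
  also have "\<dots> = comp_sub C X (unit_ctx C) Y f (comp_sub C X Y (unit_ctx C) g s)"
    using comp_assoc[OF assms(2,3) unit_ctx assms(3) assms(5) g f] .
  also have "comp_sub C X Y (unit_ctx C) g s = bang_sub C X"
    using to_unit_eq[OF assms(2) comp_sub[OF assms(2,3) unit_ctx assms(5) g] bang_sub[OF assms(2)]] .
  finally show ?thesis .
qed

text \<open>By democracy at the empty context, 1.N1 is terminal. A term over \<open>X\<close> is the
  second component of a map into 1.N1, so this map factors through \<open>dem 1\<close>, along which
  the variable becomes \<open>zero_tm\<close>. This makes the rule for \<open>Everywhere\<close>
  sound.\<close>

lemma (in democratic_cwf) zero_tm_in: "zero_tm C \<in> Tm C (unit_ctx C) (n1_ty C)"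
  and n1_everywhere: "\<lbrakk>X \<in> Ctx C; s \<in> Sub C X (unit_ctx C);
      a \<in> Tm C X (ty_sub C X (unit_ctx C) (n1_ty C) s)\<rbrakk>
    \<Longrightarrow> a = tm_sub C X (unit_ctx C) (n1_ty C) (zero_tm C) s"
proof -
  let ?N = "n1_ty C" and ?U = "unit_ctx C" and ?d = "dem (unit_ctx C)"
  let ?X = "ext C ?U ?N"
  note N = bar[OF unit_ctx, folded n1_ty_eq]
  note X = ext[OF unit_ctx N] and p = pr[OF unit_ctx N] and q = vr[OF unit_ctx N]
  note iso = dem[OF unit_ctx, folded n1_ty_eq]
  have d: "?d \<in> Sub C ?U ?X" using iso unfolding is_iso_def by blast
  \<comment> \<open>Any endomap of 1 is the identity, so \<open>dem 1\<close> is a section of p and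
    the type of \<open>zero_tm\<close> is N1 itself.\<close>
  have pd: "comp_sub C ?U ?X ?U (pr C ?U ?N) ?d = id_sub C ?U"
    using to_unit_eq[OF unit_ctx comp_sub[OF unit_ctx X unit_ctx d p] id_sub[OF unit_ctx]] .
  have z: "zero_tm C = tm_sub C ?U ?X (ty_sub C ?X ?U ?N (pr C ?U ?N)) (vr C ?U ?N) ?d"
    using zero_tm_eq unfolding Let_def n1_ty_eq .
  have Np: "ty_sub C ?X ?U ?N (pr C ?U ?N) \<in> Ty C ?X" using ty_sub X unit_ctx p N by blast
  have Npd: "ty_sub C ?U ?X (ty_sub C ?X ?U ?N (pr C ?U ?N)) ?d = ?N"
    using ty_sub_comp[OF unit_ctx X unit_ctx d p N] pd ty_sub_id[OF unit_ctx N] by simp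
  show zin: "zero_tm C \<in> Tm C ?U ?N"
    using tm_sub[OF unit_ctx X d Np q] unfolding z Npd .
  assume G: "X \<in> Ctx C" and g: "s \<in> Sub C X ?U" and a: "a \<in> Tm C X (ty_sub C X ?U ?N s)"
  note s = sub_ext_char[OF G unit_ctx N g a]
  have "a = tm_sub C X ?X (ty_sub C ?X ?U ?N (pr C ?U ?N)) (vr C ?U ?N) (comp_sub C X ?U ?X ?d (bang_sub C X))"
    using s(3) iso_to_unit_unique[OF cwf_axioms G X iso s(1)] by simp
  also have "bang_sub C X = s" using to_unit_eq[OF G bang_sub[OF G] g] .
  also have "tm_sub C X ?X (ty_sub C ?X ?U ?N (pr C ?U ?N)) (vr C ?U ?N) (comp_sub C X ?U ?X ?d s)
      = tm_sub C X ?U ?N (zero_tm C) s"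
    using tm_sub_comp[OF G unit_ctx X g d Np q] unfolding z Npd .
  finally show "a = tm_sub C X ?U ?N (zero_tm C) s" .
qed

lemma (in democratic_cwf) supports_N1: "supports_N1 C"
proof
  show "n1_ty C \<in> Ty C (unit_ctx C)" using bar[OF unit_ctx] n1_ty_eq by simp
  show "zero_tm C \<in> Tm C (unit_ctx C) (n1_ty C)" by (rule zero_tm_in)
  fix a assume "a \<in> Tm C (unit_ctx C) (n1_ty C)"
  then show "a = zero_tm C"
    using n1_everywhere[OF unit_ctx id_sub[OF unit_ctx], of a] ty_sub_id[OF unit_ctx]
      tm_sub_id[OF unit_ctx _ zero_tm_in] bar[OF unit_ctx] n1_ty_eq by simp
qed

section \<open>Composition of strict morphisms\<close>

text \<open>The domain \<open>C\<close> is an argument because a composite has to be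
  \<open>undefined\<close> off its carriers again, for equality of maps to be equality of
  morphisms.\<close>

definition cwf_map_comp ::
  "('c, 's, 't, 'e, 'm) cwf_scheme \<Rightarrow> ('c2, 's2, 't2, 'e2, 'c3, 's3, 't3, 'e3) cwf_map \<Rightarrow>
    ('c, 's, 't, 'e, 'c2, 's2, 't2, 'e2) cwf_map \<Rightarrow> ('c, 's, 't, 'e, 'c3, 's3, 't3, 'e3) cwf_map" where
  "cwf_map_comp C G F = \<lparr>
     FCtx = (\<lambda>X. if X \<in> Ctx C then FCtx G (FCtx F X) else undefined),
     FSub = (\<lambda>X Y s. if X \<in> Ctx C \<and> Y \<in> Ctx C \<and> s \<in> Sub C X Y
       then FSub G (FCtx F X) (FCtx F Y) (FSub F X Y s) else undefined),
     FTy = (\<lambda>X A. if X \<in> Ctx C \<and> A \<in> Ty C X then FTy G (FCtx F X) (FTy F X A) else undefined),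
     FTm = (\<lambda>X A a. if X \<in> Ctx C \<and> A \<in> Ty C X \<and> a \<in> Tm C X A
       then FTm G (FCtx F X) (FTy F X A) (FTm F X A a) else undefined)\<rparr>"

locale composable_morphisms = F: strict_cwf_morphism C D F + G: strict_cwf_morphism D E G
  for C :: "('c, 's, 't, 'e, 'm) cwf_scheme" and D :: "('c2, 's2, 't2, 'e2, 'm2) cwf_scheme"
    and E :: "('c3, 's3, 't3, 'e3, 'm3) cwf_scheme" and F G
begin

lemmas typed = F.dom.id_sub F.dom.comp_sub F.dom.ty_sub F.dom.tm_sub F.dom.unit_ctx F.dom.ext
  F.dom.pr F.dom.vr F.dom.sub_ext_char(1) F.FCtx F.FSub F.FTy F.FTm

lemma FTm_sub: "\<lbrakk>X \<in> Ctx C; Y \<in> Ctx C; s \<in> Sub C X Y; A \<in> Ty C Y; a \<in> Tm C X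
  (ty_sub C X Y A s)\<rbrakk>
  \<Longrightarrow> FTm F X (ty_sub C X Y A s) a
    \<in> Tm D (FCtx F X) (ty_sub D (FCtx F X) (FCtx F Y) (FTy F Y A) (FSub F X Y s))"
  using F.FTm F.dom.ty_sub by (metis F.F_ty_sub)

lemma strict_comp: "strict_cwf_morphism C E (cwf_map_comp C G F)"
  apply (intro strict_cwf_morphism.intro strict_cwf_morphism_axioms.intro F.dom.cwf_axioms G.cod.cwf_axioms)
  by (simp_all add: cwf_map_comp_def typed FTm_sub G.FCtx G.FSub G.FTy G.FTm
      F.F_id F.F_comp F.F_ty_sub F.F_tm_sub F.F_unit F.F_ext F.F_pr F.F_vr F.F_sub_ext
      G.F_id G.F_comp G.F_ty_sub G.F_tm_sub G.F_unit G.F_ext G.F_pr G.F_vr G.F_sub_ext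
      cong: conj_cong)

lemma FTy_ext: "\<lbrakk>X \<in> Ctx C; A \<in> Ty C X; B \<in> Ty C (ext C X A)\<rbrakk>
  \<Longrightarrow> FTy F (ext C X A) B \<in> Ty D (ext D (FCtx F X) (FTy F X A))"
  using F.FTy F.dom.ext F.F_ext by metis

lemma FTm_ext: "\<lbrakk>X \<in> Ctx C; A \<in> Ty C X; B \<in> Ty C (ext C X A); b \<in> Tm C (ext C X A) B\<rbrakk>
  \<Longrightarrow> FTm F (ext C X A) B b \<in> Tm D (ext D (FCtx F X) (FTy F X A)) (FTy F (ext C X A) B)"
  using F.FTm F.dom.ext F.F_ext by metis

lemma F_inst: "\<lbrakk>X \<in> Ctx C; A \<in> Ty C X; a \<in> Tm C X A\<rbrakk>
  \<Longrightarrow> FSub F X (ext C X A) (inst C X A a) = inst D (FCtx F X) (FTy F X A) (FTm F X A a)"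
  unfolding inst_def
  using F.F_sub_ext[of X X A "id_sub C X" a] F.dom.id_sub F.dom.ty_sub_id F.F_id by simp

lemma F_ty_inst: "\<lbrakk>X \<in> Ctx C; A \<in> Ty C X; B \<in> Ty C (ext C X A); a \<in> Tm C X A\<rbrakk>
  \<Longrightarrow> FTy F X (ty_sub C X (ext C X A) B (inst C X A a))
    = ty_sub D (FCtx F X) (ext D (FCtx F X) (FTy F X A)) (FTy F (ext C X A) B)
        (inst D (FCtx F X) (FTy F X A) (FTm F X A a))"
  using F.F_ty_sub[of X "ext C X A" "inst C X A a" B] F.dom.inst_char F.dom.ext F_inst F.F_ext
  by simp

lemma FTm_inst: "\<lbrakk>X \<in> Ctx C; A \<in> Ty C X; B \<in> Ty C (ext C X A); a \<in> Tm C X A;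
    b \<in> Tm C X (ty_sub C X (ext C X A) B (inst C X A a))\<rbrakk>
  \<Longrightarrow> FTm F X (ty_sub C X (ext C X A) B (inst C X A a)) b
    \<in> Tm D (FCtx F X) (ty_sub D (FCtx F X) (ext D (FCtx F X) (FTy F X A)) (FTy F (ext C X A) B)
        (inst D (FCtx F X) (FTy F X A) (FTm F X A a)))"
  using F.FTm[of X "ty_sub C X (ext C X A) B (inst C X A a)" b]
    F.dom.ty_sub[of X "ext C X A" "inst C X A a" B] F.dom.ext F.dom.inst_char F_ty_inst by simp

end

text \<open>Support in the domain keeps the types and terms formed there inside the carriers, where
  the composite has its intended value. The same holds for the next three lemmas.\<close>

lemma preserves_I_comp:
  assumes "supports_I C" "preserves_I C D F" "preserves_I D E G"
  shows "preserves_I C E (cwf_map_comp C G F)"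
proof -
  interpret supports_I C by fact
  interpret F: preserves_I C D F by fact
  interpret G: preserves_I D E G by fact
  interpret composable_morphisms C D E F G by unfold_locales
  show ?thesis
    by (intro preserves_I.intro preserves_I_axioms.intro strict_comp)
      (simp_all add: cwf_map_comp_def id_ty refl_tm F.FCtx F.FTy F.FTm F.F_id_ty F.F_refl_tm
        G.F_id_ty G.F_refl_tm)
qed

lemma preserves_N1_comp:
  assumes "supports_N1 C" "preserves_N1 C D F" "preserves_N1 D E G"
  shows "preserves_N1 C E (cwf_map_comp C G F)"
proof -
  interpret supports_N1 C by fact
  interpret F: preserves_N1 C D F by fact
  interpret G: preserves_N1 D E G by fact
  interpret composable_morphisms C D E F G by unfold_locales
  show ?thesis
    by (intro preserves_N1.intro preserves_N1_axioms.intro strict_comp)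
      (simp_all add: cwf_map_comp_def unit_ctx n1_ty zero_tm F.F_n1_ty F.F_zero_tm F.F_unit
        G.F_n1_ty G.F_zero_tm)
qed

lemma preserves_Sigma_comp:
  assumes "supports_Sigma C" "preserves_Sigma C D F" "preserves_Sigma D E G"
  shows "preserves_Sigma C E (cwf_map_comp C G F)"
proof -
  interpret supports_Sigma C by fact
  interpret F: preserves_Sigma C D F by fact
  interpret G: preserves_Sigma D E G by fact
  interpret composable_morphisms C D E F G by unfold_locales
  have FTm_sigma: "FTm F X (sigma_ty C X A B) c
      \<in> Tm D (FCtx F X) (sigma_ty D (FCtx F X) (FTy F X A) (FTy F (ext C X A) B))"
    if "X \<in> Ctx C" "A \<in> Ty C X" "B \<in> Ty C (ext C X A)" "c \<in> Tm C X (sigma_ty C X A B)" for X A B c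
    using F.FTm[OF that(1) sigma_ty[OF that(1-3)] that(4)] F.F_sigma_ty[OF that(1-3)] by simp
  show ?thesis
    by (intro preserves_Sigma.intro preserves_Sigma_axioms.intro strict_comp)
      (simp_all add: cwf_map_comp_def sigma_ty pair_tm fst_tm snd_tm ext ty_sub inst_char(1)
        F.FCtx F.FTy F.FTm FTy_ext FTm_ext F_inst F_ty_inst FTm_inst FTm_sigma F.F_ext
        F.F_sigma_ty F.F_pair_tm F.F_fst_tm F.F_snd_tm
        G.F_ext G.F_sigma_ty G.F_pair_tm G.F_fst_tm G.F_snd_tm)
qed

lemma preserves_Pi_comp:
  assumes "supports_Pi C" "preserves_Pi C D F" "preserves_Pi D E G"
  shows "preserves_Pi C E (cwf_map_comp C G F)"
proof -
  interpret supports_Pi C by fact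
  interpret F: preserves_Pi C D F by fact
  interpret G: preserves_Pi D E G by fact
  interpret composable_morphisms C D E F G by unfold_locales
  have FTm_pi: "FTm F X (pi_ty C X A B) c
      \<in> Tm D (FCtx F X) (pi_ty D (FCtx F X) (FTy F X A) (FTy F (ext C X A) B))"
    if "X \<in> Ctx C" "A \<in> Ty C X" "B \<in> Ty C (ext C X A)" "c \<in> Tm C X (pi_ty C X A B)" for X A B c
    using F.FTm[OF that(1) pi_ty[OF that(1-3)] that(4)] F.F_pi_ty[OF that(1-3)] by simp
  show ?thesis
    by (intro preserves_Pi.intro preserves_Pi_axioms.intro strict_comp)
      (simp_all add: cwf_map_comp_def pi_ty lam_tm app_tm ext ty_sub inst_char(1)
        F.FCtx F.FTy F.FTm FTy_ext FTm_ext F_inst F_ty_inst FTm_inst FTm_pi F.F_ext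
        F.F_pi_ty F.F_lam_tm F.F_app_tm
        G.F_ext G.F_pi_ty G.F_lam_tm G.F_app_tm)
qed

section \<open>The syntactic cwf\<close>

lemma ctx_refl1: "ctxeq u G G' \<Longrightarrow> ctxeq u G G" by (rule ctx_trans[OF _ ctx_sym])
lemma sub_refl1: "subeq u G g g' D \<Longrightarrow> subeq u G g g D" by (rule sub_trans[OF _ sub_sym])
lemma ty_refl1: "tyeq u G A A' \<Longrightarrow> tyeq u G A A" by (rule ty_trans[OF _ ty_sym])

text \<open>Symmetry and transitivity suffice for contexts; in the next three lemmas the
  preservation rules also exchange the representatives of contexts and types, in both
  directions.\<close>

lemma ctx_cls_eq:
  assumes "ctxeq u G G'"
  shows "ctx_cls u G = ctx_cls u G'"
  unfolding ctx_cls_def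
  by (intro Collect_cong iffI; erule ctx_trans[OF ctx_sym[OF assms]] ctx_trans[OF assms])

lemma sub_cls_eq:
  assumes "ctxeq u G G'" "ctxeq u D D'" "subeq u G g g' D"
  shows "sub_cls u G g D = sub_cls u G' g' D'"
  unfolding sub_cls_def
  by (intro Collect_cong iffI; erule sub_pres[OF assms(1,2) sub_trans[OF sub_sym[OF assms(3)]]]
      sub_trans[OF assms(3) sub_pres[OF ctx_sym[OF assms(1)] ctx_sym[OF assms(2)]]])

lemma ty_cls_eq:
  assumes "ctxeq u G G'" "tyeq u G A A'"
  shows "ty_cls u G A = ty_cls u G' A'"
  unfolding ty_cls_def
  by (intro Collect_cong iffI; erule ty_pres[OF assms(1) ty_trans[OF ty_sym[OF assms(2)]]]
      ty_trans[OF assms(2) ty_pres[OF ctx_sym[OF assms(1)]]])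

lemma tm_cls_eq:
  assumes "ctxeq u G G'" "tyeq u G A A'" "tmeq u G a a' A"
  shows "tm_cls u G a A = tm_cls u G' a' A'"
  unfolding tm_cls_def
  by (intro Collect_cong iffI; erule tm_pres[OF assms(1,2) tm_trans[OF tm_sym[OF assms(3)]]]
      tm_trans[OF assms(3) tm_pres[OF ctx_sym[OF assms(1)] ty_pres[OF assms(1) ty_sym[OF assms(2)]]]])

text \<open>The way back from classes to derivations. Meaningless expressions have empty classes,
  hence the reflexivity premise on one side.\<close>

lemma ctx_clsD: "\<lbrakk>ctx_cls u G = ctx_cls u G'; ctxeq u G' G'\<rbrakk> \<Longrightarrow> ctxeq u G G'"
  unfolding ctx_cls_def by blast

lemma sub_clsD: "\<lbrakk>sub_cls u G g D = sub_cls u G g' D; subeq u G g' g' D\<rbrakk> \<Longrightarrow> subeq u G g g' D"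
  unfolding sub_cls_def by blast

lemma ty_clsD: "\<lbrakk>ty_cls u G A = ty_cls u G A'; tyeq u G A' A'\<rbrakk> \<Longrightarrow> tyeq u G A A'"
  unfolding ty_cls_def by blast

lemma tm_clsD: "\<lbrakk>tm_cls u G a A = tm_cls u G a' A; tmeq u G a' a' A\<rbrakk> \<Longrightarrow> tmeq u G a a' A"
  unfolding tm_cls_def by blast

lemma rep_in: "x \<in> X \<Longrightarrow> rep X \<in> X"
  unfolding rep_def by (rule someI)

lemma rep_ctx: "ctxeq u G G \<Longrightarrow> ctxeq u G (rep (ctx_cls u G))"
  using rep_in[of G "ctx_cls u G"] unfolding ctx_cls_def by simp

lemma rep_sub: "subeq u G g g D \<Longrightarrow> subeq u G g (rep (sub_cls u G g D)) D"
  using rep_in[of g "sub_cls u G g D"] unfolding sub_cls_def by simp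

lemma rep_ty: "tyeq u G A A \<Longrightarrow> tyeq u G A (rep (ty_cls u G A))"
  using rep_in[of A "ty_cls u G A"] unfolding ty_cls_def by simp

lemma rep_tm: "tmeq u G a a A \<Longrightarrow> tmeq u G a (rep (tm_cls u G a A)) A"
  using rep_in[of a "tm_cls u G a A"] unfolding tm_cls_def by simp

lemma tm_conv: "\<lbrakk>ctxeq u G G; tyeq u G A A'; tmeq u G a a' A\<rbrakk> \<Longrightarrow> tmeq u G a a' A'"
  by (rule tm_pres)

lemma slift_cong:
  assumes "ctxeq u D D" "tyeq u G A A'" "subeq u D g g' G"
  shows "subeq u (CExt D (TSub A g)) (slift A g) (slift A' g') (CExt G A)"
proof -
  have r: "tyeq u G A A" "subeq u D g g G"
    using ty_refl1[OF assms(2)] sub_refl1[OF assms(3)] .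
  note t = ty_sub_cong[OF assms(2,3)] and t' = ty_sub_cong[OF r]
  have c: "subeq u (CExt D (TSub A g)) (SComp g (SProj (TSub A g))) (SComp g' (SProj (TSub A' g'))) G"
    using comp_cong[OF proj_cong[OF t] assms(3)] .
  \<comment> \<open>The variable has type \<open>A[g][p]\<close>, while pairing asks for A at the
    composite of \<open>g\<close> with p.\<close>
  have "tmeq u (CExt D (TSub A g)) (EVar (TSub A g)) (EVar (TSub A' g')) (TSub A (SComp g (SProj (TSub A g))))"
    by (rule tm_conv[OF ext_cong[OF assms(1) t'] ty_sym[OF ty_sub_comp[OF r proj_cong[OF t']]] var_cong[OF t]])
  then show ?thesis
    unfolding slift_def using sub_ext_cong[OF assms(2) c] by blast
qed

lemma sinst_cong:
  assumes "ctxeq u G G'" "tyeq u G A A'" "tmeq u G a a' A"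
  shows "subeq u G (sinst G A a) (sinst G' A' a') (CExt G A)"
proof -
  have r: "tyeq u G A A" "ctxeq u G G"
    using ty_refl1[OF assms(2)] ctx_refl1[OF assms(1)] .
  show ?thesis
    unfolding sinst_def
    by (rule sub_ext_cong[OF assms(2) id_cong[OF assms(1)] tm_conv[OF r(2) ty_sym[OF ty_sub_id[OF r(1)]] assms(3)]])
qed

section \<open>Carriers and operations of the syntactic cwf at given representatives\<close>

context
  fixes u :: n1_uniqueness
begin

lemma Ctx_syn: "X \<in> Ctx (syn_cwf u) \<longleftrightarrow> (\<exists>G. X = ctx_cls u G \<and> ctxeq u G G)"
  unfolding syn_cwf_def by auto

text \<open>A carrier collects classes formed over any representatives of its contexts; preservation
  moves such a class to the representatives at hand. Types and terms are treated likewise.\<close>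

lemma Sub_syn: "\<lbrakk>ctxeq u G G; ctxeq u D D\<rbrakk>
  \<Longrightarrow> s \<in> Sub (syn_cwf u) (ctx_cls u G) (ctx_cls u D) \<longleftrightarrow> (\<exists>g. s =
    sub_cls u G g D \<and> subeq u G g g D)"
  by (rule iffI; clarsimp simp: syn_cwf_def ctx_cls_def)
    (use sub_cls_eq[OF ctx_sym ctx_sym] sub_pres[OF ctx_sym ctx_sym] in \<open>fast\<close>)+

lemma Ty_syn: "ctxeq u G G
  \<Longrightarrow> X \<in> Ty (syn_cwf u) (ctx_cls u G) \<longleftrightarrow> (\<exists>A. X = ty_cls u G A
    \<and> tyeq u G A A)"
  by (rule iffI; clarsimp simp: syn_cwf_def ctx_cls_def)
    (use ty_cls_eq[OF ctx_sym] ty_pres[OF ctx_sym] in \<open>fast\<close>)+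

lemma Tm_syn: "\<lbrakk>ctxeq u G G; tyeq u G A A\<rbrakk>
  \<Longrightarrow> x \<in> Tm (syn_cwf u) (ctx_cls u G) (ty_cls u G A) \<longleftrightarrow> (\<exists>a. x =
    tm_cls u G a A \<and> tmeq u G a a A)"
proof
  assume G: "ctxeq u G G" and A: "tyeq u G A A" and x: "x \<in> Tm (syn_cwf u) (ctx_cls u G) (ty_cls u G A)"
  from x obtain G' a A' where x: "x = tm_cls u G' a A'" "ctxeq u G G'" "tyeq u G A A'" "tmeq u G' a a A'"
    unfolding syn_cwf_def ctx_cls_def ty_cls_def by auto
  note c = ctx_sym[OF x(2)] and t = ty_pres[OF x(2) ty_sym[OF x(3)]]
  show "\<exists>a. x = tm_cls u G a A \<and> tmeq u G a a A"
    using tm_cls_eq[OF c t x(4)] tm_pres[OF c t x(4)] x(1) by blast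
qed (auto simp: syn_cwf_def ctx_cls_def ty_cls_def)

text \<open>This and the following computation rules remove \<open>rep\<close>: by congruence the
  class built from chosen representatives is the class built from the given ones.\<close>

lemma id_syn: "ctxeq u G G \<Longrightarrow> id_sub (syn_cwf u) (ctx_cls u G) = sub_cls u G (SId G) G"
  unfolding syn_cwf_def by (simp, rule sym, intro sub_cls_eq id_cong rep_ctx)

lemma comp_syn: "\<lbrakk>ctxeq u G G; ctxeq u K K; subeq u G d d D; subeq u D g g K\<rbrakk>
  \<Longrightarrow> comp_sub (syn_cwf u) (ctx_cls u G) (ctx_cls u D) (ctx_cls u K) (sub_cls u D g K) (sub_cls u G d D)
    = sub_cls u G (SComp g d) K"
  unfolding syn_cwf_def by (simp, rule sym, intro sub_cls_eq rep_ctx comp_cong[OF rep_sub rep_sub])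

lemma ty_sub_syn: "\<lbrakk>ctxeq u G G; tyeq u D A A; subeq u G g g D\<rbrakk>
  \<Longrightarrow> ty_sub (syn_cwf u) (ctx_cls u G) (ctx_cls u D) (ty_cls u D A) (sub_cls u G g D) = ty_cls u G (TSub A g)"
  unfolding syn_cwf_def by (simp, rule sym, intro ty_cls_eq rep_ctx ty_sub_cong[OF rep_ty rep_sub])

lemma tm_sub_syn: "\<lbrakk>ctxeq u G G; tyeq u D A A; tmeq u D a a A; subeq u G g g D\<rbrakk>
  \<Longrightarrow> tm_sub (syn_cwf u) (ctx_cls u G) (ctx_cls u D) (ty_cls u D A) (tm_cls u D a A) (sub_cls u G g D)
    = tm_cls u G (ESub a g) (TSub A g)"
  unfolding syn_cwf_def
  by (simp, rule sym, intro tm_cls_eq rep_ctx ty_sub_cong[OF rep_ty rep_sub] tm_sub_cong[OF rep_tm rep_sub])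

lemma unit_syn: "unit_ctx (syn_cwf u) = ctx_cls u CUnit"
  unfolding syn_cwf_def by simp

lemma ext_syn: "\<lbrakk>ctxeq u G G; tyeq u G A A\<rbrakk>
  \<Longrightarrow> ext (syn_cwf u) (ctx_cls u G) (ty_cls u G A) = ctx_cls u (CExt G A)"
  unfolding syn_cwf_def by (simp, rule sym, intro ctx_cls_eq ext_cong rep_ctx rep_ty)

lemma pr_syn: "\<lbrakk>ctxeq u G G; tyeq u G A A\<rbrakk>
  \<Longrightarrow> pr (syn_cwf u) (ctx_cls u G) (ty_cls u G A) = sub_cls u (CExt G A) (SProj A) G"
  unfolding syn_cwf_def by (simp, rule sym, intro sub_cls_eq proj_cong ext_cong rep_ctx rep_ty)

lemma vr_syn: "\<lbrakk>ctxeq u G G; tyeq u G A A\<rbrakk>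
  \<Longrightarrow> vr (syn_cwf u) (ctx_cls u G) (ty_cls u G A) = tm_cls u (CExt G A) (EVar A) (TSub A (SProj A))"
  unfolding syn_cwf_def
  by (simp, rule sym, intro tm_cls_eq var_cong ty_sub_cong[OF rep_ty proj_cong] ext_cong rep_ctx rep_ty)

lemmas cls_syn = id_syn comp_syn ty_sub_syn tm_sub_syn unit_syn ext_syn pr_syn vr_syn
lemmas mem_syn = Ctx_syn Sub_syn Ty_syn Tm_syn

text \<open>A variable under a substitution into an extension is typed over \<open>A[p][h]\<close>,
  but as the second component of a pair it is needed over the first component
  \<open>k\<close>.\<close>

lemma conv_syn:
  assumes "tyeq u D A A" "subeq u G h h (CExt D A)" "subeq u G (SComp (SProj A) h) k D"
  shows "tyeq u G (TSub (TSub A (SProj A)) h) (TSub A k)"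
  using ty_trans[OF ty_sym[OF ty_sub_comp[OF assms(1) proj_cong[OF assms(1)] assms(2)]] ty_sub_cong[OF assms(1,3)]] .

text \<open>The existence half of the universal property, kept apart because it also computes
  \<open>sub_ext\<close> in \<open>sub_ext_syn\<close> once the cwf laws are known.\<close>

lemma sub_ext_syn_char:
  assumes "ctxeq u G G" "ctxeq u D D" "tyeq u D A A" "subeq u G g g D" "tmeq u G a a (TSub A g)"
  defines "X \<equiv> ctx_cls u G" and "Y \<equiv> ctx_cls u D" and "T \<equiv> ty_cls u D A"
    and "t \<equiv> sub_cls u G (SExt g a A) (CExt D A)"
  shows "t \<in> Sub (syn_cwf u) X (ext (syn_cwf u) Y T)"
    and "comp_sub (syn_cwf u) X (ext (syn_cwf u) Y T) Y (pr (syn_cwf u) Y T) t = sub_cls u G g D"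
    and "tm_sub (syn_cwf u) X (ext (syn_cwf u) Y T) (ty_sub (syn_cwf u) (ext (syn_cwf u) Y T) Y T (pr (syn_cwf
      u) Y T)) (vr (syn_cwf u) Y T) t
      = tm_cls u G a (TSub A g)"
proof -
  note e = ext_cong[OF assms(2,3)] and p = proj_cong[OF assms(3)] and v = var_cong[OF assms(3)]
  note tp = ty_sub_cong[OF assms(3) p]
  note s = sub_ext_cong[OF assms(3-5)]
  note defs = X_def Y_def T_def t_def
  show "t \<in> Sub (syn_cwf u) X (ext (syn_cwf u) Y T)"
    unfolding defs using assms(1-5) e s by (auto simp: mem_syn cls_syn)
  show "comp_sub (syn_cwf u) X (ext (syn_cwf u) Y T) Y (pr (syn_cwf u) Y T) t = sub_cls u G g D"
    unfolding defs using assms(1-5) e p s by (simp add: cls_syn) (intro sub_cls_eq proj_sub_ext)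
  show "tm_sub (syn_cwf u) X (ext (syn_cwf u) Y T) (ty_sub (syn_cwf u) (ext (syn_cwf u) Y T) Y T (pr (syn_cwf
    u) Y T)) (vr (syn_cwf u) Y T) t
      = tm_cls u G a (TSub A g)"
    unfolding defs using assms(1-5) e p s v tp conv_syn[OF assms(3) s proj_sub_ext[OF assms(3-5)]]
    by (simp add: cls_syn) (intro tm_cls_eq tm_conv[OF _ ty_sym var_sub_ext])
qed

lemma cwf_syn: "cwf (syn_cwf u)"
proof -
  let ?K = "syn_cwf u"
  show ?thesis
  proof
    fix X assume "X \<in> Ctx ?K"
    then show "id_sub ?K X \<in> Sub ?K X X"
      by (clarsimp simp: mem_syn cls_syn) (intro exI conjI, rule refl, rule id_cong)
  next
    fix W X Y r s
    assume "W \<in> Ctx ?K" "X \<in> Ctx ?K" "Y \<in> Ctx ?K" "r \<in> Sub ?K W X" "s \<in> Sub ?K X Y"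
    then show "comp_sub ?K W X Y s r \<in> Sub ?K W Y"
      by (clarsimp simp: mem_syn cls_syn) (intro exI conjI, rule refl, blast intro: comp_cong)
  next
    fix W X Y Z s r t
    assume *: "W \<in> Ctx ?K" "X \<in> Ctx ?K" "Y \<in> Ctx ?K" "Z \<in> Ctx ?K"
      "s \<in> Sub ?K W X" "r \<in> Sub ?K X Y" "t \<in> Sub ?K Y Z"
    from *(1-4) obtain K G D L where c: "W = ctx_cls u K" "ctxeq u K K" "X = ctx_cls u G" "ctxeq u G G"
      "Y = ctx_cls u D" "ctxeq u D D" "Z = ctx_cls u L" "ctxeq u L L"
      by (auto simp: mem_syn)
    from * c obtain g d l where s: "s = sub_cls u K g G" "r = sub_cls u G d D" "t = sub_cls u D l L"
      and r: "subeq u K g g G" "subeq u G d d D" "subeq u D l l L"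
      by (auto simp: mem_syn)
    have "subeq u K (SComp d g) (SComp d g) D" "subeq u G (SComp l d) (SComp l d) L"
      using comp_cong r by blast+
    then show "comp_sub ?K W X Z (comp_sub ?K X Y Z t r) s
      = comp_sub ?K W Y Z t (comp_sub ?K W X Y r s)"
      using c r by (simp add: s cls_syn) (intro sub_cls_eq comp_assoc)
  next
    fix X Y s assume "X \<in> Ctx ?K" "Y \<in> Ctx ?K" "s \<in> Sub ?K X Y"
    then obtain G D g where c: "X = ctx_cls u G" "ctxeq u G G" "Y = ctx_cls u D" "ctxeq u D D"
      "s = sub_cls u G g D" "subeq u G g g D"
      by (auto simp: mem_syn)
    then show "comp_sub ?K X Y Y (id_sub ?K Y) s = s" "comp_sub ?K X X Y s (id_sub ?K X) = s"
      by (simp_all add: cls_syn id_cong)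
        (intro sub_cls_eq sub_sym[OF id_left] sub_sym[OF id_right]; assumption)+
  next
    fix X Y s A assume "X \<in> Ctx ?K" "Y \<in> Ctx ?K" "s \<in> Sub ?K X Y" "A \<in> Ty ?K Y"
    then show "ty_sub ?K X Y A s \<in> Ty ?K X"
      by (clarsimp simp: mem_syn cls_syn) (intro exI conjI, rule refl, blast intro: ty_sub_cong)
  next
    fix X A assume "X \<in> Ctx ?K" "A \<in> Ty ?K X"
    then show "ty_sub ?K X X A (id_sub ?K X) = A"
      by (clarsimp simp: mem_syn cls_syn id_cong) (intro ty_cls_eq ty_sub_id)
  next
    fix W X Y r s A
    assume *: "W \<in> Ctx ?K" "X \<in> Ctx ?K" "Y \<in> Ctx ?K" "r \<in> Sub ?K W X" "s \<in> Sub ?K X Y" "A \<in> Ty ?K Y"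
    from *(1-3) obtain K G D where c: "W = ctx_cls u K" "ctxeq u K K" "X = ctx_cls u G" "ctxeq u G G"
      "Y = ctx_cls u D" "ctxeq u D D"
      by (auto simp: mem_syn)
    from * c obtain d g B where s: "r = sub_cls u K d G" "s = sub_cls u G g D" "A = ty_cls u D B"
      and r: "subeq u K d d G" "subeq u G g g D" "tyeq u D B B"
      by (auto simp: mem_syn)
    have k: "subeq u K (SComp g d) (SComp g d) D" "tyeq u G (TSub B g) (TSub B g)"
      using comp_cong ty_sub_cong r by blast+
    then show "ty_sub ?K W Y A (comp_sub ?K W X Y s r) = ty_sub ?K W X (ty_sub ?K X Y A s) r"
      using c r by (simp add: s cls_syn) (intro ty_cls_eq ty_sub_comp)
    fix a assume "a \<in> Tm ?K Y A"
    then obtain b where b: "a = tm_cls u D b B" "tmeq u D b b B"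
      using c s r by (auto simp: mem_syn)
    have "tmeq u G (ESub b g) (ESub b g) (TSub B g)"
      using b r tm_sub_cong by blast
    then show "tm_sub ?K W Y A a (comp_sub ?K W X Y s r)
        = tm_sub ?K W X (ty_sub ?K X Y A s) (tm_sub ?K X Y A a s) r"
      using c r b k by (simp add: s cls_syn) (intro tm_cls_eq ty_sub_comp tm_sub_comp)
  next
    fix X Y s A a assume "X \<in> Ctx ?K" "Y \<in> Ctx ?K" "s \<in> Sub ?K X Y" "A \<in> Ty ?K Y" "a \<in> Tm ?K Y A"
    then show "tm_sub ?K X Y A a s \<in> Tm ?K X (ty_sub ?K X Y A s)"
      by (clarsimp simp: mem_syn cls_syn ty_sub_cong) (intro exI conjI, rule refl, blast intro: tm_sub_cong)
  next
    fix X A a assume "X \<in> Ctx ?K" "A \<in> Ty ?K X" "a \<in> Tm ?K X A"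
    then show "tm_sub ?K X X A a (id_sub ?K X) = a"
      by (clarsimp simp: mem_syn cls_syn id_cong)
        (intro tm_cls_eq ty_sub_id tm_conv[OF _ ty_sym[OF ty_sub_id] tm_sub_id])
  next
    show "unit_ctx ?K \<in> Ctx ?K" by (auto simp: mem_syn cls_syn intro: unit_cong)
  next
    fix X assume "X \<in> Ctx ?K"
    then obtain G where G: "X = ctx_cls u G" "ctxeq u G G" by (auto simp: mem_syn)
    show "\<exists>!s. s \<in> Sub ?K X (unit_ctx ?K)"
      using G by (intro ex1I[of _ "sub_cls u G (SBang G) CUnit"])
        (clarsimp simp: mem_syn cls_syn unit_cong,
         (blast intro: bang_cong | intro sub_cls_eq bang_unique unit_cong; assumption))+
  next
    fix Y A assume "Y \<in> Ctx ?K" "A \<in> Ty ?K Y"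
    then obtain D B where c: "Y = ctx_cls u D" "ctxeq u D D" "A = ty_cls u D B" "tyeq u D B B"
      by (auto simp: mem_syn)
    note e = ext_cong[OF c(2,4)] and p = proj_cong[OF c(4)]
    show "ext ?K Y A \<in> Ctx ?K" "pr ?K Y A \<in> Sub ?K (ext ?K Y A) Y"
      using c e p by (auto simp: mem_syn cls_syn)
    show "vr ?K Y A \<in> Tm ?K (ext ?K Y A) (ty_sub ?K (ext ?K Y A) Y A (pr ?K Y A))"
      using c e p ty_sub_cong[OF c(4) p] by (auto simp: mem_syn cls_syn intro: var_cong)
  next
    fix X Y A s a
    assume *: "X \<in> Ctx ?K" "Y \<in> Ctx ?K" "A \<in> Ty ?K Y" "s \<in> Sub ?K X Y" "a \<in> Tm ?K X (ty_sub ?K X Y A s)"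
    from *(1-4) obtain G D B g where c: "X = ctx_cls u G" "ctxeq u G G" "Y = ctx_cls u D" "ctxeq u D D"
      "A = ty_cls u D B" "tyeq u D B B" "s = sub_cls u G g D" "subeq u G g g D"
      by (auto simp: mem_syn)
    note l = ty_sub_cong[OF c(6,8)]
    from * c l obtain b where b: "a = tm_cls u G b (TSub B g)" "tmeq u G b b (TSub B g)"
      by (auto simp: mem_syn cls_syn)
    note e = ext_cong[OF c(4,6)] and p = proj_cong[OF c(6)] and v = var_cong[OF c(6)]
    note tp = ty_sub_cong[OF c(6) p]
    note s = sub_ext_cong[OF c(6,8) b(2)]
    note conv = conv_syn[OF c(6)]
    show "\<exists>!t. t \<in> Sub ?K X (ext ?K Y A) \<and>
              comp_sub ?K X (ext ?K Y A) Y (pr ?K Y A) t = s \<and>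
              tm_sub ?K X (ext ?K Y A) (ty_sub ?K (ext ?K Y A) Y A (pr ?K Y A)) (vr ?K Y A) t = a"
    proof (intro ex1I conjI)
      note s = sub_ext_syn_char[OF c(2,4,6,8) b(2)]
      show "sub_cls u G (SExt g b B) (CExt D B) \<in> Sub ?K X (ext ?K Y A)"
        unfolding c(1,3,5) by (rule s(1))
      show "comp_sub ?K X (ext ?K Y A) Y (pr ?K Y A) (sub_cls u G (SExt g b B) (CExt D B)) = s"
        unfolding c(1,3,5,7) by (rule s(2))
      show "tm_sub ?K X (ext ?K Y A) (ty_sub ?K (ext ?K Y A) Y A (pr ?K Y A)) (vr ?K Y A)
          (sub_cls u G (SExt g b B) (CExt D B)) = a"
        unfolding c(1,3,5) b(1) by (rule s(3))
      fix t
      assume th: "t \<in> Sub ?K X (ext ?K Y A) \<and>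
              comp_sub ?K X (ext ?K Y A) Y (pr ?K Y A) t = s \<and>
              tm_sub ?K X (ext ?K Y A) (ty_sub ?K (ext ?K Y A) Y A (pr ?K Y A)) (vr ?K Y A) t = a"
      then obtain h where h: "t = sub_cls u G h (CExt D B)" "subeq u G h h (CExt D B)"
        using c e by (auto simp: mem_syn cls_syn)
      have 1: "subeq u G (SComp (SProj B) h) g D"
        using th c e p h by (auto simp: cls_syn intro!: sub_clsD)
      have "tm_cls u G (ESub (EVar B) h) (TSub (TSub B (SProj B)) h) = a"
        using th c e p h v tp by (auto simp: cls_syn)
      then have "tm_cls u G (ESub (EVar B) h) (TSub B g) = tm_cls u G b (TSub B g)"
        using tm_cls_eq[OF c(2) conv[OF h(2) 1] tm_sub_cong[OF v h(2)]] b by simp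
      then have 2: "tmeq u G (ESub (EVar B) h) b (TSub B g)"
        using b by (auto intro: tm_clsD)
      \<comment> \<open>\<open>sub_ext_cong\<close> types the second components over the first
        component on its left, which is \<open>SComp (SProj B) h\<close> here.\<close>
      have 3: "tmeq u G (ESub (EVar B) h) b (TSub B (SComp (SProj B) h))"
        using tm_conv[OF c(2) ty_sym[OF ty_sub_cong[OF c(6) 1]] 2] .
      show "t = sub_cls u G (SExt g b B) (CExt D B)"
        unfolding h(1)
        by (intro sub_cls_eq c e sub_trans[OF sub_ext_eta[OF c(6) h(2)]] sub_ext_cong 1 3)
    qed
  qed
qed

interpretation syn: cwf "syn_cwf u" by (rule cwf_syn)

lemma sub_ext_syn:
  assumes "ctxeq u G G" "ctxeq u D D" "tyeq u D A A" "subeq u G g g D" "tmeq u G a a (TSub A g)"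
  shows "sub_ext (syn_cwf u) (ctx_cls u G) (ctx_cls u D) (ty_cls u D A) (sub_cls u G g D) (tm_cls u G a (TSub A g))
    = sub_cls u G (SExt g a A) (CExt D A)"
  using assms by (intro syn.sub_ext_eqI[symmetric] sub_ext_syn_char) (auto simp: mem_syn)

lemma lift_syn:
  assumes "ctxeq u G G" "ctxeq u D D" "tyeq u D A A" "subeq u G g g D"
  shows "lift (syn_cwf u) (ctx_cls u G) (ctx_cls u D) (ty_cls u D A) (sub_cls u G g D)
    = sub_cls u (CExt G (TSub A g)) (slift A g) (CExt D A)"
proof -
  note t = ty_sub_cong[OF assms(3,4)]
  note p = proj_cong[OF t] and e = ext_cong[OF assms(1) t] and v = var_cong[OF t]
  note c = comp_cong[OF p assms(4)]
  note k = ty_sym[OF ty_sub_comp[OF assms(3,4) p]]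
  show ?thesis
    unfolding lift_def Let_def using assms t p e v c
    by (simp add: cls_syn slift_def tm_cls_eq[OF e k v] sub_ext_syn tm_conv[OF e k v])
qed

lemma inst_syn:
  assumes "ctxeq u G G" "tyeq u G A A" "tmeq u G a a A"
  shows "inst (syn_cwf u) (ctx_cls u G) (ty_cls u G A) (tm_cls u G a A) = sub_cls u G (sinst G A a) (CExt G A)"
proof -
  note k = ty_sym[OF ty_sub_id[OF assms(2)]]
  show ?thesis
    unfolding inst_def using assms
    by (simp add: cls_syn sinst_def tm_cls_eq[OF assms(1) k assms(3)] sub_ext_syn id_cong tm_conv[OF assms(1) k assms(3)])
qed

lemma id_ty_syn: "\<lbrakk>ctxeq u G G; tyeq u G A A; tmeq u G a a A; tmeq u G b b A\<rbrakk>
  \<Longrightarrow> id_ty (syn_cwf u) (ctx_cls u G) (ty_cls u G A) (tm_cls u G a A) (tm_cls u G b A) = ty_cls u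
    G (TId A a b)"
  unfolding syn_cwf_def
  by (simp, rule sym, intro ty_cls_eq rep_ctx idty_cong[OF rep_ty rep_tm rep_tm])

lemma refl_tm_syn:
  assumes "ctxeq u G G" "tyeq u G A A" "tmeq u G a a A"
  shows "refl_tm (syn_cwf u) (ctx_cls u G) (ty_cls u G A) (tm_cls u G a A) = tm_cls u G (ERefl a) (TId A a a)"
proof -
  let ?A = "rep (ty_cls u G A)" and ?a = "rep (tm_cls u G a A)"
  note r = rep_ty[OF assms(2)] rep_tm[OF assms(3)]
  \<comment> \<open>The congruence rule types this equation over \<open>TId A a ?a\<close>, so a
    conversion is needed.\<close>
  have "tmeq u G (ERefl a) (ERefl ?a) (TId A a a)"
    using tm_conv[OF assms(1) idty_cong[OF assms(2,3) tm_sym[OF r(2)]] refl_cong[OF r(2)]] .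
  then show ?thesis
    unfolding syn_cwf_def
    by (simp, intro tm_cls_eq[symmetric] rep_ctx assms idty_cong r)
qed

lemma n1_ty_syn: "n1_ty (syn_cwf u) = ty_cls u CUnit TN1" and zero_tm_syn: "zero_tm (syn_cwf u) = tm_cls u CUnit EZero TN1"
  unfolding syn_cwf_def by simp_all

lemma sigma_ty_syn: "\<lbrakk>ctxeq u G G; tyeq u G A A; tyeq u (CExt G A) B B\<rbrakk>
  \<Longrightarrow> sigma_ty (syn_cwf u) (ctx_cls u G) (ty_cls u G A) (ty_cls u (CExt G A) B) = ty_cls u G (TSigma A B)"
  unfolding syn_cwf_def
  by (simp, rule sym, intro ty_cls_eq rep_ctx sigma_cong[OF rep_ty rep_ty])

lemma pi_ty_syn: "\<lbrakk>ctxeq u G G; tyeq u G A A; tyeq u (CExt G A) B B\<rbrakk>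
  \<Longrightarrow> pi_ty (syn_cwf u) (ctx_cls u G) (ty_cls u G A) (ty_cls u (CExt G A) B) = ty_cls u G (TPi A B)"
  unfolding syn_cwf_def
  by (simp, rule sym, intro ty_cls_eq rep_ctx pi_cong[OF rep_ty rep_ty])

lemma pair_tm_syn: "\<lbrakk>ctxeq u G G; tyeq u G A A; tyeq u (CExt G A) B B; tmeq u G a a A;
    tmeq u G b b (TSub B (sinst G A a))\<rbrakk>
  \<Longrightarrow> pair_tm (syn_cwf u) (ctx_cls u G) (ty_cls u G A) (ty_cls u (CExt G A) B) (tm_cls u G a A)
      (tm_cls u G b (TSub B (sinst G A a)))
    = tm_cls u G (EPair A B a b) (TSigma A B)"
  unfolding syn_cwf_def
  by (simp, rule sym, intro tm_cls_eq rep_ctx sigma_cong[OF rep_ty rep_ty]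
      pair_cong[OF rep_ty rep_ty rep_tm rep_tm])

lemma fst_tm_syn: "\<lbrakk>ctxeq u G G; tyeq u G A A; tyeq u (CExt G A) B B; tmeq u G c c (TSigma A B)\<rbrakk>
  \<Longrightarrow> fst_tm (syn_cwf u) (ctx_cls u G) (ty_cls u G A) (ty_cls u (CExt G A) B) (tm_cls u G c (TSigma A B))
    = tm_cls u G (EFst A c) A"
  unfolding syn_cwf_def
  by (simp, rule sym, intro tm_cls_eq rep_ctx rep_ty fst_cong[OF rep_ty _ rep_tm])

lemma inst_fst_cong:
  assumes "ctxeq u G G'" "tyeq u G A A'" "tyeq u (CExt G A) B B'" "tmeq u G c c' (TSigma A B)"
  shows "tyeq u G (TSub B (sinst G A (EFst A c))) (TSub B' (sinst G' A' (EFst A' c')))"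
  using ty_sub_cong[OF assms(3) sinst_cong[OF assms(1,2) fst_cong[OF assms(2) ty_refl1[OF assms(3)] assms(4)]]] .

lemma snd_tm_syn: "\<lbrakk>ctxeq u G G; tyeq u G A A; tyeq u (CExt G A) B B; tmeq u G c c (TSigma A B)\<rbrakk>
  \<Longrightarrow> snd_tm (syn_cwf u) (ctx_cls u G) (ty_cls u G A) (ty_cls u (CExt G A) B) (tm_cls u G c (TSigma A B))
    = tm_cls u G (ESnd A B c) (TSub B (sinst G A (EFst A c)))"
  unfolding syn_cwf_def
  by (simp, rule sym, intro tm_cls_eq rep_ctx snd_cong[OF rep_ty rep_ty rep_tm]
      inst_fst_cong[OF rep_ctx rep_ty rep_ty rep_tm])

lemma lam_tm_syn: "\<lbrakk>ctxeq u G G; tyeq u G A A; tyeq u (CExt G A) B B; tmeq u (CExt G A) b b B\<rbrakk>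
  \<Longrightarrow> lam_tm (syn_cwf u) (ctx_cls u G) (ty_cls u G A) (ty_cls u (CExt G A) B) (tm_cls u (CExt G A) b B)
    = tm_cls u G (ELam A b) (TPi A B)"
  unfolding syn_cwf_def
  by (simp, rule sym, intro tm_cls_eq rep_ctx pi_cong[OF rep_ty rep_ty] lam_cong[OF rep_ty _ rep_tm])

lemma app_tm_syn: "\<lbrakk>ctxeq u G G; tyeq u G A A; tyeq u (CExt G A) B B; tmeq u G c c (TPi A B); tmeq u G a a A\<rbrakk>
  \<Longrightarrow> app_tm (syn_cwf u) (ctx_cls u G) (ty_cls u G A) (ty_cls u (CExt G A) B) (tm_cls u G c (TPi
    A B)) (tm_cls u G a A)
    = tm_cls u G (EApp A B c a) (TSub B (sinst G A a))"
  unfolding syn_cwf_def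
  by (simp, rule sym, intro tm_cls_eq rep_ctx ty_sub_cong[OF rep_ty sinst_cong[OF rep_ctx rep_ty rep_tm]]
      app_cong[OF rep_ty rep_ty rep_tm rep_tm])

text \<open>Not derived rule by rule: it is \<open>ty_sub_inst\<close> in the syntactic cwf, read
  back from classes.\<close>

lemma ty_inst_sub:
  assumes "ctxeq u G G" "ctxeq u D D" "tyeq u D A A" "tyeq u (CExt D A) B B" "subeq u G g g D"
    "tmeq u D a a A"
  shows "tyeq u G (TSub (TSub B (sinst D A a)) g)
    (TSub (TSub B (slift A g)) (sinst G (TSub A g) (ESub a g)))"
proof (rule ty_clsD)
  note t = ty_sub_cong[OF assms(3,5)] and a = tm_sub_cong[OF assms(6,5)]
  note e = ext_cong[OF assms(2,3)] and e' = ext_cong[OF assms(1) t]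
  note i = sinst_cong[OF assms(2,3,6)] and i' = sinst_cong[OF assms(1) t a]
  note l = slift_cong[OF assms(1,3,5)]
  note B = ty_sub_cong[OF assms(4) l] and B' = ty_sub_cong[OF assms(4) i]
  show "tyeq u G (TSub (TSub B (slift A g)) (sinst G (TSub A g) (ESub a g)))
      (TSub (TSub B (slift A g)) (sinst G (TSub A g) (ESub a g)))"
    by (rule ty_sub_cong[OF B i'])
  show "ty_cls u G (TSub (TSub B (sinst D A a)) g)
    = ty_cls u G (TSub (TSub B (slift A g)) (sinst G (TSub A g) (ESub a g)))"
    using syn.ty_sub_inst[of "ctx_cls u G" "ctx_cls u D" "ty_cls u D A" "sub_cls u G g D"
        "tm_cls u D a A" "ty_cls u (CExt D A) B"] assms t a e e' i i' l B B'
    by (auto simp: mem_syn cls_syn lift_syn inst_syn)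
qed

lemmas ops_syn = cls_syn lift_syn inst_syn id_ty_syn refl_tm_syn n1_ty_syn zero_tm_syn sigma_ty_syn
  pi_ty_syn pair_tm_syn fst_tm_syn snd_tm_syn lam_tm_syn app_tm_syn

end

section \<open>Type formers of the syntactic cwf\<close>

lemma supports_I_syn: "supports_I (syn_cwf u)"
proof -
  interpret syn: cwf "syn_cwf u" by (rule cwf_syn)
  let ?K = "syn_cwf u"
  show ?thesis
  proof
    fix X A a a'
    assume *: "X \<in> Ctx ?K" "A \<in> Ty ?K X" "a \<in> Tm ?K X A" "a' \<in> Tm ?K X A"
    from *(1,2) obtain G B where c: "X = ctx_cls u G" "ctxeq u G G" "A = ty_cls u G B" "tyeq u G B B"
      by (auto simp: mem_syn)
    with * obtain b b' where b: "a = tm_cls u G b B" "tmeq u G b b B" "a' = tm_cls u G b' B" "tmeq u G b' b' B"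
      by (auto simp: mem_syn)
    note t = idty_cong[OF c(4) b(2) b(4)]
    show "id_ty ?K X A a a' \<in> Ty ?K X"
      using c b t by (auto simp: mem_syn ops_syn)
    fix z assume "z \<in> Tm ?K X (id_ty ?K X A a a')"
    then obtain x where x: "z = tm_cls u G x (TId B b b')" "tmeq u G x x (TId B b b')"
      using c b t by (auto simp: mem_syn ops_syn)
    note r = reflection[OF x(2)]
    have "z = refl_tm ?K X A a"
      using c b x tm_cls_eq[OF c(2) idty_cong[OF c(4) b(2) tm_sym[OF r]] refl_unique[OF x(2)]]
      by (simp add: ops_syn)
    moreover have "a = a'" using b tm_cls_eq[OF c(2,4) r] by simp
    ultimately show "a = a' \<and> z = refl_tm ?K X A a" by blast
  next
    fix X A a
    assume *: "X \<in> Ctx ?K" "A \<in> Ty ?K X" "a \<in> Tm ?K X A"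
    then obtain G B b where c: "X = ctx_cls u G" "ctxeq u G G" "A = ty_cls u G B" "tyeq u G B B"
      "a = tm_cls u G b B" "tmeq u G b b B"
      by (auto simp: mem_syn)
    then show "refl_tm ?K X A a \<in> Tm ?K X (id_ty ?K X A a a)"
      using refl_cong[OF c(6)] idty_cong[OF c(4,6,6)] by (auto simp: mem_syn ops_syn)
  next
    fix X Y s A a a'
    assume *: "X \<in> Ctx ?K" "Y \<in> Ctx ?K" "s \<in> Sub ?K X Y" "A \<in> Ty ?K Y"
      "a \<in> Tm ?K Y A" "a' \<in> Tm ?K Y A"
    from *(1,2,4) obtain G D B where c: "X = ctx_cls u G" "ctxeq u G G" "Y = ctx_cls u D" "ctxeq u D D"
      "A = ty_cls u D B" "tyeq u D B B"
      by (auto simp: mem_syn)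
    with * obtain b b' g where b: "a = tm_cls u D b B" "tmeq u D b b B" "a' = tm_cls u D b' B" "tmeq u D b' b' B"
      "s = sub_cls u G g D" "subeq u G g g D"
      by (auto simp: mem_syn)
    show "ty_sub ?K X Y (id_ty ?K Y A a a') s
        = id_ty ?K X (ty_sub ?K X Y A s) (tm_sub ?K X Y A a s) (tm_sub ?K X Y A a' s)"
      using c b idty_cong[OF c(6) b(2,4)] ty_sub_cong[OF c(6) b(6)] tm_sub_cong[OF b(2,6)] tm_sub_cong[OF b(4,6)]
      by (simp add: ops_syn) (intro ty_cls_eq idty_sub)
  next
    fix X Y s A a
    assume *: "X \<in> Ctx ?K" "Y \<in> Ctx ?K" "s \<in> Sub ?K X Y" "A \<in> Ty ?K Y"
      "a \<in> Tm ?K Y A"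
    from *(1,2,4) obtain G D B where c: "X = ctx_cls u G" "ctxeq u G G" "Y = ctx_cls u D" "ctxeq u D D"
      "A = ty_cls u D B" "tyeq u D B B"
      by (auto simp: mem_syn)
    with * obtain b g where b: "a = tm_cls u D b B" "tmeq u D b b B"
      "s = sub_cls u G g D" "subeq u G g g D"
      by (auto simp: mem_syn)
    note bs = tm_sub_cong[OF b(2,4)]
    \<comment> \<open>The calculus has no rule for substitution into \<open>ERefl\<close>. The
      substituted term inhabits an identity type with equal ends, and \<open>refl_unique\<close>
      identifies it.\<close>
    have 1: "tmeq u G (ESub (ERefl b) g) (ESub (ERefl b) g) (TId (TSub B g) (ESub b g) (ESub b g))"
      using tm_conv[OF c(2) idty_sub[OF c(6) b(2,2,4)] tm_sub_cong[OF refl_cong[OF b(2)] b(4)]] .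
    have 2: "tmeq u G (ESub (ERefl b) g) (ERefl (ESub b g)) (TSub (TId B b b) g)"
      by (rule tm_conv[OF c(2) ty_sym[OF idty_sub[OF c(6) b(2,2,4)]] refl_unique[OF 1]])
    show "tm_sub ?K X Y (id_ty ?K Y A a a) (refl_tm ?K Y A a) s
        = refl_tm ?K X (ty_sub ?K X Y A s) (tm_sub ?K X Y A a s)"
      using c b 2 idty_cong[OF c(6) b(2,2)] ty_sub_cong[OF c(6) b(4)] bs refl_cong[OF b(2)]
      by (simp add: ops_syn) (intro tm_cls_eq idty_sub)
  qed
qed

lemma supports_N1_syn: "supports_N1 (syn_cwf u)"
proof -
  interpret syn: cwf "syn_cwf u" by (rule cwf_syn)
  let ?K = "syn_cwf u"
  show ?thesis
  proof
    show "n1_ty ?K \<in> Ty ?K (unit_ctx ?K)"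
      using n1_cong unit_cong by (auto simp: mem_syn ops_syn)
    show "zero_tm ?K \<in> Tm ?K (unit_ctx ?K) (n1_ty ?K)"
      using n1_cong unit_cong zero_cong by (auto simp: mem_syn ops_syn)
    fix a assume "a \<in> Tm ?K (unit_ctx ?K) (n1_ty ?K)"
    then obtain b where "a = tm_cls u CUnit b TN1" "tmeq u CUnit b b TN1"
      using n1_cong unit_cong by (auto simp: mem_syn ops_syn)
    then show "a = zero_tm ?K"
      by (simp add: ops_syn) (intro tm_cls_eq unit_cong n1_cong n1_unique)
  qed
qed

lemma syn_ext_cases:
  assumes "X \<in> Ctx (syn_cwf u)" "A \<in> Ty (syn_cwf u) X" "B \<in> Ty (syn_cwf u) (ext (syn_cwf u) X A)"
  obtains G T U where "X = ctx_cls u G" "ctxeq u G G" "A = ty_cls u G T" "tyeq u G T T"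
    "ctxeq u (CExt G T) (CExt G T)" "B = ty_cls u (CExt G T) U" "tyeq u (CExt G T) U U"
proof -
  from assms(1,2) obtain G T where c: "X = ctx_cls u G" "ctxeq u G G" "A = ty_cls u G T" "tyeq u G T T"
    by (auto simp: mem_syn)
  note e = ext_cong[OF c(2,4)]
  from assms(3) obtain U where "B = ty_cls u (CExt G T) U" "tyeq u (CExt G T) U U"
    using c e by (auto simp: mem_syn ops_syn)
  then show ?thesis using that c e by blast
qed

lemma supports_Sigma_syn: "supports_Sigma (syn_cwf u)"
proof -
  interpret syn: cwf "syn_cwf u" by (rule cwf_syn)
  let ?K = "syn_cwf u"
  show ?thesis
  proof
    fix X A B
    assume *: "X \<in> Ctx ?K" "A \<in> Ty ?K X" "B \<in> Ty ?K (ext ?K X A)"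
    from * obtain G T U where c: "X = ctx_cls u G" "ctxeq u G G" "A = ty_cls u G T" "tyeq u G T T"
      "ctxeq u (CExt G T) (CExt G T)" "B = ty_cls u (CExt G T) U" "tyeq u (CExt G T) U U"
      by (rule syn_ext_cases)
    note s = sigma_cong[OF c(4,7)]
    show "sigma_ty ?K X A B \<in> Ty ?K X"
      using c s by (auto simp: mem_syn ops_syn)
    {
      fix c assume "c \<in> Tm ?K X (sigma_ty ?K X A B)"
      then obtain x where x: "c = tm_cls u G x (TSigma T U)" "tmeq u G x x (TSigma T U)"
        using c s by (auto simp: mem_syn ops_syn)
      note f = fst_cong[OF c(4,7) x(2)] and sn = snd_cong[OF c(4,7) x(2)]
      note i = sinst_cong[OF c(2,4) f]
      note t = ty_sub_cong[OF c(7) i]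
      show "fst_tm ?K X A B c \<in> Tm ?K X A"
        using c x f by (auto simp: mem_syn ops_syn)
      show "snd_tm ?K X A B c
          \<in> Tm ?K X (ty_sub ?K X (ext ?K X A) B (inst ?K X A (fst_tm ?K X A B c)))"
        using c x f i t sn by (auto simp: mem_syn ops_syn)
      show "pair_tm ?K X A B (fst_tm ?K X A B c) (snd_tm ?K X A B c) = c"
        using c x f i t sn s by (simp add: ops_syn) (intro tm_cls_eq tm_sym[OF pair_eta])
    }
    fix a b assume ab: "a \<in> Tm ?K X A"
      "b \<in> Tm ?K X (ty_sub ?K X (ext ?K X A) B (inst ?K X A a))"
    from ab(1) obtain x where x: "a = tm_cls u G x T" "tmeq u G x x T"
      using c by (auto simp: mem_syn)
    note i = sinst_cong[OF c(2,4) x(2)]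
    note t = ty_sub_cong[OF c(7) i]
    from ab(2) obtain y where y: "b = tm_cls u G y (TSub U (sinst G T x))" "tmeq u G y y (TSub U (sinst G T x))"
      using c x i t by (auto simp: mem_syn ops_syn)
    note p = pair_cong[OF c(4,7) x(2) y(2)]
    note fp = fst_pair[OF c(4,7) x(2) y(2)] and sp = snd_pair[OF c(4,7) x(2) y(2)]
    show "pair_tm ?K X A B a b \<in> Tm ?K X (sigma_ty ?K X A B)"
      using c x y p s by (auto simp: mem_syn ops_syn)
    show "fst_tm ?K X A B (pair_tm ?K X A B a b) = a"
      using c x y p by (simp add: ops_syn) (intro tm_cls_eq fp)
    \<comment> \<open>\<open>snd\<close> of the pair is typed over its own first projection, while
      \<open>y\<close> is typed over \<open>x\<close>; the beta rule for \<open>fst\<close>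
      identifies the two types.\<close>
    have t': "tyeq u G (TSub U (sinst G T (EFst T (EPair T U x y)))) (TSub U (sinst G T x))"
      by (rule ty_sub_cong[OF c(7) sinst_cong[OF c(2,4) fp]])
    show "snd_tm ?K X A B (pair_tm ?K X A B a b) = b"
      using c x y p by (simp add: ops_syn) (intro tm_cls_eq t' tm_conv[OF _ ty_sym[OF t'] sp])
  next
    fix X Y s A B
    let ?A = "ty_sub ?K X Y A s"
    let ?B = "ty_sub ?K (ext ?K X ?A) (ext ?K Y A) B (lift ?K X Y A s)"
    assume *: "X \<in> Ctx ?K" "Y \<in> Ctx ?K" "s \<in> Sub ?K X Y" "A \<in> Ty ?K Y"
      "B \<in> Ty ?K (ext ?K Y A)"
    from *(2,4,5) obtain D T U where c: "Y = ctx_cls u D" "ctxeq u D D" "A = ty_cls u D T" "tyeq u D T T"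
      "ctxeq u (CExt D T) (CExt D T)" "B = ty_cls u (CExt D T) U" "tyeq u (CExt D T) U U"
      by (rule syn_ext_cases)
    from *(1,3) c(1,2) obtain G g where g: "X = ctx_cls u G" "ctxeq u G G" "s = sub_cls u G g D" "subeq u G g g D"
      by (auto simp: mem_syn)
    note s = sigma_cong[OF c(4,7)]
    note T' = ty_sub_cong[OF c(4) g(4)]
    note e' = ext_cong[OF g(2) T'] and l = slift_cong[OF g(2) c(4) g(4)]
    note U' = ty_sub_cong[OF c(7) l]
    note ss = sigma_sub[OF c(4,7) g(4)]
    show "ty_sub ?K X Y (sigma_ty ?K Y A B) s
        = sigma_ty ?K X ?A
            ?B"
      using c g s T' e' l U' by (simp add: ops_syn) (intro ty_cls_eq ss)
    {
      fix c assume "c \<in> Tm ?K Y (sigma_ty ?K Y A B)"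
      then obtain x where x: "c = tm_cls u D x (TSigma T U)" "tmeq u D x x (TSigma T U)"
        using c s by (auto simp: mem_syn ops_syn)
      note f = fst_cong[OF c(4,7) x(2)] and sn = snd_cong[OF c(4,7) x(2)]
      note x' = tm_sub_cong[OF x(2) g(4)]
      note xs = tm_conv[OF g(2) ss x'] and xe = tm_cls_eq[OF g(2) ss x']
      note i = sinst_cong[OF c(2,4) f]
      note t = ty_sub_cong[OF c(7) i]
      note fs = fst_sub[OF c(4,7) x(2) g(4)]
      \<comment> \<open>The substitution first passes the instantiation; then \<open>fst_sub\<close>
        rewrites the instantiating term.\<close>
      have ty: "tyeq u G (TSub (TSub U (sinst D T (EFst T x))) g)
          (TSub (TSub U (slift T g)) (sinst G (TSub T g) (EFst (TSub T g) (ESub x g))))"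
        using ty_trans[OF ty_inst_sub[OF g(2) c(2,4,7) g(4) f]
            ty_sub_cong[OF U' sinst_cong[OF g(2) T' fs]]] .
      show "tm_sub ?K X Y A (fst_tm ?K Y A B c) s
        = fst_tm ?K X ?A
            ?B
            (tm_sub ?K X Y (sigma_ty ?K Y A B) c s)"
        using c g s T' e' l U' x f x' xs xe by (simp add: ops_syn) (intro tm_cls_eq fs)
      show "tm_sub ?K X Y (ty_sub ?K Y (ext ?K Y A) B (inst ?K Y A (fst_tm ?K Y A B c)))
            (snd_tm ?K Y A B c) s
        = snd_tm ?K X ?A
            ?B
            (tm_sub ?K X Y (sigma_ty ?K Y A B) c s)"
        using c g s T' e' l U' x f x' xs xe i t sn
        by (simp add: ops_syn) (intro tm_cls_eq ty snd_sub)
    }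
    fix a b assume ab: "a \<in> Tm ?K Y A"
      "b \<in> Tm ?K Y (ty_sub ?K Y (ext ?K Y A) B (inst ?K Y A a))"
    from ab(1) obtain x where x: "a = tm_cls u D x T" "tmeq u D x x T"
      using c by (auto simp: mem_syn)
    note i = sinst_cong[OF c(2,4) x(2)]
    note t = ty_sub_cong[OF c(7) i]
    from ab(2) obtain y where y: "b = tm_cls u D y (TSub U (sinst D T x))" "tmeq u D y y (TSub U (sinst D T x))"
      using c x i t by (auto simp: mem_syn ops_syn)
    note p = pair_cong[OF c(4,7) x(2) y(2)]
    note x' = tm_sub_cong[OF x(2) g(4)] and y' = tm_sub_cong[OF y(2) g(4)]
    note ty = ty_inst_sub[OF g(2) c(2,4,7) g(4) x(2)]
    note ys = tm_conv[OF g(2) ty y'] and ye = tm_cls_eq[OF g(2) ty y']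
    show "tm_sub ?K X Y (sigma_ty ?K Y A B) (pair_tm ?K Y A B a b) s
        = pair_tm ?K X ?A
            ?B
            (tm_sub ?K X Y A a s)
            (tm_sub ?K X Y (ty_sub ?K Y (ext ?K Y A) B (inst ?K Y A a)) b s)"
      using c g s T' e' l U' x y p x' y' ys ye i t
      by (simp add: ops_syn) (intro tm_cls_eq ss pair_sub)
  qed
qed

lemma supports_Pi_syn: "supports_Pi (syn_cwf u)"
proof -
  interpret syn: cwf "syn_cwf u" by (rule cwf_syn)
  let ?K = "syn_cwf u"
  show ?thesis
  proof
    fix X A B
    assume *: "X \<in> Ctx ?K" "A \<in> Ty ?K X" "B \<in> Ty ?K (ext ?K X A)"
    from * obtain G T U where c: "X = ctx_cls u G" "ctxeq u G G" "A = ty_cls u G T" "tyeq u G T T"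
      "ctxeq u (CExt G T) (CExt G T)" "B = ty_cls u (CExt G T) U" "tyeq u (CExt G T) U U"
      by (rule syn_ext_cases)
    note s = pi_cong[OF c(4,7)]
    show "pi_ty ?K X A B \<in> Ty ?K X"
      using c s by (auto simp: mem_syn ops_syn)
    {
      fix b assume "b \<in> Tm ?K (ext ?K X A) B"
      then obtain y where y: "b = tm_cls u (CExt G T) y U" "tmeq u (CExt G T) y y U"
        using c by (auto simp: mem_syn ops_syn)
      note lm = lam_cong[OF c(4,7) y(2)]
      show "lam_tm ?K X A B b \<in> Tm ?K X (pi_ty ?K X A B)"
        using c s y lm by (auto simp: mem_syn ops_syn)
      fix a assume "a \<in> Tm ?K X A"
      then obtain x where x: "a = tm_cls u G x T" "tmeq u G x x T"
        using c by (auto simp: mem_syn)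
      note i = sinst_cong[OF c(2,4) x(2)]
      note t = ty_sub_cong[OF c(7) i]
      show "app_tm ?K X A B (lam_tm ?K X A B b) a = tm_sub ?K X (ext ?K X A) B b (inst ?K X A a)"
        using c s y lm x i t by (simp add: ops_syn) (intro tm_cls_eq beta)
    }
    fix c assume "c \<in> Tm ?K X (pi_ty ?K X A B)"
    then obtain z where z: "c = tm_cls u G z (TPi T U)" "tmeq u G z z (TPi T U)"
      using c s by (auto simp: mem_syn ops_syn)
    {
      fix a assume "a \<in> Tm ?K X A"
      then obtain x where x: "a = tm_cls u G x T" "tmeq u G x x T"
        using c by (auto simp: mem_syn)
      note i = sinst_cong[OF c(2,4) x(2)]
      note t = ty_sub_cong[OF c(7) i]
      note ap = app_cong[OF c(4,7) z(2) x(2)]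
      show "app_tm ?K X A B c a \<in> Tm ?K X (ty_sub ?K X (ext ?K X A) B (inst ?K X A a))"
        using c s z x i t ap by (auto simp: mem_syn ops_syn)
    }
    let ?E = "CExt G T" and ?T = "TSub T (SProj T)"
    let ?U = "TSub U (slift T (SProj T))"
    note p = proj_cong[OF c(4)]
    note T' = ty_sub_cong[OF c(4) p] and q = var_cong[OF c(4)]
    note e' = ext_cong[OF c(5) T'] and l = slift_cong[OF c(5) c(4) p]
    note U' = ty_sub_cong[OF c(7) l]
    note ps = pi_sub[OF c(4,7) p]
    note z' = tm_sub_cong[OF z(2) p]
    note zs = tm_conv[OF c(5) ps z'] and ze = tm_cls_eq[OF c(5) ps z']
    note ap = app_cong[OF T' U' zs q]
    note i = sinst_cong[OF c(5) T' q]
    \<comment> \<open>The application in the eta rule is typed over \<open>U[p+][<id, q>]\<close>.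
      That this is \<open>U\<close> is \<open>lift_pr_inst_vr\<close> in the syntactic cwf.\<close>
    have ty: "tyeq u ?E (TSub ?U (sinst ?E ?T (EVar T))) U"
    proof (rule ty_clsD[OF _ c(7)])
      have cE: "ctx_cls u G \<in> Ctx ?K" "ty_cls u G T \<in> Ty ?K (ctx_cls u G)"
        using c by (auto simp: mem_syn)
      have U: "ty_cls u ?E U \<in> Ty ?K (ctx_cls u ?E)"
        using c by (auto simp: mem_syn)
      have m: "sub_cls u ?E (sinst ?E ?T (EVar T)) (CExt ?E ?T) \<in> Sub ?K (ctx_cls u ?E) (ctx_cls u (CExt ?E ?T))"
        "sub_cls u (CExt ?E ?T) (slift T (SProj T)) ?E \<in> Sub ?K (ctx_cls u (CExt ?E ?T)) (ctx_cls u ?E)"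
        "ctx_cls u ?E \<in> Ctx ?K" "ctx_cls u (CExt ?E ?T) \<in> Ctx ?K"
        using c(5) e' i l by (auto simp: mem_syn)
      show "ty_cls u ?E (TSub ?U (sinst ?E ?T (EVar T))) = ty_cls u ?E U"
        using syn.lift_pr_inst_vr[OF cE] syn.ty_sub_comp[OF m(3,4,3,1,2) U] syn.ty_sub_id[OF m(3) U]
          c p T' q e' l U' i
        by (simp add: ops_syn)
    qed
    note tap = tm_conv[OF c(5) ty ap] and eap = tm_cls_eq[OF c(5) ty ap]
    show "lam_tm ?K X A B
            (app_tm ?K (ext ?K X A) (ty_sub ?K (ext ?K X A) X A (pr ?K X A))
              (ty_sub ?K (ext ?K (ext ?K X A) (ty_sub ?K (ext ?K X A) X A (pr ?K X A))) (ext ?K X A) B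
                (lift ?K (ext ?K X A) X A (pr ?K X A)))
              (tm_sub ?K (ext ?K X A) X (pi_ty ?K X A B) c (pr ?K X A))
              (vr ?K X A)) = c"
      using c s z p T' q e' l U' z' zs ze tap eap
      by (simp add: ops_syn) (intro tm_cls_eq eta)
  next
    fix X Y s A B
    let ?A = "ty_sub ?K X Y A s"
    let ?B = "ty_sub ?K (ext ?K X ?A) (ext ?K Y A) B (lift ?K X Y A s)"
    assume *: "X \<in> Ctx ?K" "Y \<in> Ctx ?K" "s \<in> Sub ?K X Y" "A \<in> Ty ?K Y"
      "B \<in> Ty ?K (ext ?K Y A)"
    from *(2,4,5) obtain D T U where c: "Y = ctx_cls u D" "ctxeq u D D" "A = ty_cls u D T" "tyeq u D T T"
      "ctxeq u (CExt D T) (CExt D T)" "B = ty_cls u (CExt D T) U" "tyeq u (CExt D T) U U"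
      by (rule syn_ext_cases)
    from *(1,3) c(1,2) obtain G g where g: "X = ctx_cls u G" "ctxeq u G G" "s = sub_cls u G g D" "subeq u G g g D"
      by (auto simp: mem_syn)
    note s = pi_cong[OF c(4,7)]
    note T' = ty_sub_cong[OF c(4) g(4)]
    note e' = ext_cong[OF g(2) T'] and l = slift_cong[OF g(2) c(4) g(4)]
    note U' = ty_sub_cong[OF c(7) l]
    note ss = pi_sub[OF c(4,7) g(4)]
    show "ty_sub ?K X Y (pi_ty ?K Y A B) s
        = pi_ty ?K X ?A
            ?B"
      using c g s T' e' l U' by (simp add: ops_syn) (intro ty_cls_eq ss)
    {
      fix b assume "b \<in> Tm ?K (ext ?K Y A) B"
      then obtain y where y: "b = tm_cls u (CExt D T) y U" "tmeq u (CExt D T) y y U"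
        using c by (auto simp: mem_syn ops_syn)
      note lm = lam_cong[OF c(4,7) y(2)] and y' = tm_sub_cong[OF y(2) l]
      show "tm_sub ?K X Y (pi_ty ?K Y A B) (lam_tm ?K Y A B b) s
        = lam_tm ?K X ?A
            ?B
            (tm_sub ?K (ext ?K X ?A) (ext ?K Y A) B b (lift ?K X Y A s))"
        using c g s T' e' l U' y lm y'
        by (simp add: ops_syn) (intro tm_cls_eq ss lam_sub)
    }
    fix c a assume "c \<in> Tm ?K Y (pi_ty ?K Y A B)" "a \<in> Tm ?K Y A"
    then obtain z x where z: "c = tm_cls u D z (TPi T U)" "tmeq u D z z (TPi T U)"
      and x: "a = tm_cls u D x T" "tmeq u D x x T"
      using c s by (auto simp: mem_syn ops_syn)
    note i = sinst_cong[OF c(2,4) x(2)]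
    note t = ty_sub_cong[OF c(7) i]
    note x' = tm_sub_cong[OF x(2) g(4)] and z' = tm_sub_cong[OF z(2) g(4)]
    note zs = tm_conv[OF g(2) ss z'] and ze = tm_cls_eq[OF g(2) ss z']
    note ap = app_cong[OF c(4,7) z(2) x(2)]
    note ty = ty_inst_sub[OF g(2) c(2,4,7) g(4) x(2)]
    show "tm_sub ?K X Y (ty_sub ?K Y (ext ?K Y A) B (inst ?K Y A a)) (app_tm ?K Y A B c a) s
        = app_tm ?K X ?A
            ?B
            (tm_sub ?K X Y (pi_ty ?K Y A B) c s)
            (tm_sub ?K X Y A a s)"
      using c g s T' e' l U' i t x z x' z' zs ze ap
      by (simp add: ops_syn) (intro tm_cls_eq ty app_sub)
  qed
qed

section \<open>Telescopes over a cwf\<close>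

text \<open>In \<open>Sig T U\<close> the tree \<open>U\<close> is over the extension by the value of \<open>T\<close>. Only \<open>\<Sigma>\<close> is kept
  formal: the raw syntax annotates the eliminators of the other types sufficiently.\<close>

datatype 't ttree = Leaf 't | Sig "'t ttree" "'t ttree"

primrec tval :: "('c, 's, 't, 'e, 'm) tcwf_scheme \<Rightarrow> 'c \<Rightarrow> 't ttree \<Rightarrow> 't" where
  "tval C X (Leaf A) = A"
| "tval C X (Sig T U) = sigma_ty C X (tval C X T) (tval C (ext C X (tval C X T)) U)"

primrec wft :: "('c, 's, 't, 'e, 'm) tcwf_scheme \<Rightarrow> 'c \<Rightarrow> 't ttree \<Rightarrow> bool" where
  "wft C X (Leaf A) \<longleftrightarrow> A \<in> Ty C X"
| "wft C X (Sig T U) \<longleftrightarrow> wft C X T \<and> wft C (ext C X (tval C X T)) U"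

text \<open>Under \<open>Sig\<close> the context grows by the substituted value of \<open>T\<close>,
  not by the value of the substituted tree; \<open>tsub_char\<close> shows that the two
  agree.\<close>

primrec tsub :: "('c, 's, 't, 'e, 'm) tcwf_scheme \<Rightarrow> 'c \<Rightarrow> 'c \<Rightarrow> 't ttree
  \<Rightarrow> 's \<Rightarrow> 't ttree" where
  "tsub C X Y (Leaf A) s = Leaf (ty_sub C X Y A s)"
| "tsub C X Y (Sig T U) s = Sig (tsub C X Y T s)
     (tsub C (ext C X (ty_sub C X Y (tval C Y T) s)) (ext C Y (tval C Y T)) U (lift C X Y (tval C Y T) s))"

text \<open>The head of the list is the type added last, so that extension is consing.\<close>

primrec cval :: "('c, 's, 't, 'e, 'm) tcwf_scheme \<Rightarrow> 't ttree list \<Rightarrow> 'c" where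
  "cval C [] = unit_ctx C"
| "cval C (T # X) = ext C (cval C X) (tval C (cval C X) T)"

primrec wfc :: "('c, 's, 't, 'e, 'm) tcwf_scheme \<Rightarrow> 't ttree list \<Rightarrow> bool" where
  "wfc C [] \<longleftrightarrow> True"
| "wfc C (T # X) \<longleftrightarrow> wfc C X \<and> wft C (cval C X) T"

abbreviation (input) tv where "tv C X T \<equiv> tval C (cval C X) T"

text \<open>Substitutions and terms remain those of \<open>C\<close> between the values; only
  contexts and types become formal. Hence extension and Sigma are free constructors, while the laws
  about substitutions and terms are inherited from \<open>C\<close>.\<close>

definition tele_cwf :: "('c, 's, 't, 'e, 'm) tcwf_scheme \<Rightarrow> ('t ttree list, 's, 't ttree, 'e) tcwf" where
  "tele_cwf C = \<lparr>
     Ctx = {X. wfc C X},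
     Sub = (\<lambda>X Y. Sub C (cval C X) (cval C Y)),
     Ty = (\<lambda>X. {T. wft C (cval C X) T}),
     Tm = (\<lambda>X T. Tm C (cval C X) (tv C X T)),
     id_sub = (\<lambda>X. id_sub C (cval C X)),
     comp_sub = (\<lambda>X Y Z. comp_sub C (cval C X) (cval C Y) (cval C Z)),
     ty_sub = (\<lambda>X Y. tsub C (cval C X) (cval C Y)),
     tm_sub = (\<lambda>X Y T. tm_sub C (cval C X) (cval C Y) (tv C Y T)),
     unit_ctx = [],
     ext = (\<lambda>X T. T # X),
     pr = (\<lambda>X T. pr C (cval C X) (tv C X T)),
     vr = (\<lambda>X T. vr C (cval C X) (tv C X T)),
     id_ty = (\<lambda>X T a b. Leaf (id_ty C (cval C X) (tv C X T) a b)),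
     refl_tm = (\<lambda>X T. refl_tm C (cval C X) (tv C X T)),
     n1_ty = Leaf (n1_ty C),
     zero_tm = zero_tm C,
     sigma_ty = (\<lambda>X T U. Sig T U),
     pair_tm = (\<lambda>X T U. pair_tm C (cval C X) (tv C X T) (tv C (T # X) U)),
     fst_tm = (\<lambda>X T U. fst_tm C (cval C X) (tv C X T) (tv C (T # X) U)),
     snd_tm = (\<lambda>X T U. snd_tm C (cval C X) (tv C X T) (tv C (T # X) U)),
     pi_ty = (\<lambda>X T U. Leaf (pi_ty C (cval C X) (tv C X T) (tv C (T # X) U))),
     lam_tm = (\<lambda>X T U. lam_tm C (cval C X) (tv C X T) (tv C (T # X) U)),
     app_tm = (\<lambda>X T U. app_tm C (cval C X) (tv C X T) (tv C (T # X) U))\<rparr>"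

lemma tele_simps:
  shows "Ctx (tele_cwf C) = {X. wfc C X}"
    and "Sub (tele_cwf C) = (\<lambda>X Y. Sub C (cval C X) (cval C Y))"
    and "Ty (tele_cwf C) = (\<lambda>X. {T. wft C (cval C X) T})"
    and "Tm (tele_cwf C) = (\<lambda>X T. Tm C (cval C X) (tv C X T))"
    and "id_sub (tele_cwf C) = (\<lambda>X. id_sub C (cval C X))"
    and "comp_sub (tele_cwf C) = (\<lambda>X Y Z. comp_sub C (cval C X) (cval C Y) (cval C Z))"
    and "ty_sub (tele_cwf C) = (\<lambda>X Y. tsub C (cval C X) (cval C Y))"
    and "tm_sub (tele_cwf C) = (\<lambda>X Y T. tm_sub C (cval C X) (cval C Y) (tv C Y T))"
    and "unit_ctx (tele_cwf C) = []"
    and "ext (tele_cwf C) = (\<lambda>X T. T # X)"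
    and "pr (tele_cwf C) = (\<lambda>X T. pr C (cval C X) (tv C X T))"
    and "vr (tele_cwf C) = (\<lambda>X T. vr C (cval C X) (tv C X T))"
    and "id_ty (tele_cwf C) = (\<lambda>X T a b. Leaf (id_ty C (cval C X) (tv C X T) a b))"
    and "refl_tm (tele_cwf C) = (\<lambda>X T. refl_tm C (cval C X) (tv C X T))"
    and "n1_ty (tele_cwf C) = Leaf (n1_ty C)"
    and "zero_tm (tele_cwf C) = zero_tm C"
    and "sigma_ty (tele_cwf C) = (\<lambda>X T U. Sig T U)"
    and "pair_tm (tele_cwf C) = (\<lambda>X T U. pair_tm C (cval C X) (tv C X T) (tv C (T # X) U))"
    and "fst_tm (tele_cwf C) = (\<lambda>X T U. fst_tm C (cval C X) (tv C X T) (tv C (T # X) U))"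
    and "snd_tm (tele_cwf C) = (\<lambda>X T U. snd_tm C (cval C X) (tv C X T) (tv C (T # X) U))"
    and "pi_ty (tele_cwf C) = (\<lambda>X T U. Leaf (pi_ty C (cval C X) (tv C X T) (tv C (T # X) U)))"
    and "lam_tm (tele_cwf C) = (\<lambda>X T U. lam_tm C (cval C X) (tv C X T) (tv C (T # X) U))"
    and "app_tm (tele_cwf C) = (\<lambda>X T U. app_tm C (cval C X) (tv C X T) (tv C (T # X) U))"
  unfolding tele_cwf_def by simp_all

locale type_theory_cwf = supports_I C + supports_N1 C + supports_Sigma C + supports_Pi C
  for C :: "('c, 's, 't, 'e, 'm) tcwf_scheme"

context supports_Sigma
begin

lemma tval_in: "\<lbrakk>X \<in> Ctx C; wft C X T\<rbrakk> \<Longrightarrow> tval C X T \<in> Ty C X"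
  by (induction T arbitrary: X) (simp_all add: ext sigma_ty)

text \<open>Both parts go through the induction together: under \<open>Sig\<close> the second tree
  must be well formed over the extension by the value of the substituted first one, and only the
  second part says what that value is.\<close>

lemma tsub_char:
  "\<lbrakk>X \<in> Ctx C; Y \<in> Ctx C; wft C Y T; s \<in> Sub C X Y\<rbrakk>
    \<Longrightarrow> wft C X (tsub C X Y T s) \<and> tval C X (tsub C X Y T s) = ty_sub C X Y (tval C Y T) s"
proof (induction T arbitrary: X Y s)
  case (Leaf A)
  then show ?case by (simp add: ty_sub)
next
  case (Sig T U)
  then have T: "tval C Y T \<in> Ty C Y" by (simp add: tval_in)
  note e = ext[OF Sig.prems(2) T] and l = lift_char[OF Sig.prems(1,2) T Sig.prems(4)]
  show ?case
    using Sig.IH(1)[OF Sig.prems(1,2) _ Sig.prems(4)] Sig.IH(2)[OF l(2) e _ l(5)] Sig.prems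
      sigma_ty_sub[OF Sig.prems(1,2,4) T tval_in[OF e]]
    by simp
qed

lemmas wft_tsub = tsub_char[THEN conjunct1] and tval_tsub = tsub_char[THEN conjunct2]

text \<open>Functoriality has to hold on trees, not merely on their values. The \<open>Sig\<close>
  cases here and in \<open>tsub_comp\<close> are where \<open>lift_id\<close> and
  \<open>lift_comp\<close> are needed.\<close>

lemma tsub_id: "\<lbrakk>X \<in> Ctx C; wft C X T\<rbrakk> \<Longrightarrow> tsub C X X T (id_sub C X) = T"
proof (induction T arbitrary: X)
  case (Sig T U)
  then have T: "tval C X T \<in> Ty C X" by (simp add: tval_in)
  show ?case
    using Sig ext[OF _ T] by (simp add: ty_sub_id[OF _ T] lift_id[OF _ T])
qed (simp add: ty_sub_id)

lemma tsub_comp: "\<lbrakk>X \<in> Ctx C; Y \<in> Ctx C; Z \<in> Ctx C; s \<in> Sub C X Y; t \<in> Sub C Y Z;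
  wft C Z T\<rbrakk>
  \<Longrightarrow> tsub C X Z T (comp_sub C X Y Z t s) = tsub C X Y (tsub C Y Z T t) s"
proof (induction T arbitrary: X Y Z s t)
  case (Sig T U)
  then have T: "tval C Z T \<in> Ty C Z" by (simp add: tval_in)
  have T': "ty_sub C Y Z (tval C Z T) t \<in> Ty C Y" using ty_sub Sig.prems T by blast
  note e = ext[OF Sig.prems(3) T] and l = lift_char[OF Sig.prems(2,3) T Sig.prems(5)]
    and l' = lift_char[OF Sig.prems(1,2) T' Sig.prems(4)]
  show ?case
    using Sig.IH(1)[OF Sig.prems(1-5)] Sig.IH(2)[OF l'(2) l(2) e l'(5) l(5)] Sig.prems
    by (simp add: tval_tsub lift_comp[OF Sig.prems(1-3) T Sig.prems(5,4)]
        ty_sub_comp[OF Sig.prems(1-5) T])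
qed (simp add: ty_sub_comp)

lemma cval_in: "wfc C X \<Longrightarrow> cval C X \<in> Ctx C"
  by (induction X) (simp_all add: unit_ctx ext tval_in)

lemma cwf_tele: "cwf (tele_cwf C)"
proof
  fix X Y T s a
  assume "X \<in> Ctx (tele_cwf C)" "Y \<in> Ctx (tele_cwf C)" "T \<in> Ty (tele_cwf C) Y" "s \<in> Sub
    (tele_cwf C) X Y" "a \<in> Tm (tele_cwf C) X (ty_sub (tele_cwf C) X Y T s)"
  then show "\<exists>!\<theta>. \<theta> \<in> Sub (tele_cwf C) X (ext (tele_cwf C) Y T) \<and>
            comp_sub (tele_cwf C) X (ext (tele_cwf C) Y T) Y (pr (tele_cwf C) Y T) \<theta> = s \<and>
            tm_sub (tele_cwf C) X (ext (tele_cwf C) Y T) (ty_sub (tele_cwf C) (ext (tele_cwf C) Y T) Y T (pr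
              (tele_cwf C) Y T)) (vr (tele_cwf C) Y T) \<theta> = a"
    using ext_universal[of "cval C X" "cval C Y" "tv C Y T" s a]
    by (simp add: tele_simps cval_in tval_in tval_tsub ext pr)
qed (simp_all add: tele_simps cval_in tval_in tval_tsub wft_tsub tsub_id tsub_comp
    id_sub comp_sub comp_assoc comp_id_left comp_id_right tm_sub tm_sub_id tm_sub_comp
    unit_ctx_terminal ext pr vr)

lemma sub_ext_tele: "\<lbrakk>wfc C Y; wft C (cval C Y) T\<rbrakk>
  \<Longrightarrow> sub_ext (tele_cwf C) X Y T s a = sub_ext C (cval C X) (cval C Y) (tv C Y T) s a"
  unfolding sub_ext_def by (simp add: tele_simps cval_in tval_in tval_tsub ext pr)

lemma lift_tele: "\<lbrakk>wfc C X; wfc C Y; wft C (cval C Y) T; s \<in> Sub C (cval C X) (cval C Y)\<rbrakk>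
  \<Longrightarrow> lift (tele_cwf C) X Y T s = lift C (cval C X) (cval C Y) (tv C Y T) s"
  unfolding lift_def Let_def by (simp add: sub_ext_tele) (simp add: tele_simps cval_in tval_tsub)

lemma inst_tele: "\<lbrakk>wfc C X; wft C (cval C X) T\<rbrakk>
  \<Longrightarrow> inst (tele_cwf C) X T a = inst C (cval C X) (tv C X T) a"
  unfolding inst_def by (simp add: sub_ext_tele) (simp add: tele_simps)

text \<open>Stability of Sigma under substitution is the second equation of \<open>tsub\<close>; the
  other laws are those of \<open>C\<close> at the values.\<close>

lemma supports_Sigma_tele: "supports_Sigma (tele_cwf C)"
  apply (intro supports_Sigma.intro supports_Sigma_axioms.intro cwf_tele)
  by (simp_all add: lift_tele inst_tele tele_simps cval_in tval_in tval_tsub wft_tsub ext ty_sub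
      inst_char lift_char pair_tm fst_tm snd_tm fst_pair snd_pair pair_fst_snd
      pair_tm_sub fst_tm_sub snd_tm_sub)

end

lemma (in type_theory_cwf) type_theory_tele: "type_theory_cwf (tele_cwf C)"
  apply (intro type_theory_cwf.intro supports_I.intro supports_N1.intro supports_Pi.intro
      supports_I_axioms.intro supports_N1_axioms.intro supports_Pi_axioms.intro
      cwf_tele supports_Sigma_tele)
  by (simp_all add: lift_tele inst_tele tele_simps cval_in tval_in tval_tsub wft_tsub ext ty_sub
      inst_char lift_char pr vr id_ty refl_tm id_ty_sub refl_tm_sub n1_ty zero_tm n1_unique
      pi_ty lam_tm app_tm beta eta pi_ty_sub lam_tm_sub app_tm_sub)
    (use reflection cval_in tval_in in blast)

definition tele_map :: "('c, 's, 't, 'e, 'm) tcwf_scheme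
    \<Rightarrow> ('t ttree list, 's, 't ttree, 'e, 'c, 's, 't, 'e) cwf_map" where
  "tele_map C = \<lparr>
     FCtx = (\<lambda>X. if wfc C X then cval C X else undefined),
     FSub = (\<lambda>X Y s. if wfc C X \<and> wfc C Y \<and> s \<in> Sub C (cval C X) (cval C Y) then s else undefined),
     FTy = (\<lambda>X T. if wfc C X \<and> wft C (cval C X) T then tv C X T else undefined),
     FTm = (\<lambda>X T a. if wfc C X \<and> wft C (cval C X) T \<and> a \<in> Tm C (cval C X) (tv C X T) then a
       else undefined)\<rparr>"

lemma (in supports_Sigma) strict_tele_map: "strict_cwf_morphism (tele_cwf C) C (tele_map C)"
  apply (intro strict_cwf_morphism.intro strict_cwf_morphism_axioms.intro cwf_tele cwf_axioms)
  by (simp_all add: tele_map_def tele_simps cval_in tval_in tval_tsub wft_tsub sub_ext_tele ext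
      id_sub comp_sub ty_sub tm_sub pr vr sub_ext_char(1)) blast+

context type_theory_cwf
begin

lemma preserves_tele_map:
  "preserves_I (tele_cwf C) C (tele_map C)" "preserves_N1 (tele_cwf C) C (tele_map C)"
  "preserves_Sigma (tele_cwf C) C (tele_map C)" "preserves_Pi (tele_cwf C) C (tele_map C)"
  by (intro preserves_I.intro preserves_N1.intro preserves_Sigma.intro preserves_Pi.intro
      preserves_I_axioms.intro preserves_N1_axioms.intro preserves_Sigma_axioms.intro
      preserves_Pi_axioms.intro strict_tele_map;
    simp add: tele_map_def inst_tele tele_simps cval_in tval_in tval_tsub wft_tsub ext ty_sub
      inst_char id_ty refl_tm n1_ty zero_tm pair_tm fst_tm snd_tm pi_ty lam_tm app_tm)+

end

section \<open>Interpretation of raw syntax\<close>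

text \<open>Uniqueness of N1-terms over all contexts is asked for directly, and only when the
  calculus has the corresponding rule. Thus the syntactic cwf is itself a model for either value of
  \<open>u\<close>, as the uniqueness proof requires, although it is shown to be democratic for
  \<open>Everywhere\<close> only.\<close>

locale model = type_theory_cwf C for C :: "('c, 's, 't, 'e, 'm) tcwf_scheme" +
  fixes o\<^sub>C :: 't and u :: n1_uniqueness
  assumes base_in: "o\<^sub>C \<in> Ty C (unit_ctx C)"
    and n1_everywhere: "\<lbrakk>u = Everywhere; X \<in> Ctx C; s \<in> Sub C X (unit_ctx C);
        e \<in> Tm C X (ty_sub C X (unit_ctx C) (n1_ty C) s)\<rbrakk>
      \<Longrightarrow> e = tm_sub C X (unit_ctx C) (n1_ty C) (zero_tm C) s"

context model
begin

text \<open>Every premise determines the semantic data of the next ones, except that \<open>i_proj\<close>, \<open>i_var\<close>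
  and \<open>i_fst\<close> decompose an extended context or a \<open>\<Sigma>\<close>-type.\<close>

inductive IC :: "rctx \<Rightarrow> 'c \<Rightarrow> bool"
  and IS :: "'c \<Rightarrow> rsub \<Rightarrow> 'c \<Rightarrow> 's \<Rightarrow> bool"
  and IT :: "'c \<Rightarrow> rty \<Rightarrow> 't \<Rightarrow> bool"
  and IE :: "'c \<Rightarrow> rtm \<Rightarrow> 't \<Rightarrow> 'e \<Rightarrow> bool"
where
  i_unit: "IC CUnit (unit_ctx C)"
| i_ext: "\<lbrakk>IC \<Gamma> X; IT X A S\<rbrakk> \<Longrightarrow> IC (CExt \<Gamma> A) (ext C X S)"
| i_comp: "\<lbrakk>IS X \<delta> Y d; IS Y \<gamma> Z g\<rbrakk>
    \<Longrightarrow> IS X (SComp \<gamma> \<delta>) Z (comp_sub C X Y Z g d)"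
| i_id: "IC \<Gamma> X \<Longrightarrow> IS X (SId \<Gamma>) X (id_sub C X)"
| i_bang: "IC \<Gamma> X \<Longrightarrow> IS X (SBang \<Gamma>) (unit_ctx C) (bang_sub C X)"
| i_proj: "\<lbrakk>X \<in> Ctx C; IT X A S\<rbrakk> \<Longrightarrow> IS (ext C X S) (SProj A) X (pr C X S)"
| i_sub_ext: "\<lbrakk>IS X \<gamma> Y g; IT Y A S; IE X a (ty_sub C X Y S g) e\<rbrakk>
    \<Longrightarrow> IS X (SExt \<gamma> a A) (ext C Y S) (sub_ext C X Y S g e)"
| i_base: "IT (unit_ctx C) TBase o\<^sub>C"
| i_ty_sub: "\<lbrakk>IS X \<gamma> Y g; IT Y A S\<rbrakk> \<Longrightarrow> IT X (TSub A \<gamma>) (ty_sub C X Y S g)"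
| i_id_ty: "\<lbrakk>IT X A S; IE X a S e; IE X b S f\<rbrakk>
    \<Longrightarrow> IT X (TId A a b) (id_ty C X S e f)"
| i_n1: "IT (unit_ctx C) TN1 (n1_ty C)"
| i_sigma: "\<lbrakk>IT X A S; IT (ext C X S) B T\<rbrakk> \<Longrightarrow> IT X (TSigma A B) (sigma_ty C X S T)"
| i_pi: "\<lbrakk>IT X A S; IT (ext C X S) B T\<rbrakk> \<Longrightarrow> IT X (TPi A B) (pi_ty C X S T)"
| i_tm_sub: "\<lbrakk>IS X \<gamma> Y g; IE Y a S e\<rbrakk>
    \<Longrightarrow> IE X (ESub a \<gamma>) (ty_sub C X Y S g) (tm_sub C X Y S e g)"
| i_var: "\<lbrakk>X \<in> Ctx C; IT X A S\<rbrakk>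
    \<Longrightarrow> IE (ext C X S) (EVar A) (ty_sub C (ext C X S) X S (pr C X S)) (vr C X S)"
| i_refl: "IE X a S e \<Longrightarrow> IE X (ERefl a) (id_ty C X S e e) (refl_tm C X S e)"
| i_zero: "IE (unit_ctx C) EZero (n1_ty C) (zero_tm C)"
| i_fst: "\<lbrakk>IT X A S; IT (ext C X S) B T; IE X c (sigma_ty C X S T) e\<rbrakk>
    \<Longrightarrow> IE X (EFst A c) S (fst_tm C X S T e)"
| i_snd: "\<lbrakk>IT X A S; IT (ext C X S) B T; IE X c (sigma_ty C X S T) e\<rbrakk>
    \<Longrightarrow> IE X (ESnd A B c) (ty_sub C X (ext C X S) T (inst C X S (fst_tm C X S T e))) (snd_tm C X S T e)"
| i_pair: "\<lbrakk>IT X A S; IT (ext C X S) B T; IE X a S e;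
      IE X b (ty_sub C X (ext C X S) T (inst C X S e)) f\<rbrakk>
    \<Longrightarrow> IE X (EPair A B a b) (sigma_ty C X S T) (pair_tm C X S T e f)"
| i_app: "\<lbrakk>IT X A S; IT (ext C X S) B T; IE X c (pi_ty C X S T) f; IE X a S e\<rbrakk>
    \<Longrightarrow> IE X (EApp A B c a) (ty_sub C X (ext C X S) T (inst C X S e)) (app_tm C X S T f e)"
| i_lam: "\<lbrakk>IT X A S; IE (ext C X S) b T f\<rbrakk>
    \<Longrightarrow> IE X (ELam A b) (pi_ty C X S T) (lam_tm C X S T f)"

inductive_cases i_elims:
  "IC CUnit X" "IC (CExt \<Gamma> A) X" "IS X (SComp \<gamma> \<delta>) Z g"
  "IS X (SId \<Gamma>) Z g" "IS X (SBang \<Gamma>) Z g" "IS X (SProj A) Z g"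
  "IS X (SExt \<gamma> a A) Z g" "IT X TBase S" "IT X (TSub A \<gamma>) S" "IT X (TId A a b) S"
  "IT X TN1 S" "IT X (TSigma A B) S" "IT X (TPi A B) S" "IE X (ESub a \<gamma>) S e"
  "IE X (EVar A) S e" "IE X (ERefl a) S e" "IE X EZero S e" "IE X (EFst A c) S e"
  "IE X (ESnd A B c) S e" "IE X (EPair A B a b) S e" "IE X (EApp A B c a) S e" "IE X (ELam A b) S e"

lemma i_typed:
  "IC \<Gamma> X \<Longrightarrow> X \<in> Ctx C"
  "IS X \<gamma> Y g \<Longrightarrow> X \<in> Ctx C \<Longrightarrow> Y \<in> Ctx C \<and> g \<in> Sub C X Y"
  "IT X A S \<Longrightarrow> X \<in> Ctx C \<Longrightarrow> S \<in> Ty C X"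
  "IE X a S e \<Longrightarrow> X \<in> Ctx C \<Longrightarrow> S \<in> Ty C X \<and> e \<in> Tm C X S"
  by (induction rule: IC_IS_IT_IE.inducts)
    (auto simp: unit_ctx ext comp_sub id_sub bang_sub pr vr sub_ext_char(1) base_in ty_sub id_ty n1_ty
      sigma_ty pi_ty tm_sub refl_tm zero_tm inst_char(1) fst_tm snd_tm pair_tm app_tm lam_tm)

end

section \<open>Determinacy of the interpretation\<close>

text \<open>What is needed to decompose an extended context or a Sigma-type. \<open>EFst A c\<close>
  records the first argument of \<open>sigma_ty\<close>, so only the second has to be recovered.
  \<open>ext_neq_unit\<close> serves the comparison of morphisms.\<close>

locale injective_model = model C o\<^sub>C u
  for C :: "('c, 's, 't, 'e, 'm) tcwf_scheme" and o\<^sub>C u +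
  assumes ext_inj: "\<lbrakk>X \<in> Ctx C; Y \<in> Ctx C; S \<in> Ty C X; T \<in> Ty C Y; ext C X S = ext C Y T\<rbrakk>
      \<Longrightarrow> X = Y \<and> S = T"
    and ext_neq_unit: "\<lbrakk>X \<in> Ctx C; S \<in> Ty C X\<rbrakk> \<Longrightarrow> ext C X S \<noteq> unit_ctx C"
    and sigma_inj: "\<lbrakk>X \<in> Ctx C; S \<in> Ty C X; T \<in> Ty C (ext C X S); T' \<in> Ty C (ext C X S);
        sigma_ty C X S T = sigma_ty C X S T'\<rbrakk> \<Longrightarrow> T = T'"
begin

text \<open>The source context and the raw expression are inputs; target, type and value are
  outputs. Injectivity is used for \<open>i_proj\<close>, \<open>i_var\<close> and
  \<open>i_fst\<close>; elsewhere the premises are determined one after the other.\<close>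

lemma i_det:
  "IC \<Gamma> X \<Longrightarrow> IC \<Gamma> X' \<Longrightarrow> X' = X"
  "IS X \<gamma> Y g \<Longrightarrow> X \<in> Ctx C \<Longrightarrow> IS X \<gamma> Y' g' \<Longrightarrow> Y'
    = Y \<and> g' = g"
  "IT X A S \<Longrightarrow> X \<in> Ctx C \<Longrightarrow> IT X A S' \<Longrightarrow> S' = S"
  "IE X a S e \<Longrightarrow> X \<in> Ctx C \<Longrightarrow> IE X a S' e' \<Longrightarrow> S' = S \<and> e' = e"
proof (induction arbitrary: X' and Y' g' and S' and S' e' rule: IC_IS_IT_IE.inducts)
  case (i_proj X A S)
  from i_proj.prems(2) show ?case
    by (elim i_elims) (metis ext_inj i_proj i_typed(3))
next
  case (i_var X A S)
  from i_var.prems(2) show ?case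
    by (elim i_elims) (metis ext_inj i_var i_typed(3))
next
  case (i_fst X A S B T c e)
  from i_fst.prems(2) show ?case
    by (elim i_elims) (metis sigma_inj i_fst i_typed(3) ext)
next
  case (i_sub_ext X \<gamma> Y g A S a e)
  from i_sub_ext.prems(2) show ?case
    by (elim i_elims) (metis i_sub_ext i_typed(2))
next
  case (i_snd X A S B T c e)
  from i_snd.prems(2) show ?case
    by (elim i_elims) (metis i_snd i_typed(3) ext)
next
  case (i_pair X A S B T a e b f)
  from i_pair.prems(2) show ?case
    by (elim i_elims) (metis i_pair i_typed(3) ext)
next
  case (i_app X A S B T c f a e)
  from i_app.prems(2) show ?case
    by (elim i_elims) (metis i_app i_typed(3) ext)
next
  case (i_lam X A S b T f)
  from i_lam.prems(2) show ?case
    by (elim i_elims) (metis i_lam i_typed(3) ext)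
qed (erule i_elims; metis i_typed ext)+

end

context model
begin

lemmas i_ctx = i_typed(1)
lemmas i_sub = i_typed(2)[THEN conjunct2]
lemmas i_ty = i_typed(3)
lemmas i_tm = i_typed(4)[THEN conjunct2]

lemma i_slift:
  assumes "X \<in> Ctx C" "IS X \<gamma> Y g" "IT Y A S"
  shows "IS (ext C X (ty_sub C X Y S g)) (slift A \<gamma>) (ext C Y S) (lift C X Y S g)"
proof -
  have Y: "Y \<in> Ctx C" and g: "g \<in> Sub C X Y" using i_typed(2) assms by blast+
  have S: "S \<in> Ty C Y" using i_ty assms Y by blast
  note l = lift_char[OF assms(1) Y S g]
  note p = pr[OF assms(1) l(1)]
  note t = i_ty_sub[OF assms(2,3)]
  show ?thesis
    unfolding slift_def lift_def Let_def
    using i_sub_ext[OF i_comp[OF i_proj[OF assms(1) t] assms(2)] assms(3)] i_var[OF assms(1) t]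
      ty_sub_comp[OF l(2) assms(1) Y p g S] by simp
qed

lemma i_sinst:
  assumes "IC G X" "IT X A S" "IE X a S e"
  shows "IS X (sinst G A a) (ext C X S) (inst C X S e)"
  unfolding sinst_def inst_def
  using i_sub_ext[OF i_id[OF assms(1)] assms(2)] assms(3) ty_sub_id[OF i_ctx[OF assms(1)] i_ty[OF assms(2)
    i_ctx[OF assms(1)]]]
  by simp

end

section \<open>Soundness of the rules\<close>

context injective_model
begin

text \<open>Each induction hypothesis of soundness brings its own witnesses for context and type. By
  determinacy they may be replaced by the values already at hand; this and the next three lemmas do
  so.\<close>

lemma ty_ex: "\<lbrakk>\<exists>X S. IC G X \<and> IT X A S \<and> IT X A' S; IC G X\<rbrakk> \<Longrightarrow>
  \<exists>S. IT X A S \<and> IT X A' S"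
  using i_det(1) by blast

lemma fam_ex:
  assumes "\<exists>X S. IC G X \<and> IT X A S \<and> IT X A' S" "\<exists>Z T. IC (CExt G A) Z \<and> IT Z B
    T \<and> IT Z B' T"
  shows "\<exists>X S T. IC G X \<and> IT X A S \<and> IT X A' S \<and> IT (ext C X S) B T \<and> IT (ext C X S) B' T"
proof -
  obtain X S where i: "IC G X" "IT X A S" "IT X A' S" using assms(1) by blast
  then show ?thesis using ty_ex[OF assms(2) i_ext[OF i(1,2)]] by blast
qed

lemma sub_ex: "\<lbrakk>\<exists>X Y g. IC D X \<and> IC G Y \<and> IS X \<gamma> Y g \<and> IS X \<gamma>' Y
  g; IC G Y\<rbrakk>
  \<Longrightarrow> \<exists>X g. IC D X \<and> IS X \<gamma> Y g \<and> IS X \<gamma>' Y g"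
  using i_det(1) by blast

lemma tm_ex: "\<lbrakk>\<exists>X S e. IC G X \<and> IT X A S \<and> IE X a S e \<and> IE X a' S e; IC G X; IT X A S\<rbrakk>
  \<Longrightarrow> \<exists>e. IE X a S e \<and> IE X a' S e"
  using i_det(1) i_det(3)[OF _ i_ctx] by blast

text \<open>The values of the context and of the type are part of the conclusion. Rules that leave
  these presuppositions implicit, such as \<open>ty_sub_cong\<close>, obtain them from the induction
  hypotheses of their premises.\<close>

lemma sound:
  "ctxeq u G G' \<Longrightarrow> \<exists>X. IC G X \<and> IC G' X"
  "subeq u D \<gamma> \<gamma>' G \<Longrightarrow> \<exists>X Y g. IC D X \<and> IC G Y \<and> IS X \<gamma> Y
    g \<and> IS X \<gamma>' Y g"
  "tyeq u G A A' \<Longrightarrow> \<exists>X S. IC G X \<and> IT X A S \<and> IT X A' S"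
  "tmeq u G a a' A \<Longrightarrow> \<exists>X S e. IC G X \<and> IT X A S \<and> IE X a S e \<and> IE X a' S e"
proof (induction rule: ctxeq_subeq_tyeq_tmeq.inducts)
  case h: (sub_trans D \<gamma> \<gamma>' G \<gamma>'')
  then obtain X Y g Y' g' where i: "IC D X" "IC G Y" "IS X \<gamma> Y g" "IS X \<gamma>' Y g" "IS X \<gamma>'
    Y' g'" "IS X \<gamma>'' Y' g'"
    by (metis i_det(1))
  then show ?case using i_det(2)[OF i(4) i_ctx[OF i(1)] i(5)] by blast
next
  case (ty_trans G A A' A'')
  then show ?case by (metis i_det(1,3) i_ctx)
next
  case h: (tm_trans G a a' A a'')
  then obtain X S e S' e' where i: "IC G X" "IT X A S" "IE X a S e" "IE X a' S e" "IE X a' S' e'" "IE X a'' S' e'"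
    by (metis i_det(1))
  then show ?case using i_det(4)[OF i(4) i_ctx[OF i(1)] i(5)] by blast
next
  case h: (tm_pres G G' A A' a a')
  from h(2) obtain X where X: "IC G X" "IC G' X" by blast
  from ty_ex[OF h(4) X(1)] obtain S where S: "IT X A S" "IT X A' S" by blast
  from tm_ex[OF h(6) X(1) S(1)] obtain e where e: "IE X a S e" "IE X a' S e" by blast
  show ?case by (intro exI conjI) (rule X S e)+
next
  case unit_cong
  show ?case using i_unit by blast
next
  case base_cong
  show ?case using i_unit i_base by blast
next
  case (ext_cong G G' A A')
  then show ?case by (metis i_det(1) i_ext)
next
  case (ty_sub_cong G A A' D \<gamma> \<gamma>')
  then show ?case by (metis i_det(1) i_ty_sub)
next
  case (id_cong G G')
  then show ?case by (metis i_id)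
next
  case (bang_cong G G')
  then show ?case by (metis i_bang i_unit)
next
  case (comp_cong G \<delta> \<delta>' D \<gamma> \<gamma>' K)
  then show ?case by (metis i_det(1) i_comp)
next
  case (proj_cong G A A')
  then show ?case by (metis i_ctx i_ext i_proj)
next
  case (var_cong G A A')
  then show ?case by (metis i_ctx i_ext i_proj i_var i_ty_sub)
next
  case h: (sub_ext_cong G A A' D \<gamma> \<gamma>' a a')
  from h(2) obtain Y S where i: "IC G Y" "IT Y A S" "IT Y A' S" by blast
  obtain X g where j: "IC D X" "IS X \<gamma> Y g" "IS X \<gamma>' Y g" using sub_ex[OF h(4) i(1)] by blast
  show ?case using i j tm_ex[OF h(6) j(1) i_ty_sub[OF j(2) i(2)]] i_ext[OF i(1,2)]
    by (blast intro: i_sub_ext)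
next
  case (tm_sub_cong G a a' A D \<gamma> \<gamma>')
  then show ?case by (metis i_det(1) i_ty_sub i_tm_sub)
next
  case h: (comp_assoc H \<gamma> G \<delta> D \<theta> K)
  then obtain X Y Z W g d t where i: "IC H X" "IC G Y" "IC D Z" "IC K W"
    and s: "IS X \<gamma> Y g" "IS Y \<delta> Z d" "IS Z \<theta> W t"
    by (metis i_det(1))
  have "comp_sub C X Y W (comp_sub C Y Z W t d) g = comp_sub C X Z W t (comp_sub C X Y Z d g)"
    using i s by (intro comp_assoc) (auto intro: i_ctx i_sub)
  then show ?case using i i_comp[OF s(1) i_comp[OF s(2,3)]] i_comp[OF i_comp[OF s(1,2)] s(3)]
    by metis
next
  case h: (id_left G \<gamma> D)
  then obtain X Y g where i: "IC G X" "IC D Y" "IS X \<gamma> Y g" by blast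
  then show ?case
    using i_comp[OF i(3) i_id[OF i(2)]] comp_id_left[OF i_ctx i_ctx i_sub[OF _ i_ctx]] by metis
next
  case h: (id_right G \<gamma> D)
  then obtain X Y g where i: "IC G X" "IC D Y" "IS X \<gamma> Y g" by blast
  then show ?case
    using i_comp[OF i_id[OF i(1)] i(3)] comp_id_right[OF i_ctx i_ctx i_sub[OF _ i_ctx]] by metis
next
  case h: (ty_sub_comp K A D \<gamma> G \<delta>)
  then obtain X Y Z S g d where i: "IC G X" "IC D Y" "IC K Z" "IT Z A S" "IS Y \<gamma> Z g" "IS X \<delta> Y d"
    by (metis i_det(1))
  have "ty_sub C X Z S (comp_sub C X Y Z g d) = ty_sub C X Y (ty_sub C Y Z S g) d"
    using i by (intro ty_sub_comp) (auto intro: i_ctx i_sub i_ty)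
  then show ?case using i i_ty_sub[OF i_comp[OF i(6,5)] i(4)] i_ty_sub[OF i(6) i_ty_sub[OF i(5,4)]] by metis
next
  case h: (ty_sub_id G A)
  then obtain X S where i: "IC G X" "IT X A S" by blast
  then show ?case using i_ty_sub[OF i_id[OF i(1)] i(2)] ty_sub_id[OF i_ctx[OF i(1)] i_ty[OF i(2) i_ctx[OF i(1)]]] by metis
next
  case h: (tm_sub_comp K a A D \<gamma> G \<delta>)
  then obtain X Y Z S g d e where i: "IC G X" "IC D Y" "IC K Z" "IT Z A S" "IS Y \<gamma> Z g" "IS X \<delta> Y
    d" "IE Z a S e"
    by (metis i_det(1))
  have "ty_sub C X Z S (comp_sub C X Y Z g d) = ty_sub C X Y (ty_sub C Y Z S g) d"
    "tm_sub C X Z S e (comp_sub C X Y Z g d) = tm_sub C X Y (ty_sub C Y Z S g) (tm_sub C Y Z S e g) d"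
    using i by (intro ty_sub_comp tm_sub_comp; auto intro: i_ctx i_sub i_ty i_tm)+
  then show ?case
    using i i_ty_sub[OF i_comp[OF i(6,5)] i(4)] i_tm_sub[OF i_comp[OF i(6,5)] i(7)] i_tm_sub[OF i(6) i_tm_sub[OF i(5,7)]]
    by metis
next
  case h: (tm_sub_id G a A)
  then obtain X S e where i: "IC G X" "IT X A S" "IE X a S e" by blast
  note X = i_ctx[OF i(1)]
  show ?case
    using i i_tm_sub[OF i_id[OF i(1)] i(3)] ty_sub_id[OF X i_ty[OF i(2) X]] tm_sub_id[OF X i_ty[OF i(2) X] i_tm[OF i(3) X]]
    by metis
next
  case h: (bang_unique G \<gamma>)
  then obtain X g where i: "IC G X" "IS X \<gamma> (unit_ctx C) g" by (metis i_det(1) i_unit)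
  note X = i_ctx[OF i(1)]
  show ?case
    using i i_bang[OF i(1)] to_unit_eq[OF X i_sub[OF i(2) X] bang_sub[OF X]] i_unit by metis
next
  case h: (proj_sub_ext G A D \<gamma> a)
  from h(2) obtain Y S where 1: "IC G Y" "IT Y A S" by blast
  obtain X g where 2: "IC D X" "IS X \<gamma> Y g" using sub_ex[OF h(4) 1(1)] by blast
  obtain e where 3: "IE X a (ty_sub C X Y S g) e" using tm_ex[OF h(6) 2(1) i_ty_sub[OF 2(2) 1(2)]] by blast
  note i = 2(1) 1 2(2) 3
  note X = i_ctx[OF i(1)] and Y = i_ctx[OF i(2)]
  have "comp_sub C X (ext C Y S) Y (pr C Y S) (sub_ext C X Y S g e) = g"
    using i X Y by (intro sub_ext_char) (auto intro: i_sub i_ty i_tm)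
  then show ?case using i i_comp[OF i_sub_ext[OF i(4,3,5)] i_proj[OF Y i(3)]] by metis
next
  case h: (var_sub_ext G A D \<gamma> a)
  from h(2) obtain Y S where 1: "IC G Y" "IT Y A S" by blast
  obtain X g where 2: "IC D X" "IS X \<gamma> Y g" using sub_ex[OF h(4) 1(1)] by blast
  obtain e where 3: "IE X a (ty_sub C X Y S g) e" using tm_ex[OF h(6) 2(1) i_ty_sub[OF 2(2) 1(2)]] by blast
  note i = 2(1) 1 2(2) 3
  note X = i_ctx[OF i(1)] and Y = i_ctx[OF i(2)]
  note g = i_sub[OF i(4) X] and S = i_ty[OF i(3) Y] and e = i_tm[OF i(5) X]
  note s = sub_ext_char[OF X Y S g e]
  show ?case
    using i i_ty_sub[OF i(4,3)] i_tm_sub[OF i_sub_ext[OF i(4,3,5)] i_var[OF Y i(3)]] s(2,3)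
      ty_sub_comp[OF X ext[OF Y S] Y s(1) pr[OF Y S] S]
    by metis
next
  case h: (sub_ext_eta G A D \<gamma>)
  from h(2) obtain Y S where 1: "IC G Y" "IT Y A S" by blast
  with sub_ex[OF h(4) i_ext[OF 1]] obtain X g
    where i: "IC D X" "IC G Y" "IT Y A S" "IS X \<gamma> (ext C Y S) g" by blast
  note X = i_ctx[OF i(1)] and Y = i_ctx[OF i(2)]
  note S = i_ty[OF i(3) Y]
  note g = i_sub[OF i(4) X]
  note c = i_comp[OF i(4) i_proj[OF Y i(3)]] and v = i_tm_sub[OF i(4) i_var[OF Y i(3)]]
  show ?case
    using i i_ext[OF i(2,3)] sub_ext_eta[OF X Y S g] i_sub_ext[OF c i(3)] v
      ty_sub_comp[OF X ext[OF Y S] Y g pr[OF Y S] S]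
    by metis
next
  case h: (idty_cong G A A' a a' b b')
  from h(2) obtain X S where i: "IC G X" "IT X A S" "IT X A' S" by blast
  show ?case using i tm_ex[OF h(4) i(1,2)] tm_ex[OF h(6) i(1,2)] by (blast intro: i_id_ty)
next
  case h: (refl_cong G a a' A)
  from h(2) obtain X S e where i: "IC G X" "IT X A S" "IE X a S e" "IE X a' S e" by blast
  then show ?case using i_id_ty[OF i(2-4)] i_refl[OF i(3)] i_refl[OF i(4)] by blast
next
  case h: (reflection G c A a a')
  from h(2) obtain X R z where i: "IC G X" "IT X (TId A a a') R" "IE X c R z" by blast
  \<comment> \<open>The premise mentions \<open>a\<close> and \<open>a'\<close> only inside the type
    of \<open>c\<close>; decomposing the interpretation of that type yields their values.\<close>
  from i(2) obtain S e f where j: "R = id_ty C X S e f" "IT X A S" "IE X a S e" "IE X a' S f"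
    by (elim i_elims)
  note X = i_ctx[OF i(1)]
  have "e = f" using reflection[OF X i_ty[OF j(2) X] i_tm[OF j(3) X] i_tm[OF j(4) X]] i_tm[OF i(3) X] j(1) by blast
  then show ?case using i j by blast
next
  case h: (refl_unique G c A a a')
  from h(2) obtain X R z where i: "IC G X" "IT X (TId A a a') R" "IE X c R z" by blast
  from i(2) obtain S e f where j: "R = id_ty C X S e f" "IT X A S" "IE X a S e" "IE X a' S f"
    by (elim i_elims)
  note X = i_ctx[OF i(1)]
  have "e = f \<and> z = refl_tm C X S e" using reflection[OF X i_ty[OF j(2) X] i_tm[OF j(3) X] i_tm[OF j(4)
    X]] i_tm[OF i(3) X] j(1) by blast
  then show ?case using i j i_refl by blast
next
  case h: (idty_sub G A a a' D \<gamma>)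
  from h(2) obtain Y S where 1: "IC G Y" "IT Y A S" by blast
  obtain X g where 2: "IC D X" "IS X \<gamma> Y g" using sub_ex[OF h(8) 1(1)] by blast
  obtain e f where 3: "IE Y a S e" "IE Y a' S f" using tm_ex[OF h(4) 1] tm_ex[OF h(6) 1] by blast
  note i = 2(1) 1 2(2) 3
  have "ty_sub C X Y (id_ty C Y S e f) g
      = id_ty C X (ty_sub C X Y S g) (tm_sub C X Y S e g) (tm_sub C X Y S f g)"
    using i by (intro id_ty_sub) (auto intro: i_ctx i_sub i_ty i_tm)
  then show ?case
    using i i_ty_sub[OF i(4) i_id_ty[OF i(3,5,6)]] i_id_ty[OF i_ty_sub[OF i(4,3)] i_tm_sub[OF i(4,5)] i_tm_sub[OF i(4,6)]]
    by metis
next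
  case n1_cong
  show ?case using i_n1 i_unit by blast
next
  case zero_cong
  show ?case using i_n1 i_unit i_zero by blast
next
  case h: (n1_unique a)
  from tm_ex[OF h(2) i_unit i_n1] obtain e where i: "IE (unit_ctx C) a (n1_ty C) e" by blast
  show ?case using n1_unique[OF i_tm[OF i unit_ctx]] i i_n1 i_unit i_zero by metis
next
  case h: (n1_unique_everywhere G a)
  \<comment> \<open>\<open>h(1)\<close> says \<open>u = Everywhere\<close>; it unlocks the
    corresponding assumption of \<open>model\<close>.\<close>
  from h(3) obtain X where X: "IC G X" by blast
  with tm_ex[OF h(3) X i_ty_sub[OF i_bang[OF X] i_n1]] obtain e
    where i: "IC G X" "IE X a (ty_sub C X (unit_ctx C) (n1_ty C) (bang_sub C X)) e" by blast
  note X = i_ctx[OF i(1)]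
  show ?case
    using n1_everywhere[OF h(1) X bang_sub[OF X] i_tm[OF i(2) X]] i i_ty_sub[OF i_bang[OF i(1)] i_n1]
      i_tm_sub[OF i_bang[OF i(1)] i_zero]
    by metis
next
  case h: (sigma_cong G A A' B B')
  from h(2) obtain X S where i: "IC G X" "IT X A S" "IT X A' S" by blast
  show ?case using i ty_ex[OF h(4) i_ext[OF i(1,2)]] by (blast intro: i_sigma)
next
  case h: (pair_cong G A A' B B' a a' b b')
  from fam_ex[OF h(2,4)] obtain X S T where 1: "IC G X" "IT X A S" "IT X A' S"
    and 2: "IT (ext C X S) B T" "IT (ext C X S) B' T" by blast
  obtain e where 3: "IE X a S e" "IE X a' S e" using tm_ex[OF h(6) 1(1,2)] by blast
  obtain f where 4: "IE X b (ty_sub C X (ext C X S) T (inst C X S e)) f"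
    "IE X b' (ty_sub C X (ext C X S) T (inst C X S e)) f"
    using tm_ex[OF h(8) 1(1) i_ty_sub[OF i_sinst[OF 1(1,2) 3(1)] 2(1)]] by blast
  note i = 1 2 3 4
  show ?case using i(1) i_pair[OF i(2,4,6,8)] i_pair[OF i(3,5,7,9)] i_sigma[OF i(2,4)] by blast
next
  case h: (fst_cong G A A' B c c')
  from fam_ex[OF h(2,4)] obtain X S T where 1: "IC G X" "IT X A S" "IT X A' S" and 2: "IT (ext C X S) B T" by blast
  obtain e where 3: "IE X c (sigma_ty C X S T) e" "IE X c' (sigma_ty C X S T) e"
    using tm_ex[OF h(6) 1(1) i_sigma[OF 1(2) 2]] by blast
  note i = 1 2 3
  show ?case using i i_fst[OF i(2,4,5)] i_fst[OF i(3,4,6)] by blast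
next
  case h: (snd_cong G A A' B B' c c')
  from fam_ex[OF h(2,4)] obtain X S T where 1: "IC G X" "IT X A S" "IT X A' S"
    and 2: "IT (ext C X S) B T" "IT (ext C X S) B' T" by blast
  obtain e where 3: "IE X c (sigma_ty C X S T) e" "IE X c' (sigma_ty C X S T) e"
    using tm_ex[OF h(6) 1(1) i_sigma[OF 1(2) 2(1)]] by blast
  note i = 1 2 3
  show ?case
    using i(1) i_snd[OF i(2,4,6)] i_snd[OF i(3,5,7)] i_ty_sub[OF i_sinst[OF i(1,2) i_fst[OF i(2,4,6)]] i(4)]
    by blast
next
  case h: (fst_pair G A B a b)
  from fam_ex[OF h(2,4)] obtain X S T where 1: "IC G X" "IT X A S" and 2: "IT (ext C X S) B T" by blast
  obtain e where 3: "IE X a S e" using tm_ex[OF h(6) 1] by blast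
  obtain f where 4: "IE X b (ty_sub C X (ext C X S) T (inst C X S e)) f"
    using tm_ex[OF h(8) 1(1) i_ty_sub[OF i_sinst[OF 1 3] 2]] by blast
  note i = 1 2 3 4
  note X = i_ctx[OF i(1)]
  note S = i_ty[OF i(2) X] and e = i_tm[OF i(4) X] and f = i_tm[OF i(5) X]
  note T = i_ty[OF i(3) ext[OF X S]]
  show ?case using i i_fst[OF i(2,3) i_pair[OF i(2-5)]] fst_pair[OF X S T e f] by metis
next
  case h: (snd_pair G A B a b)
  from fam_ex[OF h(2,4)] obtain X S T where 1: "IC G X" "IT X A S" and 2: "IT (ext C X S) B T" by blast
  obtain e where 3: "IE X a S e" using tm_ex[OF h(6) 1] by blast
  obtain f where 4: "IE X b (ty_sub C X (ext C X S) T (inst C X S e)) f"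
    using tm_ex[OF h(8) 1(1) i_ty_sub[OF i_sinst[OF 1 3] 2]] by blast
  note i = 1 2 3 4
  note X = i_ctx[OF i(1)]
  note S = i_ty[OF i(2) X] and e = i_tm[OF i(4) X] and f = i_tm[OF i(5) X]
  note T = i_ty[OF i(3) ext[OF X S]]
  show ?case
    using i i_snd[OF i(2,3) i_pair[OF i(2-5)]] fst_pair[OF X S T e f] snd_pair[OF X S T e f]
      i_ty_sub[OF i_sinst[OF i(1,2,4)] i(3)]
    by metis
next
  case h: (pair_eta G A B c)
  from fam_ex[OF h(2,4)] obtain X S T where 1: "IC G X" "IT X A S" and 2: "IT (ext C X S) B T" by blast
  obtain e where 3: "IE X c (sigma_ty C X S T) e" using tm_ex[OF h(6) 1(1) i_sigma[OF 1(2) 2]] by blast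
  note i = 1 2 3
  note X = i_ctx[OF i(1)]
  note S = i_ty[OF i(2) X] and e = i_tm[OF i(4) X]
  note T = i_ty[OF i(3) ext[OF X S]]
  show ?case
    using i i_pair[OF i(2,3) i_fst[OF i(2-4)] i_snd[OF i(2-4)]] pair_fst_snd[OF X S T e]
      i_sigma[OF i(2,3)]
    by metis
next
  case h: (sigma_sub G A B D \<gamma>)
  from fam_ex[OF h(2,4)] obtain Y S T where 1: "IC G Y" "IT Y A S" and 2: "IT (ext C Y S) B T" by blast
  obtain X g where 3: "IC D X" "IS X \<gamma> Y g" using sub_ex[OF h(6) 1(1)] by blast
  note i = 1 2 3
  note X = i_ctx[OF i(4)] and Y = i_ctx[OF i(1)] and g = i_sub[OF i(5) X] and S = i_ty[OF i(2) Y]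
  note T = i_ty[OF i(3) ext[OF Y S]]
  note l = i_slift[OF X i(5,2)]
  show ?case
    using i(4) i_ty_sub[OF i(5) i_sigma[OF i(2,3)]] i_sigma[OF i_ty_sub[OF i(5,2)] i_ty_sub[OF l i(3)]]
      sigma_ty_sub[OF X Y g S T]
    by metis
next
  case h: (fst_sub G A B c D \<gamma>)
  from fam_ex[OF h(2,4)] obtain Y S T where 1: "IC G Y" "IT Y A S" and 2: "IT (ext C Y S) B T" by blast
  obtain X g where 3: "IC D X" "IS X \<gamma> Y g" using sub_ex[OF h(8) 1(1)] by blast
  obtain e where 4: "IE Y c (sigma_ty C Y S T) e" using tm_ex[OF h(6) 1(1) i_sigma[OF 1(2) 2]] by blast
  note i = 1 2 3 4
  note X = i_ctx[OF i(4)] and Y = i_ctx[OF i(1)]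
  note S = i_ty[OF i(2) Y] and g = i_sub[OF i(5) X] and e = i_tm[OF i(6) Y]
  note T = i_ty[OF i(3) ext[OF Y S]]
  note l = i_slift[OF X i(5,2)]
  show ?case
    using i(4) i_ty_sub[OF i(5,2)] i_tm_sub[OF i(5) i_fst[OF i(2,3,6)]]
      i_fst[OF i_ty_sub[OF i(5,2)] i_ty_sub[OF l i(3)]] i_tm_sub[OF i(5,6)] sigma_ty_sub[OF X Y g S T]
        fst_tm_sub[OF X Y g S T e]
    by metis
next
  case h: (snd_sub G A B c D \<gamma>)
  from fam_ex[OF h(2,4)] obtain Y S T where 1: "IC G Y" "IT Y A S" and 2: "IT (ext C Y S) B T" by blast
  obtain X g where 3: "IC D X" "IS X \<gamma> Y g" using sub_ex[OF h(8) 1(1)] by blast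
  obtain e where 4: "IE Y c (sigma_ty C Y S T) e" using tm_ex[OF h(6) 1(1) i_sigma[OF 1(2) 2]] by blast
  note i = 1 2 3 4
  note X = i_ctx[OF i(4)] and Y = i_ctx[OF i(1)]
  note S = i_ty[OF i(2) Y] and g = i_sub[OF i(5) X] and e = i_tm[OF i(6) Y]
  note T = i_ty[OF i(3) ext[OF Y S]]
  note l = i_slift[OF X i(5,2)]
  note f = fst_tm[OF Y S T e]
  \<comment> \<open>The value of the substituted term comes with a substituted Sigma-type, which
    \<open>i_snd\<close> needs in the form of a Sigma-type.\<close>
  have c: "IE X (ESub c \<gamma>) (sigma_ty C X (ty_sub C X Y S g)
      (ty_sub C (ext C X (ty_sub C X Y S g)) (ext C Y S) T (lift C X Y S g))) (tm_sub C X Y (sigma_ty C Y S T) e g)"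
    using i_tm_sub[OF i(5,6)] sigma_ty_sub[OF X Y g S T] by simp
  show ?case
    using i(4) i_ty_sub[OF i(5) i_ty_sub[OF i_sinst[OF i(1,2) i_fst[OF i(2,3,6)]] i(3)]]
      i_tm_sub[OF i(5) i_snd[OF i(2,3,6)]]
      i_snd[OF i_ty_sub[OF i(5,2)] i_ty_sub[OF l i(3)] c]
      ty_sub_inst[OF X Y S g f T] fst_tm_sub[OF X Y g S T e] snd_tm_sub[OF X Y g S T e]
    by metis
next
  case h: (pair_sub G A B a b D \<gamma>)
  from fam_ex[OF h(2,4)] obtain Y S T where 1: "IC G Y" "IT Y A S" and 2: "IT (ext C Y S) B T" by blast
  obtain X g where 3: "IC D X" "IS X \<gamma> Y g" using sub_ex[OF h(10) 1(1)] by blast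
  obtain e where 4: "IE Y a S e" using tm_ex[OF h(6) 1] by blast
  obtain f where 5: "IE Y b (ty_sub C Y (ext C Y S) T (inst C Y S e)) f"
    using tm_ex[OF h(8) 1(1) i_ty_sub[OF i_sinst[OF 1 4] 2]] by blast
  note i = 1 2 3 4 5
  note X = i_ctx[OF i(4)] and Y = i_ctx[OF i(1)]
  note S = i_ty[OF i(2) Y] and g = i_sub[OF i(5) X] and e = i_tm[OF i(6) Y] and f = i_tm[OF i(7) Y]
  note T = i_ty[OF i(3) ext[OF Y S]]
  note l = i_slift[OF X i(5,2)]
  have b: "IE X (ESub b \<gamma>) (ty_sub C X (ext C X (ty_sub C X Y S g))
        (ty_sub C (ext C X (ty_sub C X Y S g)) (ext C Y S) T (lift C X Y S g))
        (inst C X (ty_sub C X Y S g) (tm_sub C X Y S e g)))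
      (tm_sub C X Y (ty_sub C Y (ext C Y S) T (inst C Y S e)) f g)"
    using i_tm_sub[OF i(5,7)] ty_sub_inst[OF X Y S g e T] by simp
  show ?case
    using i(4) i_ty_sub[OF i(5) i_sigma[OF i(2,3)]] i_tm_sub[OF i(5) i_pair[OF i(2,3,6,7)]]
      i_pair[OF i_ty_sub[OF i(5,2)] i_ty_sub[OF l i(3)] i_tm_sub[OF i(5,6)] b]
      sigma_ty_sub[OF X Y g S T] pair_tm_sub[OF X Y g S T e f]
    by metis
next
  case h: (pi_cong G A A' B B')
  from h(2) obtain X S where i: "IC G X" "IT X A S" "IT X A' S" by blast
  show ?case using i ty_ex[OF h(4) i_ext[OF i(1,2)]] by (blast intro: i_pi)
next
  case h: (lam_cong G A A' B b b')
  from fam_ex[OF h(2,4)] obtain X S T where 1: "IC G X" "IT X A S" "IT X A' S" and 2: "IT (ext C X S) B T" by blast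
  obtain f where 3: "IE (ext C X S) b T f" "IE (ext C X S) b' T f"
    using tm_ex[OF h(6) i_ext[OF 1(1,2)] 2] by blast
  note i = 1 2 3
  show ?case using i(1) i_lam[OF i(2,5)] i_lam[OF i(3,6)] i_pi[OF i(2,4)] by blast
next
  case h: (app_cong G A A' B B' c c' a a')
  from fam_ex[OF h(2,4)] obtain X S T where 1: "IC G X" "IT X A S" "IT X A' S"
    and 2: "IT (ext C X S) B T" "IT (ext C X S) B' T" by blast
  obtain f where 3: "IE X c (pi_ty C X S T) f" "IE X c' (pi_ty C X S T) f"
    using tm_ex[OF h(6) 1(1) i_pi[OF 1(2) 2(1)]] by blast
  obtain e where 4: "IE X a S e" "IE X a' S e" using tm_ex[OF h(8) 1(1,2)] by blast
  note i = 1 2 4 3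
  show ?case using i(1) i_app[OF i(2,4,8,6)] i_app[OF i(3,5,9,7)] i_ty_sub[OF i_sinst[OF i(1,2,6)] i(4)] by blast
next
  case h: (beta G A B b a)
  from fam_ex[OF h(2,4)] obtain X S T where 1: "IC G X" "IT X A S" and 2: "IT (ext C X S) B T" by blast
  obtain e f where 3: "IE X a S e" "IE (ext C X S) b T f"
    using tm_ex[OF h(8) 1] tm_ex[OF h(6) i_ext[OF 1] 2] by blast
  note i = 1 2 3
  note X = i_ctx[OF i(1)]
  note S = i_ty[OF i(2) X] and e = i_tm[OF i(4) X]
  note T = i_ty[OF i(3) ext[OF X S]] and f = i_tm[OF i(5) ext[OF X S]]
  note s = i_sinst[OF i(1,2,4)]
  show ?case
    using i(1) i_app[OF i(2,3) i_lam[OF i(2,5)] i(4)] i_ty_sub[OF s i(3)] i_tm_sub[OF s i(5)]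
      beta[OF X S T f e]
    by metis
next
  case h: (eta G A B c)
  from fam_ex[OF h(2,4)] obtain X S T where 1: "IC G X" "IT X A S" and 2: "IT (ext C X S) B T" by blast
  obtain f where 3: "IE X c (pi_ty C X S T) f" using tm_ex[OF h(6) 1(1) i_pi[OF 1(2) 2]] by blast
  note i = 1 2 3
  note X = i_ctx[OF i(1)]
  note S = i_ty[OF i(2) X] and f = i_tm[OF i(4) X]
  note E = ext[OF X S] and p = pr[OF X S]
  note T = i_ty[OF i(3) E]
  let ?E = "ext C X S"
  let ?S = "ty_sub C ?E X S (pr C X S)"
  let ?T = "ty_sub C (ext C ?E ?S) ?E T (lift C ?E X S (pr C X S))"
  note lc = lift_char[OF E X S p]
  note jp = i_proj[OF X i(2)]
  note jS = i_ty_sub[OF jp i(2)] and l = i_slift[OF E jp i(2)]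
  note jT = i_ty_sub[OF l i(3)]
  have jc: "IE ?E (ESub c (SProj A)) (pi_ty C ?E ?S ?T) (tm_sub C ?E X (pi_ty C X S T) f (pr C X S))"
    using i_tm_sub[OF jp i(4)] pi_ty_sub[OF E X p S T] by simp
  \<comment> \<open>The type of the application under the abstraction is \<open>T\<close> again, so
    \<open>i_lam\<close> gives back the Pi-type of \<open>c\<close>.\<close>
  have t: "ty_sub C ?E (ext C ?E ?S) ?T (inst C ?E ?S (vr C X S)) = T"
    using lift_pr_inst_vr[OF X S] ty_sub_id[OF E T]
      ty_sub_comp[OF E lc(2) E inst_char(1)[OF E lc(1) vr[OF X S]] lc(5) T] by simp
  show ?case
    using i(1,4) i_pi[OF i(2,3)] i_lam[OF i(2) i_app[OF jS jT jc i_var[OF X i(2)]]] t eta[OF X S T f]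
    by metis
next
  case h: (pi_sub G A B D \<gamma>)
  from fam_ex[OF h(2,4)] obtain Y S T where 1: "IC G Y" "IT Y A S" and 2: "IT (ext C Y S) B T" by blast
  obtain X g where 3: "IC D X" "IS X \<gamma> Y g" using sub_ex[OF h(6) 1(1)] by blast
  note i = 1 2 3
  note X = i_ctx[OF i(4)] and Y = i_ctx[OF i(1)] and g = i_sub[OF i(5) X] and S = i_ty[OF i(2) Y]
  note T = i_ty[OF i(3) ext[OF Y S]]
  note l = i_slift[OF X i(5,2)]
  show ?case
    using i(4) i_ty_sub[OF i(5) i_pi[OF i(2,3)]] i_pi[OF i_ty_sub[OF i(5,2)] i_ty_sub[OF l i(3)]]
      pi_ty_sub[OF X Y g S T]
    by metis
next
  case h: (lam_sub G A B b D \<gamma>)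
  from fam_ex[OF h(2,4)] obtain Y S T where 1: "IC G Y" "IT Y A S" and 2: "IT (ext C Y S) B T" by blast
  obtain X g where 3: "IC D X" "IS X \<gamma> Y g" using sub_ex[OF h(8) 1(1)] by blast
  obtain f where 4: "IE (ext C Y S) b T f" using tm_ex[OF h(6) i_ext[OF 1] 2] by blast
  note i = 1 2 3 4
  note X = i_ctx[OF i(4)] and Y = i_ctx[OF i(1)] and g = i_sub[OF i(5) X] and S = i_ty[OF i(2) Y]
  note T = i_ty[OF i(3) ext[OF Y S]] and f = i_tm[OF i(6) ext[OF Y S]]
  note l = i_slift[OF X i(5,2)]
  show ?case
    using i(4) i_ty_sub[OF i(5) i_pi[OF i(2,3)]] i_tm_sub[OF i(5) i_lam[OF i(2,6)]]
      i_lam[OF i_ty_sub[OF i(5,2)] i_tm_sub[OF l i(6)]]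
      pi_ty_sub[OF X Y g S T] lam_tm_sub[OF X Y g S T f]
    by metis
next
  case h: (app_sub G A B c a D \<gamma>)
  from fam_ex[OF h(2,4)] obtain Y S T where 1: "IC G Y" "IT Y A S" and 2: "IT (ext C Y S) B T" by blast
  obtain X g where 3: "IC D X" "IS X \<gamma> Y g" using sub_ex[OF h(10) 1(1)] by blast
  obtain e f where 4: "IE Y a S e" "IE Y c (pi_ty C Y S T) f"
    using tm_ex[OF h(8) 1] tm_ex[OF h(6) 1(1) i_pi[OF 1(2) 2]] by blast
  note i = 1 2 3 4
  note X = i_ctx[OF i(4)] and Y = i_ctx[OF i(1)]
  note S = i_ty[OF i(2) Y] and g = i_sub[OF i(5) X] and e = i_tm[OF i(6) Y] and f = i_tm[OF i(7) Y]
  note T = i_ty[OF i(3) ext[OF Y S]]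
  note l = i_slift[OF X i(5,2)]
  have c: "IE X (ESub c \<gamma>) (pi_ty C X (ty_sub C X Y S g)
        (ty_sub C (ext C X (ty_sub C X Y S g)) (ext C Y S) T (lift C X Y S g)))
      (tm_sub C X Y (pi_ty C Y S T) f g)"
    using i_tm_sub[OF i(5,7)] pi_ty_sub[OF X Y g S T] by simp
  show ?case
    using i(4) i_ty_sub[OF i(5) i_ty_sub[OF i_sinst[OF i(1,2,6)] i(3)]]
      i_tm_sub[OF i(5) i_app[OF i(2,3,7,6)]]
      i_app[OF i_ty_sub[OF i(5,2)] i_ty_sub[OF l i(3)] c i_tm_sub[OF i(5,6)]]
      ty_sub_inst[OF X Y S g e T] app_tm_sub[OF X Y g S T f e]
    by metis
\<comment> \<open>What remains is symmetry, transitivity for contexts, and preservation for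
  substitutions and types: only values of contexts have to be identified.\<close>
qed (metis i_det(1))+

end

text \<open>The injectivity is that of the list and tree constructors.\<close>

lemma (in model) model_tele: "injective_model (tele_cwf C) (Leaf o\<^sub>C) u"
proof (intro injective_model.intro model.intro model_axioms.intro injective_model_axioms.intro
    type_theory_tele)
  show "Leaf o\<^sub>C \<in> Ty (tele_cwf C) (unit_ctx (tele_cwf C))"
    by (simp add: tele_simps base_in)
  show "e = tm_sub (tele_cwf C) X (unit_ctx (tele_cwf C)) (n1_ty (tele_cwf C)) (zero_tm (tele_cwf C)) s"
    if "u = Everywhere" "X \<in> Ctx (tele_cwf C)" "s \<in> Sub (tele_cwf C) X (unit_ctx (tele_cwf C))"
      "e \<in> Tm (tele_cwf C) X (ty_sub (tele_cwf C) X (unit_ctx (tele_cwf C)) (n1_ty (tele_cwf C)) s)"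
    for X s e
    using that n1_everywhere[of "cval C X" s e] by (simp add: tele_simps cval_in)
qed (auto simp: tele_simps)

section \<open>The morphism induced by the interpretation\<close>

context injective_model
begin

text \<open>By determinacy these descriptions denote the value whenever there is one; the other
  outputs are quantified away.\<close>

definition vC where "vC G = (THE X. IC G X)"
definition vS where "vS X \<gamma> = (THE g. \<exists>Y. IS X \<gamma> Y g)"
definition vT where "vT X A = (THE S. IT X A S)"
definition vE where "vE X a = (THE e. \<exists>S. IE X a S e)"

lemma vC: "IC G X \<Longrightarrow> vC G = X"
  unfolding vC_def using i_det(1) by blast
lemma vS: "\<lbrakk>X \<in> Ctx C; IS X \<gamma> Y g\<rbrakk> \<Longrightarrow> vS X \<gamma> = g"
  unfolding vS_def by (rule the_equality, blast, metis i_det(2))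
lemma vT: "\<lbrakk>X \<in> Ctx C; IT X A S\<rbrakk> \<Longrightarrow> vT X A = S"
  unfolding vT_def by (rule the_equality, blast, metis i_det(3))
lemma vE: "\<lbrakk>X \<in> Ctx C; IE X a S e\<rbrakk> \<Longrightarrow> vE X a = e"
  unfolding vE_def by (rule the_equality, blast, metis i_det(4))

definition interp_map :: "(rctx set, rsub set, rty set, rtm set, 'c, 's, 't, 'e) cwf_map" where
  "interp_map = \<lparr>
     FCtx = (\<lambda>X. if X \<in> Ctx (syn_cwf u) then vC (rep X) else undefined),
     FSub = (\<lambda>X Y g. if X \<in> Ctx (syn_cwf u) \<and> Y \<in> Ctx (syn_cwf u) \<and> g \<in> Sub (syn_cwf u) X Y
       then vS (vC (rep X)) (rep g) else undefined),
     FTy = (\<lambda>X S. if X \<in> Ctx (syn_cwf u) \<and> S \<in> Ty (syn_cwf u) X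
       then vT (vC (rep X)) (rep S) else undefined),
     FTm = (\<lambda>X S e. if X \<in> Ctx (syn_cwf u) \<and> S \<in> Ty (syn_cwf u) X \<and> e \<in> Tm (syn_cwf u) X S
       then vE (vC (rep X)) (rep e) else undefined)\<rparr>"

lemma IC_v: "ctxeq u G G' \<Longrightarrow> IC G (vC G) \<and> vC G' = vC G"
  using sound(1) vC by blast

lemmas iC = IC_v[THEN conjunct1] and vC_eq = IC_v[THEN conjunct2]
lemmas vC_in = i_ctx[OF iC]

lemma IS_v:
  assumes "subeq u G \<gamma> \<gamma>' D"
  shows "IS (vC G) \<gamma> (vC D) (vS (vC G) \<gamma>) \<and> vS (vC G) \<gamma>' = vS (vC G) \<gamma>"
proof -
  obtain X Y g where i: "IC G X" "IC D Y" "IS X \<gamma> Y g" "IS X \<gamma>' Y g" using sound(2)[OF assms] by blast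
  then show ?thesis using vS[OF i_ctx[OF i(1)]] vC by simp
qed

lemmas iS = IS_v[THEN conjunct1] and vS_eq = IS_v[THEN conjunct2]

lemma IT_v:
  assumes "tyeq u G A A'"
  shows "IT (vC G) A (vT (vC G) A) \<and> vT (vC G) A' = vT (vC G) A"
proof -
  obtain X S where i: "IC G X" "IT X A S" "IT X A' S" using sound(3)[OF assms] by blast
  then show ?thesis using vT[OF i_ctx[OF i(1)]] vC by simp
qed

lemmas iT = IT_v[THEN conjunct1] and vT_eq = IT_v[THEN conjunct2]

lemma IE_v:
  assumes "tmeq u G a a' A"
  shows "IE (vC G) a (vT (vC G) A) (vE (vC G) a) \<and> vE (vC G) a' = vE (vC G) a"
proof -
  obtain X S e where i: "IC G X" "IT X A S" "IE X a S e" "IE X a' S e" using sound(4)[OF assms] by blast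
  then show ?thesis using vE[OF i_ctx[OF i(1)]] vT[OF i_ctx[OF i(1)]] vC by simp
qed

lemmas iE = IE_v[THEN conjunct1] and vE_eq = IE_v[THEN conjunct2]

text \<open>\<open>interp_map\<close> evaluates chosen representatives. By soundness every
  representative has the same value, so \<open>rep\<close> disappears from the proofs below.\<close>

lemma F_ctx: "ctxeq u G G \<Longrightarrow> FCtx interp_map (ctx_cls u G) = vC G"
  and F_sub: "\<lbrakk>ctxeq u G G; ctxeq u D D; subeq u G \<gamma> \<gamma> D\<rbrakk>
    \<Longrightarrow> FSub interp_map (ctx_cls u G) (ctx_cls u D) (sub_cls u G \<gamma> D) = vS (vC G) \<gamma>"
  and F_ty: "\<lbrakk>ctxeq u G G; tyeq u G A A\<rbrakk>
    \<Longrightarrow> FTy interp_map (ctx_cls u G) (ty_cls u G A) = vT (vC G) A"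
  and F_tm: "\<lbrakk>ctxeq u G G; tyeq u G A A; tmeq u G a a A\<rbrakk>
    \<Longrightarrow> FTm interp_map (ctx_cls u G) (ty_cls u G A) (tm_cls u G a A) = vE (vC G) a"
  using vC_eq[OF rep_ctx] vS_eq[OF rep_sub] vT_eq[OF rep_ty] vE_eq[OF rep_tm]
  unfolding interp_map_def by (auto simp: mem_syn)

lemmas F_eval = F_ctx F_sub F_ty F_tm

lemma vS_in: "\<lbrakk>ctxeq u G G; subeq u G \<gamma> \<gamma> D\<rbrakk> \<Longrightarrow> vS (vC G) \<gamma>
  \<in> Sub C (vC G) (vC D)"
  by (rule i_sub[OF iS vC_in])

lemma vT_in: "\<lbrakk>ctxeq u G G; tyeq u G A A\<rbrakk> \<Longrightarrow> vT (vC G) A \<in> Ty C (vC G)"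
  by (rule i_ty[OF iT vC_in])

lemma vE_in: "\<lbrakk>ctxeq u G G; tmeq u G a a A\<rbrakk> \<Longrightarrow> vE (vC G) a \<in> Tm C (vC G) (vT (vC G) A)"
  by (rule i_tm[OF iE vC_in])

lemma v_unit: "vC CUnit = unit_ctx C"
  by (rule vC[OF i_unit])

lemma v_ext: "\<lbrakk>ctxeq u G G; tyeq u G A A\<rbrakk> \<Longrightarrow> vC (CExt G A) = ext C (vC G) (vT (vC G) A)"
  by (rule vC[OF i_ext[OF iC iT]])

lemma IT_ext:
  assumes "ctxeq u G G" "tyeq u G A A" "tyeq u (CExt G A) B B"
  shows "IT (ext C (vC G) (vT (vC G) A)) B (vT (ext C (vC G) (vT (vC G) A)) B)"
  using iT[OF assms(3)] unfolding v_ext[OF assms(1,2)] .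

lemma v_ty_sub: "\<lbrakk>ctxeq u G G; tyeq u D A A; subeq u G \<gamma> \<gamma> D\<rbrakk>
  \<Longrightarrow> vT (vC G) (TSub A \<gamma>) = ty_sub C (vC G) (vC D) (vT (vC D) A) (vS (vC G) \<gamma>)"
  by (rule vT[OF vC_in i_ty_sub[OF iS iT]])

lemma v_ty_inst:
  assumes "ctxeq u G G" "tyeq u G A A" "tyeq u (CExt G A) B B" "tmeq u G a a A"
  shows "vT (vC G) (TSub B (sinst G A a)) = ty_sub C (vC G) (ext C (vC G) (vT (vC G) A))
    (vT (ext C (vC G) (vT (vC G) A)) B) (inst C (vC G) (vT (vC G) A) (vE (vC G) a))"
  by (rule vT[OF vC_in[OF assms(1)] i_ty_sub[OF i_sinst[OF iC iT iE] IT_ext]]) (rule assms)+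

lemma v_sigma: "\<lbrakk>ctxeq u G G; tyeq u G A A; tyeq u (CExt G A) B B\<rbrakk> \<Longrightarrow> vT (vC G) (TSigma A B)
    = sigma_ty C (vC G) (vT (vC G) A) (vT (ext C (vC G) (vT (vC G) A)) B)"
  by (rule vT[OF vC_in i_sigma[OF iT IT_ext]])

lemma v_pi: "\<lbrakk>ctxeq u G G; tyeq u G A A; tyeq u (CExt G A) B B\<rbrakk> \<Longrightarrow> vT (vC G) (TPi A B)
    = pi_ty C (vC G) (vT (vC G) A) (vT (ext C (vC G) (vT (vC G) A)) B)"
  by (rule vT[OF vC_in i_pi[OF iT IT_ext]])

lemma strict_interp: "strict_cwf_morphism (syn_cwf u) C interp_map"
proof -
  let ?K = "syn_cwf u" and ?F = interp_map
  show ?thesis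
  proof (intro strict_cwf_morphism.intro strict_cwf_morphism_axioms.intro cwf_syn cwf_axioms)
    fix X assume "X \<in> Ctx ?K"
    then obtain G where G: "X = ctx_cls u G" "ctxeq u G G" by (auto simp: mem_syn)
    show "FCtx ?F X \<in> Ctx C" "FSub ?F X X (id_sub ?K X) = id_sub C (FCtx ?F X)"
      using G vC_in id_cong[OF G(2)] vS[OF vC_in i_id[OF iC[OF G(2)]]]
      by (simp_all add: cls_syn F_eval)
  next
    fix X Y s assume *: "X \<in> Ctx ?K" "Y \<in> Ctx ?K" "s \<in> Sub ?K X Y"
    then obtain G D where G: "X = ctx_cls u G" "ctxeq u G G" and D: "Y = ctx_cls u D" "ctxeq u D D"
      by (auto simp: mem_syn)
    with * obtain \<gamma> where g: "s = sub_cls u G \<gamma> D" "subeq u G \<gamma> \<gamma> D" by (auto simp: mem_syn)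
    show "FSub ?F X Y s \<in> Sub C (FCtx ?F X) (FCtx ?F Y)"
      using G D g vS_in by (simp add: F_eval)
    {
      fix S assume "S \<in> Ty ?K Y"
      with D obtain A where A: "S = ty_cls u D A" "tyeq u D A A" by (auto simp: mem_syn)
      note t = ty_sub_cong[OF A(2) g(2)]
      show "FTy ?F X (ty_sub ?K X Y S s) = ty_sub C (FCtx ?F X) (FCtx ?F Y) (FTy ?F Y S) (FSub ?F X Y s)"
        using G D g A t by (simp add: cls_syn F_eval v_ty_sub)
      {
        fix e assume "e \<in> Tm ?K Y S"
        with D A obtain a where a: "e = tm_cls u D a A" "tmeq u D a a A" by (auto simp: mem_syn)
        show "FTm ?F X (ty_sub ?K X Y S s) (tm_sub ?K X Y S e s)
          = tm_sub C (FCtx ?F X) (FCtx ?F Y) (FTy ?F Y S) (FTm ?F Y S e) (FSub ?F X Y s)"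
          using G D g A t a tm_sub_cong[OF a(2) g(2)] vE[OF vC_in i_tm_sub[OF iS[OF g(2)] iE[OF a(2)]]]
          by (simp add: cls_syn F_eval)
      next
        fix e assume "e \<in> Tm ?K X (ty_sub ?K X Y S s)"
        with G D g A t obtain a where a: "e = tm_cls u G a (TSub A \<gamma>)" "tmeq u G a a (TSub A \<gamma>)"
          by (auto simp: mem_syn cls_syn)
        have i: "IE (vC G) a (ty_sub C (vC G) (vC D) (vT (vC D) A) (vS (vC G) \<gamma>)) (vE (vC G) a)"
          using iE[OF a(2)] G A g by (simp add: v_ty_sub)
        show "FSub ?F X (ext ?K Y S) (sub_ext ?K X Y S s e)
          = sub_ext C (FCtx ?F X) (FCtx ?F Y) (FTy ?F Y S) (FSub ?F X Y s) (FTm ?F X (ty_sub ?K X Y S s) e)"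
          using G D g A t a ext_cong[OF D(2) A(2)] sub_ext_cong[OF A(2) g(2) a(2)]
            vS[OF vC_in i_sub_ext[OF iS[OF g(2)] iT[OF A(2)] i]]
          by (simp add: cls_syn sub_ext_syn F_eval)
      }
    }
    fix Z r assume **: "Z \<in> Ctx ?K" "r \<in> Sub ?K Z X"
    then obtain K where T: "Z = ctx_cls u K" "ctxeq u K K" by (auto simp: mem_syn)
    with ** G obtain \<delta> where d: "r = sub_cls u K \<delta> G" "subeq u K \<delta> \<delta> G" by (auto simp: mem_syn)
    show "FSub ?F Z Y (comp_sub ?K Z X Y s r)
        = comp_sub C (FCtx ?F Z) (FCtx ?F X) (FCtx ?F Y) (FSub ?F X Y s) (FSub ?F Z X r)"
      using G D g T d comp_cong[OF d(2) g(2)] vS[OF vC_in i_comp[OF iS[OF d(2)] iS[OF g(2)]]]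
      by (simp add: cls_syn F_eval)
  next
    fix X S assume *: "X \<in> Ctx ?K" "S \<in> Ty ?K X"
    then obtain G A where G: "X = ctx_cls u G" "ctxeq u G G" and A: "S = ty_cls u G A" "tyeq u G A A"
      by (auto simp: mem_syn)
    note E = ext_cong[OF G(2) A(2)] and p = proj_cong[OF A(2)] and q = var_cong[OF A(2)]
    note t = ty_sub_cong[OF A(2) p]
    show "FTy ?F X S \<in> Ty C (FCtx ?F X)" using G A vT_in by (simp add: F_eval)
    show "FCtx ?F (ext ?K X S) = ext C (FCtx ?F X) (FTy ?F X S)"
      using G A E by (simp add: cls_syn F_eval v_ext)
    show "FSub ?F (ext ?K X S) X (pr ?K X S) = pr C (FCtx ?F X) (FTy ?F X S)"
      "FTm ?F (ext ?K X S) (ty_sub ?K (ext ?K X S) X S (pr ?K X S)) (vr ?K X S) = vr C (FCtx ?F X) (FTy ?F X S)"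
      using G A E p q t vS[OF _ i_proj[OF vC_in iT]] vE[OF _ i_var[OF vC_in iT]] vC_in[OF E]
      by (simp_all add: cls_syn F_eval v_ext)
    fix e assume "e \<in> Tm ?K X S"
    with G A obtain a where "e = tm_cls u G a A" "tmeq u G a a A" by (auto simp: mem_syn)
    then show "FTm ?F X S e \<in> Tm C (FCtx ?F X) (FTy ?F X S)" using G A vE_in by (simp add: F_eval)
  next
    show "FCtx ?F (unit_ctx ?K) = unit_ctx C" using unit_cong by (simp add: cls_syn F_eval v_unit)
  qed (auto simp: interp_map_def)
qed

lemma preserves_I_interp: "preserves_I (syn_cwf u) C interp_map"
proof (intro preserves_I.intro preserves_I_axioms.intro strict_interp)
  let ?K = "syn_cwf u" and ?F = interp_map
  fix X S e assume *: "X \<in> Ctx ?K" "S \<in> Ty ?K X" "e \<in> Tm ?K X S"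
  from *(1,2) obtain G A where G: "X = ctx_cls u G" "ctxeq u G G" and A: "S = ty_cls u G A" "tyeq u G A A"
    by (auto simp: mem_syn)
  with * obtain a where a: "e = tm_cls u G a A" "tmeq u G a a A" by (auto simp: mem_syn)
  show "FTm ?F X (id_ty ?K X S e e) (refl_tm ?K X S e) = refl_tm C (FCtx ?F X) (FTy ?F X S) (FTm ?F X S e)"
    using G A a idty_cong[OF A(2) a(2,2)] refl_cong[OF a(2)] vE[OF vC_in i_refl[OF iE[OF a(2)]]]
    by (simp add: ops_syn F_eval)
  fix f assume "f \<in> Tm ?K X S"
  with G A obtain b where b: "f = tm_cls u G b A" "tmeq u G b b A" by (auto simp: mem_syn)
  show "FTy ?F X (id_ty ?K X S e f) = id_ty C (FCtx ?F X) (FTy ?F X S) (FTm ?F X S e) (FTm ?F X S f)"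
    using G A a b idty_cong[OF A(2) a(2) b(2)] vT[OF vC_in i_id_ty[OF iT[OF A(2)] iE[OF a(2)] iE[OF b(2)]]]
    by (simp add: ops_syn F_eval)
qed

lemma preserves_N1_interp: "preserves_N1 (syn_cwf u) C interp_map"
  using unit_cong n1_cong zero_cong vT[OF unit_ctx i_n1] vE[OF unit_ctx i_zero]
  by (intro preserves_N1.intro preserves_N1_axioms.intro strict_interp)
    (simp_all add: ops_syn F_eval v_unit)

lemma interp_base: "FTy interp_map (unit_ctx (syn_cwf u)) (syn_base u) = o\<^sub>C"
  using unit_cong base_cong vT[OF unit_ctx i_base] by (simp add: syn_base_def unit_syn F_eval v_unit)

lemma preserves_Sigma_interp: "preserves_Sigma (syn_cwf u) C interp_map"
proof (intro preserves_Sigma.intro preserves_Sigma_axioms.intro strict_interp)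
  let ?K = "syn_cwf u" and ?F = interp_map
  fix X S T assume "X \<in> Ctx ?K" "S \<in> Ty ?K X" "T \<in> Ty ?K (ext ?K X S)"
  then obtain G A B where c: "X = ctx_cls u G" "ctxeq u G G" "S = ty_cls u G A" "tyeq u G A A"
    "ctxeq u (CExt G A) (CExt G A)" "T = ty_cls u (CExt G A) B" "tyeq u (CExt G A) B B"
    by (rule syn_ext_cases)
  note s = sigma_cong[OF c(4,7)] and X = vC_in[OF c(2)]
  note i = iT[OF c(4)] IT_ext[OF c(2,4,7)]
  note ev = ops_syn F_eval v_ext v_sigma v_ty_inst
  show "FTy ?F X (sigma_ty ?K X S T) = sigma_ty C (FCtx ?F X) (FTy ?F X S) (FTy ?F (ext ?K X S) T)"
    using c s by (simp add: ev)
  {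
    fix z assume "z \<in> Tm ?K X (sigma_ty ?K X S T)"
    with c s obtain t where t: "z = tm_cls u G t (TSigma A B)" "tmeq u G t t (TSigma A B)"
      by (auto simp: mem_syn ops_syn)
    note f = fst_cong[OF c(4,7) t(2)] and iz = iE[OF t(2), unfolded v_sigma[OF c(2,4,7)]]
    note j = sinst_cong[OF c(2,4) f]
    show "FTm ?F X S (fst_tm ?K X S T z)
      = fst_tm C (FCtx ?F X) (FTy ?F X S) (FTy ?F (ext ?K X S) T) (FTm ?F X (sigma_ty ?K X S T) z)"
      using c s t f vE[OF X i_fst[OF i iz]] by (simp add: ev)
    show "FTm ?F X (ty_sub ?K X (ext ?K X S) T (inst ?K X S (fst_tm ?K X S T z))) (snd_tm ?K X S T z)
      = snd_tm C (FCtx ?F X) (FTy ?F X S) (FTy ?F (ext ?K X S) T) (FTm ?F X (sigma_ty ?K X S T) z)"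
      using c s t f j ty_sub_cong[OF c(7) j] snd_cong[OF c(4,7) t(2)] vE[OF X i_snd[OF i iz]]
      by (simp add: ev)
  }
  fix e f assume e: "e \<in> Tm ?K X S" and f: "f \<in> Tm ?K X (ty_sub ?K X (ext ?K X S) T (inst ?K X S e))"
  from c e obtain a where a: "e = tm_cls u G a A" "tmeq u G a a A" by (auto simp: mem_syn)
  note j = sinst_cong[OF c(2,4) a(2)]
  note t = ty_sub_cong[OF c(7) j]
  from f c a j t obtain b where b: "f = tm_cls u G b (TSub B (sinst G A a))" "tmeq u G b b (TSub B (sinst G A a))"
    by (auto simp: mem_syn ops_syn)
  show "FTm ?F X (sigma_ty ?K X S T) (pair_tm ?K X S T e f)
      = pair_tm C (FCtx ?F X) (FTy ?F X S) (FTy ?F (ext ?K X S) T) (FTm ?F X S e)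
          (FTm ?F X (ty_sub ?K X (ext ?K X S) T (inst ?K X S e)) f)"
    using c s a b j t pair_cong[OF c(4,7) a(2) b(2)]
      vE[OF X i_pair[OF i iE[OF a(2)] iE[OF b(2), unfolded v_ty_inst[OF c(2,4,7) a(2)]]]]
    by (simp add: ev)
qed

lemma preserves_Pi_interp: "preserves_Pi (syn_cwf u) C interp_map"
proof (intro preserves_Pi.intro preserves_Pi_axioms.intro strict_interp)
  let ?K = "syn_cwf u" and ?F = interp_map
  fix X S T assume "X \<in> Ctx ?K" "S \<in> Ty ?K X" "T \<in> Ty ?K (ext ?K X S)"
  then obtain G A B where c: "X = ctx_cls u G" "ctxeq u G G" "S = ty_cls u G A" "tyeq u G A A"
    "ctxeq u (CExt G A) (CExt G A)" "T = ty_cls u (CExt G A) B" "tyeq u (CExt G A) B B"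
    by (rule syn_ext_cases)
  note s = pi_cong[OF c(4,7)] and X = vC_in[OF c(2)]
  note i = iT[OF c(4)] IT_ext[OF c(2,4,7)]
  note ev = ops_syn F_eval v_ext v_pi
  show "FTy ?F X (pi_ty ?K X S T) = pi_ty C (FCtx ?F X) (FTy ?F X S) (FTy ?F (ext ?K X S) T)"
    using c s by (simp add: ev)
  {
    fix f assume "f \<in> Tm ?K (ext ?K X S) T"
    with c obtain b where b: "f = tm_cls u (CExt G A) b B" "tmeq u (CExt G A) b b B"
      by (auto simp: mem_syn ops_syn)
    show "FTm ?F X (pi_ty ?K X S T) (lam_tm ?K X S T f)
      = lam_tm C (FCtx ?F X) (FTy ?F X S) (FTy ?F (ext ?K X S) T) (FTm ?F (ext ?K X S) T f)"
      using c s b lam_cong[OF c(4,7) b(2)] vE[OF X i_lam[OF i(1) iE[OF b(2), unfolded v_ext[OF c(2,4)]]]]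
      by (simp add: ev)
  }
  fix z e assume "z \<in> Tm ?K X (pi_ty ?K X S T)" "e \<in> Tm ?K X S"
  with c s obtain t a where t: "z = tm_cls u G t (TPi A B)" "tmeq u G t t (TPi A B)"
    and a: "e = tm_cls u G a A" "tmeq u G a a A" by (auto simp: mem_syn ops_syn)
  note j = sinst_cong[OF c(2,4) a(2)]
  show "FTm ?F X (ty_sub ?K X (ext ?K X S) T (inst ?K X S e)) (app_tm ?K X S T z e)
      = app_tm C (FCtx ?F X) (FTy ?F X S) (FTy ?F (ext ?K X S) T) (FTm ?F X (pi_ty ?K X S T) z) (FTm ?F X S e)"
    using c s a t j ty_sub_cong[OF c(7) j] app_cong[OF c(4,7) t(2) a(2)]
      vE[OF X i_app[OF i iE[OF t(2), unfolded v_pi[OF c(2,4,7)]] iE[OF a(2)]]]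
    by (simp add: ev)
qed

end

section \<open>Uniqueness of the interpretation\<close>

lemmas conjs = conjunct1 conjunct2

text \<open>Agreement on \<open>\<Gamma>.A\<close> does not imply agreement on \<open>\<Gamma>\<close> when context extension in the codomain
  is not injective, so it is required hereditarily.\<close>

inductive agree_ctx :: "('c, 's, 't, 'e, 'm) tcwf_scheme \<Rightarrow> ('c, 's, 't, 'e, 'c2, 's2, 't2, 'e2) cwf_map
    \<Rightarrow> ('c, 's, 't, 'e, 'c2, 's2, 't2, 'e2) cwf_map \<Rightarrow> 'c \<Rightarrow> bool"
  for C F G where
  unit: "agree_ctx C F G (unit_ctx C)"
| ext: "\<lbrakk>agree_ctx C F G X; X \<in> Ctx C; S \<in> Ty C X; FTy F X S = FTy G X S\<rbrakk>
    \<Longrightarrow> agree_ctx C F G (ext C X S)"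

lemma agree_FCtx:
  assumes "strict_cwf_morphism C D F" "strict_cwf_morphism C D G" "agree_ctx C F G X"
  shows "FCtx F X = FCtx G X"
  using assms(3)
  by induction (simp_all add: strict_cwf_morphism.F_unit[OF assms(1)] strict_cwf_morphism.F_unit[OF assms(2)]
      strict_cwf_morphism.F_ext[OF assms(1)] strict_cwf_morphism.F_ext[OF assms(2)])

context injective_model
begin

text \<open>Every interpreted element is built by operations that both morphisms preserve, so
  induction over the interpretation shows agreement there; nothing is claimed about other elements
  of \<open>C\<close>. Agreement on a context is a hypothesis where the context is an input, and a
  conclusion where it is an output.\<close>

lemma agree:
  fixes D :: "('c2, 's2, 't2, 'e2) tcwf" and F G :: "('c, 's, 't, 'e, 'c2, 's2, 't2, 'e2) cwf_map"
  assumes F: "preserves_I C D F" "preserves_N1 C D F" "preserves_Sigma C D F" "preserves_Pi C D F"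
    and G: "preserves_I C D G" "preserves_N1 C D G" "preserves_Sigma C D G" "preserves_Pi C D G"
    and base: "FTy F (unit_ctx C) o\<^sub>C = FTy G (unit_ctx C) o\<^sub>C"
  shows "IC \<Gamma> X \<Longrightarrow> agree_ctx C F G X" (is "PROP ?P1")
    and "IS X \<gamma> Y g \<Longrightarrow> X \<in> Ctx C \<Longrightarrow> agree_ctx C F G X
      \<Longrightarrow> agree_ctx C F G Y \<and> FSub F X Y g = FSub G X Y g" (is "PROP ?P2")
    and "IT X A S \<Longrightarrow> X \<in> Ctx C \<Longrightarrow> agree_ctx C F G X \<Longrightarrow> FTy F X
      S = FTy G X S" (is "PROP ?P3")
    and "IE X a S e \<Longrightarrow> X \<in> Ctx C \<Longrightarrow> agree_ctx C F G X
      \<Longrightarrow> FTy F X S = FTy G X S \<and> FTm F X S e = FTm G X S e" (is "PROP ?P4")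
proof -
  interpret FI: preserves_I C D F by fact
  interpret FN: preserves_N1 C D F by fact
  interpret FS: preserves_Sigma C D F by fact
  interpret FP: preserves_Pi C D F by fact
  interpret GI: preserves_I C D G by fact
  interpret GN: preserves_N1 C D G by fact
  interpret GS: preserves_Sigma C D G by fact
  interpret GP: preserves_Pi C D G by fact
  note agree_FCtx = agree_FCtx[OF FI.strict_cwf_morphism_axioms GI.strict_cwf_morphism_axioms]
  \<comment> \<open>\<open>i_proj\<close> and \<open>i_var\<close> start in an extended context and
    go down to \<open>X\<close>. Injectivity in the domain identifies the last step of the
    hereditary agreement.\<close>
  have agree_ext: "agree_ctx C F G X \<and> FTy F X S = FTy G X S"
    if "agree_ctx C F G (ext C X S)" "X \<in> Ctx C" "S \<in> Ty C X" for X S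
    using that ext_inj ext_neq_unit by (cases rule: agree_ctx.cases) metis+
  \<comment> \<open>\<open>bang_sub\<close> is not among the operations that a strict morphism
    preserves by definition; both images are maps into the terminal context of
    \<open>D\<close>.\<close>
  have bang: "FSub F X (unit_ctx C) (bang_sub C X) = FSub G X (unit_ctx C) (bang_sub C X)"
    if "X \<in> Ctx C" "FCtx F X = FCtx G X" for X
  proof (rule FI.cod.to_unit_eq)
    show "FCtx F X \<in> Ctx D" using FI.FCtx[OF that(1)] .
    show "FSub F X (unit_ctx C) (bang_sub C X) \<in> Sub D (FCtx F X) (unit_ctx D)"
      using FI.FSub[OF that(1) unit_ctx bang_sub[OF that(1)]] FI.F_unit by simp
    show "FSub G X (unit_ctx C) (bang_sub C X) \<in> Sub D (FCtx F X) (unit_ctx D)"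
      using GI.FSub[OF that(1) unit_ctx bang_sub[OF that(1)]] GI.F_unit that(2) by simp
  qed
  have inst: "FSub F X (ext C X S) (inst C X S e) = FSub G X (ext C X S) (inst C X S e)"
    if "X \<in> Ctx C" "S \<in> Ty C X" "e \<in> Tm C X S" "FCtx F X = FCtx G X" "FTy F X S = FTy G X S"
      "FTm F X S e = FTm G X S e" for X S e
    unfolding inst_def
    using FI.F_sub_ext[of X X S "id_sub C X" e] GI.F_sub_ext[of X X S "id_sub C X" e] that id_sub ty_sub_id
      FI.F_id GI.F_id by simp
  show "PROP ?P1" and "PROP ?P2" and "PROP ?P3" and "PROP ?P4"
  proof (induction rule: IC_IS_IT_IE.inducts)
    case i_unit
    show ?case by (rule agree_ctx.unit)
  next
    case (i_ext \<Gamma> X A S)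
    then show ?case using i_ctx i_ty by (blast intro: agree_ctx.ext)
  next
    case (i_comp X \<delta> Y d \<gamma> Z g)
    note Y = conjs[OF i_typed(2)[OF i_comp(1,5)]] and Z = i_typed(2)[OF i_comp(3), OF Y(1)]
    then show ?case using i_comp agree_FCtx by (auto simp: FI.F_comp GI.F_comp)
  next
    case (i_id \<Gamma> X)
    then show ?case using agree_FCtx by (auto simp: FI.F_id GI.F_id)
  next
    case (i_bang \<Gamma> X)
    then show ?case using agree_FCtx bang agree_ctx.unit by blast
  next
    case (i_proj X A S)
    note S = i_ty[OF i_proj(2,1)]
    then show ?case
      using i_proj agree_ext[OF i_proj(5)] agree_FCtx[of X] by (auto simp: FI.F_pr GI.F_pr)
  next
    case (i_sub_ext X \<gamma> Y g A S a e)
    note Y = conjs[OF i_typed(2)[OF i_sub_ext(1,7)]]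
    note S = i_ty[OF i_sub_ext(3), OF Y(1)] and e = i_tm[OF i_sub_ext(5,7)]
    show ?case
      using i_sub_ext Y S e agree_FCtx[of X] agree_FCtx[of Y]
      by (auto simp: FI.F_sub_ext GI.F_sub_ext intro: agree_ctx.ext)
  next
    case i_base
    show ?case by (rule base)
  next
    case (i_ty_sub X \<gamma> Y g A S)
    note Y = conjs[OF i_typed(2)[OF i_ty_sub(1,5)]]
    note S = i_ty[OF i_ty_sub(3), OF Y(1)]
    show ?case
      using i_ty_sub Y S agree_FCtx[of X] agree_FCtx[of Y] by (auto simp: FI.F_ty_sub GI.F_ty_sub)
  next
    case (i_id_ty X A S a e b f)
    note t = i_ty[OF i_id_ty(1,7)] i_tm[OF i_id_ty(3,7)] i_tm[OF i_id_ty(5,7)]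
    show ?case using i_id_ty t agree_FCtx[of X] by (auto simp: FI.F_id_ty GI.F_id_ty)
  next
    case i_n1
    show ?case using FN.F_n1_ty GN.F_n1_ty by simp
  next
    case (i_sigma X A S B T)
    note S = i_ty[OF i_sigma(1,5)]
    note E = ext[OF i_sigma(5) S]
    note T = i_ty[OF i_sigma(3) E]
    show ?case using i_sigma S E T agree_FCtx[of X] agree_ctx.ext[OF i_sigma(6,5) S]
      by (auto simp: FS.F_sigma_ty GS.F_sigma_ty)
  next
    case (i_pi X A S B T)
    note S = i_ty[OF i_pi(1,5)]
    note E = ext[OF i_pi(5) S]
    note T = i_ty[OF i_pi(3) E]
    show ?case using i_pi S E T agree_FCtx[of X] agree_ctx.ext[OF i_pi(6,5) S]
      by (auto simp: FP.F_pi_ty GP.F_pi_ty)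
  next
    case (i_tm_sub X \<gamma> Y g a S e)
    note Y = conjs[OF i_typed(2)[OF i_tm_sub(1,5)]]
    note S = i_typed(4)[OF i_tm_sub(3), OF Y(1)]
    show ?case
      using i_tm_sub Y S agree_FCtx[of X] agree_FCtx[of Y]
      by (auto simp: FI.F_ty_sub GI.F_ty_sub FI.F_tm_sub GI.F_tm_sub)
  next
    case (i_var X A S)
    note S = i_ty[OF i_var(2,1)]
    note h = agree_ext[OF i_var(5,1) S]
    show ?case
      using i_var S h agree_FCtx[of X] ext[OF i_var(1) S] pr[OF i_var(1) S]
      by (auto simp: FI.F_vr GI.F_vr FI.F_ty_sub GI.F_ty_sub FI.F_pr GI.F_pr FI.F_ext GI.F_ext)
  next
    case (i_refl X a S e)
    note S = i_typed(4)[OF i_refl(1,3)]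
    show ?case using i_refl S agree_FCtx[of X]
      by (auto simp: FI.F_id_ty GI.F_id_ty FI.F_refl_tm GI.F_refl_tm)
  next
    case i_zero
    show ?case using FN.F_n1_ty GN.F_n1_ty FN.F_zero_tm GN.F_zero_tm by simp
  next
    case (i_fst X A S B T c e)
    note X = i_fst(7) and ag = i_fst(8)
    note S = i_ty[OF i_fst(1) X] and e = i_tm[OF i_fst(5) X]
    note E = ext[OF X S]
    note T = i_ty[OF i_fst(3) E]
    have st: "FTy F X S = FTy G X S" "FTy F (ext C X S) T = FTy G (ext C X S) T"
      "FTm F X (sigma_ty C X S T) e = FTm G X (sigma_ty C X S T) e"
      using i_fst agree_ctx.ext[OF ag X S] E by auto
    then show ?case
      using agree_FCtx[OF ag] X S T e by (simp add: FS.F_fst_tm GS.F_fst_tm)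
  next
    case (i_snd X A S B T c e)
    note X = i_snd(7) and ag = i_snd(8)
    note S = i_ty[OF i_snd(1) X] and e = i_tm[OF i_snd(5) X]
    note E = ext[OF X S]
    note T = i_ty[OF i_snd(3) E]
    note f = fst_tm[OF X S T e]
    note i = inst_char(1)[OF X S f]
    have st: "FTy F X S = FTy G X S" "FTy F (ext C X S) T = FTy G (ext C X S) T"
      "FTm F X (sigma_ty C X S T) e = FTm G X (sigma_ty C X S T) e"
      using i_snd agree_ctx.ext[OF ag X S] E by auto
    have fst: "FTm F X S (fst_tm C X S T e) = FTm G X S (fst_tm C X S T e)"
      using st agree_FCtx[OF ag] X S T e by (simp add: FS.F_fst_tm GS.F_fst_tm)
    show ?case
      using st agree_FCtx[OF ag] X S T e i E inst[OF X S f agree_FCtx[OF ag] st(1) fst]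
      by (simp add: FS.F_snd_tm GS.F_snd_tm FI.F_ty_sub GI.F_ty_sub FI.F_ext GI.F_ext)
  next
    case (i_pair X A S B T a e b f)
    note X = i_pair(9) and ag = i_pair(10)
    note S = i_ty[OF i_pair(1) X] and e = i_tm[OF i_pair(5) X] and f = i_tm[OF i_pair(7) X]
    note E = ext[OF X S]
    note T = i_ty[OF i_pair(3) E]
    have st: "FTy F X S = FTy G X S" "FTy F (ext C X S) T = FTy G (ext C X S) T"
      "FTm F X S e = FTm G X S e"
      using i_pair agree_ctx.ext[OF ag X S] E by auto
    show ?case
      using st i_pair agree_FCtx[OF ag] X S T e f E
      by (auto simp: FS.F_sigma_ty GS.F_sigma_ty FS.F_pair_tm GS.F_pair_tm)
  next
    case (i_app X A S B T c f a e)
    note X = i_app(9) and ag = i_app(10)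
    note S = i_ty[OF i_app(1) X] and f = i_tm[OF i_app(5) X] and e = i_tm[OF i_app(7) X]
    note E = ext[OF X S]
    note T = i_ty[OF i_app(3) E]
    note i = inst_char(1)[OF X S e]
    have st: "FTy F X S = FTy G X S" "FTy F (ext C X S) T = FTy G (ext C X S) T"
      "FTm F X S e = FTm G X S e"
      using i_app agree_ctx.ext[OF ag X S] E by auto
    show ?case
      using st i_app agree_FCtx[OF ag] X S T e f E i inst[OF X S e agree_FCtx[OF ag] st(1,3)]
      by (auto simp: FP.F_app_tm GP.F_app_tm FI.F_ty_sub GI.F_ty_sub FI.F_ext GI.F_ext)
  next
    case (i_lam X A S b T f)
    note X = i_lam(5) and ag = i_lam(6)
    note S = i_ty[OF i_lam(1) X]
    note E = ext[OF X S]
    note T = i_typed(4)[OF i_lam(3) E]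
    have st: "FTy F X S = FTy G X S" "FTy F (ext C X S) T = FTy G (ext C X S) T"
      "FTm F (ext C X S) T f = FTm G (ext C X S) T f"
      using i_lam agree_ctx.ext[OF ag X S] E by auto
    show ?case
      using st agree_FCtx[OF ag] X S T by (auto simp: FP.F_pi_ty GP.F_pi_ty FP.F_lam_tm GP.F_lam_tm)
  qed
qed

end

section \<open>Reading values back in the syntactic cwf\<close>

text \<open>A term is read back over the type suggested by its outermost constructor; this moves it
  to the type that was asked for.\<close>

lemma tm_cls_conv:
  assumes "ctxeq u G G" "tyeq u G A A" "ty_cls u G R = ty_cls u G A" "tmeq u G a a R"
  shows "tmeq u G a a A \<and> tm_cls u G a R = tm_cls u G a A"
  using ty_clsD[OF assms(3,2)] tm_conv[OF assms(1) _ assms(4)] tm_cls_eq[OF assms(1) _ assms(4)] by blast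

context model
begin

text \<open>Each rule of the interpretation is matched by the syntactic rule for the same
  constructor, since \<open>V\<close> preserves the operations. Typability of the raw expression is
  a conclusion. The representatives \<open>G\<close> and \<open>R\<close> are arbitrary, because the
  semantic data fix contexts and types only up to derivable equality.\<close>

lemma readback:
  fixes V :: "('c, 's, 't, 'e, rctx set, rsub set, rty set, rtm set) cwf_map"
  assumes V: "preserves_I C (syn_cwf u) V" "preserves_N1 C (syn_cwf u) V"
      "preserves_Sigma C (syn_cwf u) V" "preserves_Pi C (syn_cwf u) V"
    and base: "FTy V (unit_ctx C) o\<^sub>C = syn_base u"
  shows "IC G X \<Longrightarrow> ctxeq u G G \<and> FCtx V X = ctx_cls u G" (is "PROP ?P1")
    and "IS X \<gamma> Y g \<Longrightarrow> X \<in> Ctx C \<Longrightarrow> ctxeq u G G \<Longrightarrow> FCtx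
      V X = ctx_cls u G
      \<Longrightarrow> \<exists>D. ctxeq u D D \<and> FCtx V Y = ctx_cls u D \<and> subeq u G \<gamma>
        \<gamma> D \<and> FSub V X Y g = sub_cls u G \<gamma> D" (is "PROP ?P2")
    and "IT X A S \<Longrightarrow> X \<in> Ctx C \<Longrightarrow> ctxeq u G G \<Longrightarrow> FCtx V X = ctx_cls u G
      \<Longrightarrow> tyeq u G A A \<and> FTy V X S = ty_cls u G A" (is "PROP ?P3")
    and "IE X a S e \<Longrightarrow> X \<in> Ctx C \<Longrightarrow> ctxeq u G G \<Longrightarrow> FCtx V X = ctx_cls u G
      \<Longrightarrow> tyeq u G R R \<Longrightarrow> FTy V X S = ty_cls u G R
      \<Longrightarrow> tmeq u G a a R \<and> FTm V X S e = tm_cls u G a R" (is "PROP ?P4")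
proof -
  interpret VI: preserves_I C "syn_cwf u" V by fact
  interpret VN: preserves_N1 C "syn_cwf u" V by fact
  interpret VS: preserves_Sigma C "syn_cwf u" V by fact
  interpret VP: preserves_Pi C "syn_cwf u" V by fact
  have ctx_ex: "\<exists>G. ctxeq u G G \<and> FCtx V X = ctx_cls u G" if "X \<in> Ctx C" for X
    using VI.FCtx[OF that] by (auto simp: Ctx_syn)
  have ty_ex: "\<exists>A. tyeq u G A A \<and> FTy V X S = ty_cls u G A"
    if "X \<in> Ctx C" "S \<in> Ty C X" "ctxeq u G G" "FCtx V X = ctx_cls u G" for X S G
    using VI.FTy[OF that(1,2)] that(3,4) by (auto simp: Ty_syn)
  have ext_ex: "ctxeq u (CExt G A) (CExt G A) \<and> FCtx V (ext C X S) = ctx_cls u (CExt G A)"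
    if "X \<in> Ctx C" "S \<in> Ty C X" "ctxeq u G G" "FCtx V X = ctx_cls u G" "tyeq u G A A"
      "FTy V X S = ty_cls u G A" for X S G A
    using VI.F_ext[OF that(1,2)] that ext_cong[OF that(3,5)] by (simp add: ext_syn)
  have V_bang: "FSub V X (unit_ctx C) (bang_sub C X) = sub_cls u G (SBang G) CUnit"
    if "X \<in> Ctx C" "ctxeq u G G" "FCtx V X = ctx_cls u G" for X G
  proof (rule VI.cod.to_unit_eq)
    show "FCtx V X \<in> Ctx (syn_cwf u)" using VI.FCtx[OF that(1)] .
    show "FSub V X (unit_ctx C) (bang_sub C X) \<in> Sub (syn_cwf u) (FCtx V X) (unit_ctx (syn_cwf u))"
      using VI.FSub[OF that(1) unit_ctx bang_sub[OF that(1)]] VI.F_unit by simp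
    show "sub_cls u G (SBang G) CUnit \<in> Sub (syn_cwf u) (FCtx V X) (unit_ctx (syn_cwf u))"
      using that bang_cong[OF that(2)] unit_cong by (auto simp: unit_syn Sub_syn)
  qed
  have V_inst: "FSub V X (ext C X S) (inst C X S e) = sub_cls u G (sinst G A a) (CExt G A)"
    if "X \<in> Ctx C" "S \<in> Ty C X" "e \<in> Tm C X S" "ctxeq u G G" "FCtx V X = ctx_cls u G"
      "tyeq u G A A" "FTy V X S = ty_cls u G A" "tmeq u G a a A" "FTm V X S e = tm_cls u G a A"
    for X S e G A a
    using VI.F_sub_ext[of X X S "id_sub C X" e] that id_sub ty_sub_id VI.F_id
      inst_syn[OF that(4,6,8)] unfolding inst_def by simp
  have V_ty_inst: "FTy V X (ty_sub C X (ext C X S) T (inst C X S e)) = ty_cls u G (TSub B (sinst G A a))"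
    if "X \<in> Ctx C" "S \<in> Ty C X" "T \<in> Ty C (ext C X S)" "e \<in> Tm C X S" "ctxeq u G G" "FCtx V X = ctx_cls u G"
      "tyeq u G A A" "FTy V X S = ty_cls u G A" "tyeq u (CExt G A) B B"
      "FTy V (ext C X S) T = ty_cls u (CExt G A) B"
      "tmeq u G a a A" "FTm V X S e = tm_cls u G a A"
    for X S T e G A B a
    using VI.F_ty_sub[OF that(1) ext[OF that(1,2)] inst_char(1)[OF that(1,2,4)] that(3)] that
      V_inst[OF that(1,2,4-8,11,12)] ext_ex[OF that(1,2,5-8)] sinst_cong[OF that(5,7,11)]
    by (simp add: ty_sub_syn)
  show "PROP ?P1" and "PROP ?P2" and "PROP ?P3" and "PROP ?P4"
  proof (induction arbitrary: and G and G and G R rule: IC_IS_IT_IE.inducts)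
    case i_unit
    show ?case using VI.F_unit unit_cong by (simp add: unit_syn)
  next
    case (i_ext G X A S)
    then show ?case using ext_ex i_ctx i_ty by blast
  next
    case h: (i_comp X \<delta> Y d \<gamma> Z g)
    note Y = conjs[OF i_typed(2)[OF h(1,5)]] and Z = i_typed(2)[OF h(3), OF Y(1)]
    from h(2)[OF h(5-7)] obtain D where D: "ctxeq u D D" "FCtx V Y = ctx_cls u D" "subeq u G \<delta> \<delta> D"
      "FSub V X Y d = sub_cls u G \<delta> D" by blast
    from h(4)[OF _ D(1,2)] Y obtain K where T: "ctxeq u K K" "FCtx V Z = ctx_cls u K" "subeq u D \<gamma> \<gamma> K"
      "FSub V Y Z g = sub_cls u D \<gamma> K" by blast
    show ?case
      using VI.F_comp[of X Y Z d g] h(5-7) Y Z D T comp_cong[OF D(3) T(3)]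
      by (intro exI[of _ K]) (simp add: comp_syn)
  next
    case h: (i_id G' X)
    \<comment> \<open>The annotation of the identity is \<open>G'\<close>, which is only derivably
      equal to the representative \<open>G\<close> in use.\<close>
    then have e: "ctxeq u G' G" "ctxeq u G G'" using ctx_clsD ctx_sym by metis+
    have "subeq u G (SId G) (SId G') G" using id_cong[OF e(2)] .
    then have "subeq u G (SId G') (SId G') G" "sub_cls u G (SId G) G = sub_cls u G (SId G') G"
      using sub_refl1[OF sub_sym] sub_cls_eq[OF h(4,4)] by blast+
    then show ?case using VI.F_id[OF h(3)] h(4,5) by (intro exI[of _ G]) (simp add: id_syn)
  next
    case h: (i_bang G' X)
    then have e: "ctxeq u G G'" using ctx_clsD by metis
    have "subeq u G (SBang G) (SBang G') CUnit" using bang_cong[OF e] .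
    then have "subeq u G (SBang G') (SBang G') CUnit" "sub_cls u G (SBang G) CUnit = sub_cls u G (SBang G') CUnit"
      using sub_refl1[OF sub_sym] sub_cls_eq[OF h(4) unit_cong] by blast+
    then show ?case using V_bang[OF h(3-5)] VI.F_unit unit_cong by (intro exI[of _ CUnit]) (simp add: unit_syn)
  next
    case h: (i_proj X A S)
    note S = i_ty[OF h(2,1)]
    from ctx_ex[OF h(1)] obtain D where D: "ctxeq u D D" "FCtx V X = ctx_cls u D" by blast
    note A = conjs[OF h(3)[OF h(1) D]]
    note E = ext_ex[OF h(1) S D A]
    \<comment> \<open>\<open>D\<close> represents the image of \<open>X\<close>, so
      \<open>CExt D A\<close> and the given \<open>G\<close> have the same class without being the
      same expression.\<close>
    have e: "ctxeq u (CExt D A) G" using h E ctx_clsD by metis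
    note p = proj_cong[OF A(1)]
    have "FSub V (ext C X S) X (pr C X S) = sub_cls u G (SProj A) D"
      using VI.F_pr[OF h(1) S] D A sub_cls_eq[OF e D(1) p] by (simp add: pr_syn)
    then show ?case using D sub_pres[OF e D(1) p] by blast
  next
    case h: (i_sub_ext X \<gamma> Y g A S a e)
    note Y = conjs[OF i_typed(2)[OF h(1,7)]]
    note S = i_ty[OF h(3), OF Y(1)] and e = i_tm[OF h(5,7)]
    from h(2)[OF h(7-9)] obtain D where D: "ctxeq u D D" "FCtx V Y = ctx_cls u D" "subeq u G \<gamma> \<gamma> D"
      "FSub V X Y g = sub_cls u G \<gamma> D" by blast
    note A = conjs[OF h(4)[OF Y(1) D(1,2)]]
    note t = ty_sub_cong[OF A(1) D(3)]
    have ft: "FTy V X (ty_sub C X Y S g) = ty_cls u G (TSub A \<gamma>)"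
      using VI.F_ty_sub[OF h(7) _ _ S] Y h(7-9) D A by (simp add: ty_sub_syn)
    note a = conjs[OF h(6)[OF h(7-9) t ft]]
    note E = ext_ex[OF Y(1) S D(1,2) A]
    show ?case
      using VI.F_sub_ext[OF h(7) _ S _ e] Y h(7-9) D A a E sub_ext_cong[OF A(1) D(3) a(1)]
      by (intro exI[of _ "CExt D A"]) (simp add: sub_ext_syn ft)
  next
    case h: i_base
    then have e: "ctxeq u CUnit G" using VI.F_unit ctx_clsD unfolding unit_syn by metis
    show ?case using base ty_cls_eq[OF e base_cong] ty_pres[OF e base_cong] unfolding syn_base_def by simp
  next
    case h: (i_ty_sub X \<gamma> Y g A S)
    note Y = conjs[OF i_typed(2)[OF h(1,5)]]
    note S = i_ty[OF h(3), OF Y(1)]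
    from h(2)[OF h(5-7)] obtain D where D: "ctxeq u D D" "FCtx V Y = ctx_cls u D" "subeq u G \<gamma> \<gamma> D"
      "FSub V X Y g = sub_cls u G \<gamma> D" by blast
    note A = conjs[OF h(4)[OF Y(1) D(1,2)]]
    show ?case
      using VI.F_ty_sub[OF h(5) _ _ S] Y h(5-7) D A ty_sub_cong[OF A(1) D(3)] by (simp add: ty_sub_syn)
  next
    case h: (i_id_ty X A S a e b f)
    note t = i_ty[OF h(1,7)] i_tm[OF h(3,7)] i_tm[OF h(5,7)]
    note A = conjs[OF h(2)[OF h(7-9)]]
    note a = conjs[OF h(4)[OF h(7-9) A]] and b = conjs[OF h(6)[OF h(7-9) A]]
    show ?case
      using VI.F_id_ty[OF h(7) t] h(7-9) A a b idty_cong[OF A(1) a(1) b(1)]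
      by (simp add: id_ty_syn)
  next
    case h: i_n1
    then have e: "ctxeq u CUnit G" using VI.F_unit ctx_clsD unfolding unit_syn by metis
    show ?case using VN.F_n1_ty ty_cls_eq[OF e n1_cong] ty_pres[OF e n1_cong] unfolding n1_ty_syn by simp
  next
    case h: (i_sigma X A S B T)
    note S = i_ty[OF h(1,5)]
    note A = conjs[OF h(2)[OF h(5-7)]]
    note E = ext[OF h(5) S] and E' = conjs[OF ext_ex[OF h(5) S h(6,7) A]]
    note T = i_ty[OF h(3) E] and B = conjs[OF h(4)[OF E E']]
    show ?case
      using VS.F_sigma_ty[OF h(5) S T] h(5-7) A B sigma_cong[OF A(1) B(1)]
      by (simp add: sigma_ty_syn)
  next
    case h: (i_pi X A S B T)
    note S = i_ty[OF h(1,5)]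
    note A = conjs[OF h(2)[OF h(5-7)]]
    note E = ext[OF h(5) S] and E' = conjs[OF ext_ex[OF h(5) S h(6,7) A]]
    note T = i_ty[OF h(3) E] and B = conjs[OF h(4)[OF E E']]
    show ?case
      using VP.F_pi_ty[OF h(5) S T] h(5-7) A B pi_cong[OF A(1) B(1)]
      by (simp add: pi_ty_syn)
  next
    case h: (i_tm_sub X \<gamma> Y g a S e)
    note Y = conjs[OF i_typed(2)[OF h(1,5)]]
    note S = i_typed(4)[OF h(3), OF Y(1)]
    from h(2)[OF h(5-7)] obtain D where D: "ctxeq u D D" "FCtx V Y = ctx_cls u D" "subeq u G \<gamma> \<gamma> D"
      "FSub V X Y g = sub_cls u G \<gamma> D" by blast
    \<comment> \<open>\<open>ESub\<close> does not record the type of \<open>a\<close>; a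
      representative of the image of \<open>S\<close> takes its place.\<close>
    from ty_ex[OF _ _ D(1,2)] Y S obtain A where A: "tyeq u D A A" "FTy V Y S = ty_cls u D A" by blast
    note a = conjs[OF h(4)[OF Y(1) D(1,2) A]]
    note m = tm_sub_cong[OF a(1) D(3)]
    have 1: "FTy V X (ty_sub C X Y S g) = ty_cls u G (TSub A \<gamma>)"
      using VI.F_ty_sub[OF h(5)] Y S h(5-7) D A by (simp add: ty_sub_syn)
    have 2: "FTm V X (ty_sub C X Y S g) (tm_sub C X Y S e g) = tm_cls u G (ESub a \<gamma>) (TSub A \<gamma>)"
      using VI.F_tm_sub[OF h(5)] Y S h(5-7) D A a by (simp add: tm_sub_syn)
    show ?case using tm_cls_conv[OF h(6,8) _ m] 1 2 h(9) by simp
  next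
    case h: (i_var X A S)
    note S = i_ty[OF h(2,1)]
    from ctx_ex[OF h(1)] obtain D where D: "ctxeq u D D" "FCtx V X = ctx_cls u D" by blast
    note A = conjs[OF h(3)[OF h(1) D]]
    note E = ext_ex[OF h(1) S D A]
    have e: "ctxeq u (CExt D A) G" using h E ctx_clsD by metis
    note p = proj_cong[OF A(1)] and v = var_cong[OF A(1)]
    note t = ty_sub_cong[OF A(1) p]
    have 1: "FTy V (ext C X S) (ty_sub C (ext C X S) X S (pr C X S)) = ty_cls u G (TSub A (SProj A))"
      using VI.F_ty_sub[OF ext[OF h(1) S] h(1) pr[OF h(1) S] S] VI.F_pr[OF h(1) S] D A E ty_cls_eq[OF e t] p
      by (simp add: pr_syn ty_sub_syn)
    have 2: "FTm V (ext C X S) (ty_sub C (ext C X S) X S (pr C X S)) (vr C X S) = tm_cls u G (EVar A) (TSub A (SProj A))"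
      using VI.F_vr[OF h(1) S] D A tm_cls_eq[OF e t v] by (simp add: vr_syn)
    show ?case using tm_cls_conv[OF h(5,7) _ tm_pres[OF e t v]] 1 2 h(8) by simp
  next
    case h: (i_refl X a S e)
    note S = conjs[OF i_typed(4)[OF h(1,3)]]
    from ty_ex[OF h(3) S(1) h(4,5)] obtain A where A: "tyeq u G A A" "FTy V X S = ty_cls u G A" by blast
    note a = conjs[OF h(2)[OF h(3-5) A]]
    have 1: "FTy V X (id_ty C X S e e) = ty_cls u G (TId A a a)"
      using VI.F_id_ty[OF h(3)] S h(3-5) A a by (simp add: id_ty_syn)
    have 2: "FTm V X (id_ty C X S e e) (refl_tm C X S e) = tm_cls u G (ERefl a) (TId A a a)"
      using VI.F_refl_tm[OF h(3)] S h(3-5) A a by (simp add: refl_tm_syn)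
    show ?case using tm_cls_conv[OF h(4,6) _ refl_cong[OF a(1)]] 1 2 h(7) by simp
  next
    case h: i_zero
    then have e: "ctxeq u CUnit G" using VI.F_unit ctx_clsD unfolding unit_syn by metis
    show ?case
      using VN.F_n1_ty VN.F_zero_tm h(5) ty_cls_eq[OF e n1_cong] tm_cls_eq[OF e n1_cong zero_cong]
        tm_cls_conv[OF h(2,4) _ tm_pres[OF e n1_cong zero_cong]]
      unfolding n1_ty_syn zero_tm_syn by simp
  next
    case h: (i_fst X A S B T c e)
    note X = h(7-9)
    note S = i_ty[OF h(1,7)] and A = conjs[OF h(2)[OF X]]
    note E = ext[OF h(7) S] and E' = conjs[OF ext_ex[OF h(7) S h(8,9) A]]
    note T = i_ty[OF h(3) E] and B = conjs[OF h(4)[OF E E']]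
    note e = i_tm[OF h(5,7)]
    have s: "FTy V X (sigma_ty C X S T) = ty_cls u G (TSigma A B)"
      using VS.F_sigma_ty[OF h(7) S T] X A B by (simp add: sigma_ty_syn)
    note c = conjs[OF h(6)[OF X sigma_cong[OF A(1) B(1)] s]]
    note f = fst_cong[OF A(1) B(1) c(1)]
    have "FTm V X S (fst_tm C X S T e) = tm_cls u G (EFst A c) A"
      using VS.F_fst_tm[OF h(7) S T e] X A B c by (simp add: fst_tm_syn)
    then show ?case using tm_cls_conv[OF h(8,10) _ f] A h(11) by simp
  next
    case h: (i_snd X A S B T c e)
    note X = h(7-9)
    note S = i_ty[OF h(1,7)] and A = conjs[OF h(2)[OF X]]
    note E = ext[OF h(7) S] and E' = conjs[OF ext_ex[OF h(7) S h(8,9) A]]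
    note T = i_ty[OF h(3) E] and B = conjs[OF h(4)[OF E E']]
    note e = i_tm[OF h(5,7)]
    have s: "FTy V X (sigma_ty C X S T) = ty_cls u G (TSigma A B)"
      using VS.F_sigma_ty[OF h(7) S T] X A B by (simp add: sigma_ty_syn)
    note c = conjs[OF h(6)[OF X sigma_cong[OF A(1) B(1)] s]]
    note f = fst_cong[OF A(1) B(1) c(1)]
    have 0: "FTm V X S (fst_tm C X S T e) = tm_cls u G (EFst A c) A"
      using VS.F_fst_tm[OF h(7) S T e] X A B c by (simp add: fst_tm_syn)
    have 1: "FTy V X (ty_sub C X (ext C X S) T (inst C X S (fst_tm C X S T e))) = ty_cls u G (TSub B (sinst G A (EFst A c)))"
      using V_ty_inst[OF h(7) S T fst_tm[OF h(7) S T e] X(2,3) _ _ _ _ f 0] A B by blast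
    have 2: "FTm V X (ty_sub C X (ext C X S) T (inst C X S (fst_tm C X S T e))) (snd_tm C X S T e)
        = tm_cls u G (ESnd A B c) (TSub B (sinst G A (EFst A c)))"
      using VS.F_snd_tm[OF h(7) S T e] X A B c by (simp add: snd_tm_syn)
    show ?case
      using tm_cls_conv[OF h(8,10) _ snd_cong[OF A(1) B(1) c(1)]] 1 2 h(11)
      by simp
  next
    case h: (i_pair X A S B T a e b f)
    note X = h(9-11)
    note S = i_ty[OF h(1,9)] and A = conjs[OF h(2)[OF X]]
    note E = ext[OF h(9) S] and E' = conjs[OF ext_ex[OF h(9) S h(10,11) A]]
    note T = i_ty[OF h(3) E] and B = conjs[OF h(4)[OF E E']]
    note e = i_tm[OF h(5,9)] and f = i_tm[OF h(7,9)]
    note a = conjs[OF h(6)[OF X A]]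
    have s: "FTy V X (sigma_ty C X S T) = ty_cls u G (TSigma A B)"
      using VS.F_sigma_ty[OF h(9) S T] X A B by (simp add: sigma_ty_syn)
    have 0: "FTy V X (ty_sub C X (ext C X S) T (inst C X S e)) = ty_cls u G (TSub B (sinst G A a))"
      using V_ty_inst[OF h(9) S T e X(2,3)] A B a by blast
    note t = ty_sub_cong[OF B(1) sinst_cong[OF h(10) A(1) a(1)]]
    note b = conjs[OF h(8)[OF X t 0]]
    have 2: "FTm V X (sigma_ty C X S T) (pair_tm C X S T e f) = tm_cls u G (EPair A B a b) (TSigma A B)"
      using VS.F_pair_tm[OF h(9) S T e f] X A B a b by (simp add: pair_tm_syn)
    show ?case
      using tm_cls_conv[OF h(10,12) _ pair_cong[OF A(1) B(1) a(1) b(1)]] s 2 h(13)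
      by simp
  next
    case h: (i_app X A S B T c f a e)
    note X = h(9-11)
    note S = i_ty[OF h(1,9)] and A = conjs[OF h(2)[OF X]]
    note E = ext[OF h(9) S] and E' = conjs[OF ext_ex[OF h(9) S h(10,11) A]]
    note T = i_ty[OF h(3) E] and B = conjs[OF h(4)[OF E E']]
    note f = i_tm[OF h(5,9)] and e = i_tm[OF h(7,9)]
    note a = conjs[OF h(8)[OF X A]]
    have s: "FTy V X (pi_ty C X S T) = ty_cls u G (TPi A B)"
      using VP.F_pi_ty[OF h(9) S T] X A B by (simp add: pi_ty_syn)
    note c = conjs[OF h(6)[OF X pi_cong[OF A(1) B(1)] s]]
    have 1: "FTy V X (ty_sub C X (ext C X S) T (inst C X S e)) = ty_cls u G (TSub B (sinst G A a))"
      using V_ty_inst[OF h(9) S T e X(2,3)] A B a by blast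
    have 2: "FTm V X (ty_sub C X (ext C X S) T (inst C X S e)) (app_tm C X S T f e) = tm_cls u G (EApp A B c a)
      (TSub B (sinst G A a))"
      using VP.F_app_tm[OF h(9) S T f e] X A B a c by (simp add: app_tm_syn)
    show ?case
      using tm_cls_conv[OF h(10,12) _ app_cong[OF A(1) B(1) c(1) a(1)]] 1 2 h(13)
      by simp
  next
    case h: (i_lam X A S b T f)
    note X = h(5-7)
    note S = i_ty[OF h(1,5)] and A = conjs[OF h(2)[OF X]]
    note E = ext[OF h(5) S] and E' = conjs[OF ext_ex[OF h(5) S h(6,7) A]]
    note T = conjs[OF i_typed(4)[OF h(3) E]]
    \<comment> \<open>\<open>ELam\<close> records no codomain, so one is taken from the image of
      \<open>T\<close>.\<close>
    from ty_ex[OF E T(1) E'] obtain B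
      where B: "tyeq u (CExt G A) B B" "FTy V (ext C X S) T = ty_cls u (CExt G A) B" by blast
    note b = conjs[OF h(4)[OF E E' B]]
    have s: "FTy V X (pi_ty C X S T) = ty_cls u G (TPi A B)"
      using VP.F_pi_ty[OF h(5) S] T X A B by (simp add: pi_ty_syn)
    have 2: "FTm V X (pi_ty C X S T) (lam_tm C X S T f) = tm_cls u G (ELam A b) (TPi A B)"
      using VP.F_lam_tm[OF h(5) S] T X A B b by (simp add: lam_tm_syn)
    show ?case
      using tm_cls_conv[OF h(6,8) _ lam_cong[OF A(1) B(1) b(1)]] s 2 h(9)
      by simp
  qed
qed

end

section \<open>Existence and uniqueness of the morphism\<close>

lemma model_democratic:
  assumes "democratic_cwf C bar dem" "supports_I C" "supports_Sigma C" "supports_Pi C"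
    "o\<^sub>C \<in> Ty C (unit_ctx C)"
  shows "model C o\<^sub>C u"
proof -
  interpret democratic_cwf C bar dem by fact
  show ?thesis
    using n1_everywhere assms supports_N1
    by (intro model.intro type_theory_cwf.intro model_axioms.intro)
qed

lemma type_theory_syn: "type_theory_cwf (syn_cwf u)"
  by (intro type_theory_cwf.intro supports_I_syn supports_N1_syn supports_Sigma_syn supports_Pi_syn)

lemma syn_base_in: "syn_base u \<in> Ty (syn_cwf u) (unit_ctx (syn_cwf u))"
  unfolding syn_base_def unit_syn using Ty_syn[OF unit_cong] base_cong by blast

lemma model_syn: "model (syn_cwf u) (syn_base u) u"
proof (intro model.intro type_theory_syn model_axioms.intro syn_base_in)
  let ?K = "syn_cwf u"
  fix X s e
  assume u: "u = Everywhere" and X: "X \<in> Ctx ?K" and s: "s \<in> Sub ?K X (unit_ctx ?K)"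
    and e: "e \<in> Tm ?K X (ty_sub ?K X (unit_ctx ?K) (n1_ty ?K) s)"
  obtain G where G: "X = ctx_cls u G" "ctxeq u G G" using X by (auto simp: Ctx_syn)
  note b = bang_cong[OF G(2)]
  note t = ty_sub_cong[OF n1_cong b]
  \<comment> \<open>The rule \<open>n1_unique_everywhere\<close> speaks of \<open>SBang G\<close>;
    every substitution into the empty context is equal to it.\<close>
  have "sub_cls u G (SBang G) CUnit \<in> Sub ?K X (unit_ctx ?K)"
    using G b unit_cong by (auto simp: unit_syn Sub_syn)
  then have s': "s = sub_cls u G (SBang G) CUnit"
    using cwf.to_unit_eq[OF cwf_syn X s] by blast
  obtain a where a: "e = tm_cls u G a (TSub TN1 (SBang G))" "tmeq u G a a (TSub TN1 (SBang G))"
    using e G b t n1_cong unfolding s' by (auto simp: unit_syn n1_ty_syn ty_sub_syn Tm_syn)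
  show "e = tm_sub ?K X (unit_ctx ?K) (n1_ty ?K) (zero_tm ?K) s"
    unfolding s' using a G b n1_cong zero_cong tm_cls_eq[OF G(2) t n1_unique_everywhere[OF u a(2)]]
    by (simp add: unit_syn n1_ty_syn zero_tm_syn tm_sub_syn)
qed

lemma syn_initial_exists:
  assumes "model C o\<^sub>C u"
  shows "\<exists>F. strict_cwf_morphism (syn_cwf u) C F \<and>
    preserves_I (syn_cwf u) C F \<and> preserves_N1 (syn_cwf u) C F \<and>
    preserves_Sigma (syn_cwf u) C F \<and> preserves_Pi (syn_cwf u) C F \<and>
    FTy F (unit_ctx (syn_cwf u)) (syn_base u) = o\<^sub>C"
proof -
  let ?K = "syn_cwf u"
  interpret model C o\<^sub>C u by fact
  interpret E: injective_model "tele_cwf C" "Leaf o\<^sub>C" u by (rule model_tele)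
  let ?F = "cwf_map_comp ?K (tele_map C) E.interp_map"
  have p: "preserves_I ?K C ?F" "preserves_N1 ?K C ?F"
    "preserves_Sigma ?K C ?F" "preserves_Pi ?K C ?F"
    using preserves_I_comp[OF supports_I_syn E.preserves_I_interp preserves_tele_map(1)]
      preserves_N1_comp[OF supports_N1_syn E.preserves_N1_interp preserves_tele_map(2)]
      preserves_Sigma_comp[OF supports_Sigma_syn E.preserves_Sigma_interp preserves_tele_map(3)]
      preserves_Pi_comp[OF supports_Pi_syn E.preserves_Pi_interp preserves_tele_map(4)] .
  have "FTy ?F (unit_ctx ?K) (syn_base u) = FTy (tele_map C) (unit_ctx (tele_cwf C)) (Leaf o\<^sub>C)"
    using E.interp_base strict_cwf_morphism.F_unit[OF E.strict_interp] syn_base_in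
      cwf.unit_ctx[OF cwf_syn] by (simp add: cwf_map_comp_def)
  also have "\<dots> = o\<^sub>C"
    using base_in by (simp add: tele_map_def tele_simps)
  finally show ?thesis using p preserves_I.axioms(1)[OF p(1)] by blast
qed

text \<open>\<open>agree\<close> needs an injective domain, so \<open>F\<close> and \<open>G\<close>
  are compared after precomposition with the evaluation of telescopes. By \<open>readback\<close>
  every class is the image of the value of a representative, which transfers the agreement to
  \<open>F\<close> and \<open>G\<close>.\<close>

lemma syn_initial_unique:
  fixes C :: "('c, 's, 't, 'e) tcwf"
  assumes F: "preserves_I (syn_cwf u) C F" "preserves_N1 (syn_cwf u) C F"
      "preserves_Sigma (syn_cwf u) C F" "preserves_Pi (syn_cwf u) C F"
    and G: "preserves_I (syn_cwf u) C G" "preserves_N1 (syn_cwf u) C G"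
      "preserves_Sigma (syn_cwf u) C G" "preserves_Pi (syn_cwf u) C G"
    and base: "FTy F (unit_ctx (syn_cwf u)) (syn_base u) = FTy G (unit_ctx (syn_cwf u)) (syn_base u)"
  shows "F = G"
proof -
  let ?K = "syn_cwf u"
  interpret S: model "syn_cwf u" "syn_base u" u by (rule model_syn)
  interpret E: injective_model "tele_cwf ?K" "Leaf (syn_base u)" u by (rule S.model_tele)
  interpret F: preserves_I "syn_cwf u" C F by fact
  interpret G: preserves_I "syn_cwf u" C G by fact
  let ?E = "tele_cwf ?K" and ?V = "tele_map ?K"
  let ?F = "cwf_map_comp ?E F ?V" and ?G = "cwf_map_comp ?E G ?V"
  note V = S.preserves_tele_map
  note sup = E.supports_I_axioms E.supports_N1_axioms E.supports_Sigma_axioms E.supports_Pi_axioms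
  have F': "preserves_I ?E C ?F" "preserves_N1 ?E C ?F" "preserves_Sigma ?E C ?F" "preserves_Pi ?E C ?F"
    using preserves_I_comp[OF sup(1) V(1) F(1)] preserves_N1_comp[OF sup(2) V(2) F(2)]
      preserves_Sigma_comp[OF sup(3) V(3) F(3)] preserves_Pi_comp[OF sup(4) V(4) F(4)] .
  have G': "preserves_I ?E C ?G" "preserves_N1 ?E C ?G" "preserves_Sigma ?E C ?G" "preserves_Pi ?E C ?G"
    using preserves_I_comp[OF sup(1) V(1) G(1)] preserves_N1_comp[OF sup(2) V(2) G(2)]
      preserves_Sigma_comp[OF sup(3) V(3) G(3)] preserves_Pi_comp[OF sup(4) V(4) G(4)] .
  interpret F': preserves_I ?E C ?F by (rule F')
  interpret G': preserves_I ?E C ?G by (rule G')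
  have Vb: "FTy ?V (unit_ctx ?E) (Leaf (syn_base u)) = syn_base u"
    using S.base_in by (simp add: tele_map_def tele_simps)
  have Vu: "FCtx ?V (unit_ctx ?E) = unit_ctx ?K"
    by (simp add: tele_map_def tele_simps)
  have base': "FTy ?F (unit_ctx ?E) (Leaf (syn_base u)) = FTy ?G (unit_ctx ?E) (Leaf (syn_base u))"
    using base Vb Vu E.base_in E.unit_ctx by (simp add: cwf_map_comp_def)
  note agree = E.agree[OF F' G' base'] and rb = E.readback[OF V Vb]
  note agC = agree_FCtx[OF F'.strict_cwf_morphism_axioms G'.strict_cwf_morphism_axioms]
  have C: "FCtx F X = FCtx G X" for X
  proof (cases "X \<in> Ctx ?K")
    case True
    then obtain D where D: "X = ctx_cls u D" "ctxeq u D D" by (auto simp: Ctx_syn)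
    obtain Y where Y: "E.IC D Y" using E.sound(1)[OF D(2)] by blast
    note Y' = E.i_ctx[OF Y]
    have "FCtx ?F Y = FCtx ?G Y" by (rule agC[OF agree(1)[OF Y]])
    then show ?thesis using Y' rb(1)[OF Y] D by (simp add: cwf_map_comp_def)
  qed (simp add: F.FCtx_undefined G.FCtx_undefined)
  have T: "FTy F X A = FTy G X A" for X A
  proof (cases "X \<in> Ctx ?K \<and> A \<in> Ty ?K X")
    case True
    then obtain D where D: "X = ctx_cls u D" "ctxeq u D D" by (auto simp: Ctx_syn)
    with True obtain B where B: "A = ty_cls u D B" "tyeq u D B B" by (auto simp: Ty_syn)
    obtain Y R where Y: "E.IC D Y" "E.IT Y B R" using E.sound(3)[OF B(2)] by blast
    note Y' = E.i_ctx[OF Y(1)]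
    note R' = E.i_ty[OF Y(2) Y'] and r = rb(1)[OF Y(1)]
    have "FTy ?F Y R = FTy ?G Y R" by (rule agree(3)[OF Y(2) Y' agree(1)[OF Y(1)]])
    then show ?thesis using Y' R' r rb(3)[OF Y(2) Y' D(2)] D B by (simp add: cwf_map_comp_def)
  next
    case False
    show ?thesis unfolding F.FTy_undefined[OF False] G.FTy_undefined[OF False] ..
  qed
  have M: "FTm F X A a = FTm G X A a" for X A a
  proof (cases "X \<in> Ctx ?K \<and> A \<in> Ty ?K X \<and> a \<in> Tm ?K X A")
    case True
    then obtain D where D: "X = ctx_cls u D" "ctxeq u D D" by (auto simp: Ctx_syn)
    with True obtain B where B: "A = ty_cls u D B" "tyeq u D B B" by (auto simp: Ty_syn)
    with True D obtain b where b: "a = tm_cls u D b B" "tmeq u D b b B" by (auto simp: Tm_syn)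
    obtain Y R e where Y: "E.IC D Y" "E.IT Y B R" "E.IE Y b R e" using E.sound(4)[OF b(2)] by blast
    note Y' = E.i_ctx[OF Y(1)]
    note R' = E.i_ty[OF Y(2) Y'] and e' = E.i_tm[OF Y(3) Y'] and r = rb(1)[OF Y(1)]
    note rt = rb(3)[OF Y(2) Y' D(2)]
    have "FTm ?F Y R e = FTm ?G Y R e" using agree(4)[OF Y(3) Y' agree(1)[OF Y(1)]] by blast
    then show ?thesis
      using Y' R' e' r rt rb(4)[OF Y(3) Y' D(2) _ B(2)] D B b by (simp add: cwf_map_comp_def)
  next
    case False
    show ?thesis unfolding F.FTm_undefined[OF False] G.FTm_undefined[OF False] ..
  qed
  have S: "FSub F X Z g = FSub G X Z g" for X Z g
  proof (cases "X \<in> Ctx ?K \<and> Z \<in> Ctx ?K \<and> g \<in> Sub ?K X Z")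
    case True
    then obtain D K where D: "X = ctx_cls u D" "ctxeq u D D" "Z = ctx_cls u K" "ctxeq u K K"
      by (auto simp: Ctx_syn)
    with True obtain d where d: "g = sub_cls u D d K" "subeq u D d d K" by (auto simp: Sub_syn)
    obtain Y W s where Y: "E.IC D Y" "E.IC K W" "E.IS Y d W s" using E.sound(2)[OF d(2)] by blast
    note Y' = E.i_ctx[OF Y(1)] and W' = E.i_ctx[OF Y(2)]
    note s' = E.i_sub[OF Y(3) Y'] and r = rb(1)[OF Y(1)] and r' = rb(1)[OF Y(2)]
    obtain L where L: "ctxeq u L L" "FCtx ?V W = ctx_cls u L" "FSub ?V Y W s = sub_cls u D d L"
      "subeq u D d d L"
      using rb(2)[OF Y(3) Y' D(2)] r by blast
    \<comment> \<open>Reading back yields some codomain \<open>L\<close>; both \<open>L\<close> and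
      \<open>K\<close> represent the image of \<open>W\<close>.\<close>
    have "ctxeq u L K" using L r' ctx_clsD[of u L K] D(4) by simp
    then have "FSub ?V Y W s = g" using L(3) sub_cls_eq[OF D(2) _ L(4)] d(1) by simp
    moreover have "FSub ?F Y W s = FSub ?G Y W s" using agree(2)[OF Y(3) Y' agree(1)[OF Y(1)]] by blast
    ultimately show ?thesis using Y' W' s' r r' D by (simp add: cwf_map_comp_def)
  next
    case False
    show ?thesis unfolding F.FSub_undefined[OF False] G.FSub_undefined[OF False] ..
  qed
  \<comment> \<open>Off the carriers both maps are \<open>undefined\<close>, so the four families
    agree as total functions.\<close>
  show ?thesis using C T M S by (intro cwf_map.equality) (simp_all add: fun_eq_iff)
qed

section \<open>Democracy\<close>

context supports_Sigma
begin

text \<open>In terms of elements \<open>h'\<close> sends z to (h(fst z), snd z) and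
  \<open>g'\<close> sends (y, a) to (g(y), a); the inverse laws are checked on components. The
  definitions follow \<open>rdem_inv\<close> and \<open>rdem\<close> constructor by constructor, and
  the type equations among the conclusions are the conversions that the syntactic counterpart
  needs.\<close>

lemma iso_sigma:
  fixes h g A b G
  defines "U \<equiv> unit_ctx C"
  defines "X \<equiv> ext C U b"
  defines "B \<equiv> ty_sub C X G A h"
  defines "S \<equiv> sigma_ty C U b B"
  defines "Y \<equiv> ext C U S"
  defines "p \<equiv> pr C U S"
  defines "b' \<equiv> ty_sub C Y U b p"
  defines "B' \<equiv> ty_sub C (ext C Y b') X B (lift C Y U b p)"
  defines "f \<equiv> fst_tm C Y b' B' (vr C U S)"
  defines "k \<equiv> sub_ext C Y U b p f"
  defines "hk \<equiv> comp_sub C Y X G h k"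
  defines "s \<equiv> snd_tm C Y b' B' (vr C U S)"
  defines "h' \<equiv> sub_ext C Y G A hk s"
  defines "Z \<equiv> ext C G A"
  defines "e \<equiv> bang_sub C Z"
  defines "be \<equiv> ty_sub C Z U b e"
  defines "Be \<equiv> ty_sub C (ext C Z be) X B (lift C Z U b e)"
  defines "gp \<equiv> comp_sub C Z G X g (pr C G A)"
  defines "x \<equiv> tm_sub C Z X (ty_sub C X U b (pr C U b)) (vr C U b) gp"
  defines "w \<equiv> pair_tm C Z be Be x (vr C G A)"
  defines "g' \<equiv> sub_ext C Z U S e w"
  assumes G: "G \<in> Ctx C" and A: "A \<in> Ty C G" and b: "b \<in> Ty C U"
    and g: "g \<in> Sub C G X" and h: "h \<in> Sub C X G"
    and gh: "comp_sub C X G X g h = id_sub C X" and hg: "comp_sub C G X G h g = id_sub C G"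
  shows "f \<in> Tm C Y b'" "k \<in> Sub C Y X" "s \<in> Tm C Y (ty_sub C Y G A hk)" "h' \<in> Sub C Y Z"
    "ty_sub C Y (ext C Y b') B' (inst C Y b' f) = ty_sub C Y G A hk"
    "x \<in> Tm C Z be" "vr C G A \<in> Tm C Z (ty_sub C Z (ext C Z be) Be (inst C Z be x))"
    "ty_sub C Z (ext C Z be) Be (inst C Z be x) = ty_sub C Z G A (pr C G A)"
    "ty_sub C Z X (ty_sub C X U b (pr C U b)) gp = be"
    "w \<in> Tm C Z (ty_sub C Z U S e)" "ty_sub C Z U S e = sigma_ty C Z be Be" "g' \<in> Sub C Z Y"
    "comp_sub C Z Y Z h' g' = id_sub C Z" "comp_sub C Y Z Y g' h' = id_sub C Y"
proof -
  note U = unit_ctx[folded U_def]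
  note X = ext[OF U b, folded X_def]
  note B = ty_sub[OF X G h A, folded B_def]
  note S = sigma_ty[OF U b B[unfolded X_def], folded S_def X_def]
  note Y = ext[OF U S, folded Y_def]
  note p = pr[OF U S, folded Y_def p_def]
  note lp = lift_char[OF Y U b p, folded b'_def X_def]
  note B' = ty_sub[OF lp(2) X lp(5) B, folded B'_def]
  have Sp: "ty_sub C Y U S p = sigma_ty C Y b' B'"
    using sigma_ty_sub[OF Y U p b B[unfolded X_def]] unfolding S_def b'_def B'_def X_def .
  have q: "vr C U S \<in> Tm C Y (sigma_ty C Y b' B')"
    using vr[OF U S, folded Y_def p_def] unfolding Sp .
  note f = fst_tm[OF Y lp(1) B' q, folded f_def]
  show "f \<in> Tm C Y b'" by (rule f)
  note kc = sub_ext_char[OF Y U b p f[unfolded b'_def], folded X_def k_def]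
  show k: "k \<in> Sub C Y X" by (rule kc(1))
  note hk = comp_sub[OF Y X G k h, folded hk_def]
  note i = inst_char(1)[OF Y lp(1) f]
  \<comment> \<open>The family \<open>B'\<close> instantiated at the first projection is therefore
    \<open>B[k]\<close>, that is A at \<open>h\<close> after \<open>k\<close>; this types the second
    projection.\<close>
  have lpi: "comp_sub C Y (ext C Y b') X (lift C Y U b p) (inst C Y b' f) = k"
    using comp_lift_sub_ext[OF Y Y U b p id_sub[OF Y], of f] f ty_sub_id[OF Y lp(1)] comp_id_right[OF Y U p]
    unfolding inst_def k_def b'_def X_def by simp
  show Bi: "ty_sub C Y (ext C Y b') B' (inst C Y b' f) = ty_sub C Y G A hk"
    using ty_sub_comp[OF Y lp(2) X i lp(5) B] lpi ty_sub_comp[OF Y X G k h A]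
    unfolding B'_def B_def hk_def by simp
  show s: "s \<in> Tm C Y (ty_sub C Y G A hk)"
    using snd_tm[OF Y lp(1) B' q] Bi unfolding s_def f_def by simp
  note hc = sub_ext_char[OF Y G A hk s, folded Z_def h'_def]
  show h': "h' \<in> Sub C Y Z" by (rule hc(1))
  note Z = ext[OF G A, folded Z_def]
  note pA = pr[OF G A, folded Z_def] and qA = vr[OF G A, folded Z_def]
  note e = bang_sub[OF Z, folded U_def e_def]
  note le = lift_char[OF Z U b e, folded be_def X_def]
  note Be = ty_sub[OF le(2) X le(5) B, folded Be_def]
  note gp = comp_sub[OF Z G X pA g, folded gp_def]
  note pb = pr[OF U b, folded X_def]
  have pgp: "comp_sub C Z X U (pr C U b) gp = e"
    using to_unit_eq[OF Z, folded U_def, OF comp_sub[OF Z X U gp pb] e] .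
  note Tb = ty_sub[OF X U pb b] and qb = vr[OF U b, folded X_def]
  show xt: "ty_sub C Z X (ty_sub C X U b (pr C U b)) gp = be"
    using ty_sub_comp[OF Z X U gp pb b] pgp unfolding be_def by simp
  show x: "x \<in> Tm C Z be"
    using tm_sub[OF Z X gp Tb qb] unfolding x_def xt .
  note ix = inst_char(1)[OF Z le(1) x]
  have gp_ext: "gp = sub_ext C Z U b e x"
    using sub_ext_eqI[OF Z U b gp[unfolded X_def]] pgp unfolding x_def X_def by simp
  have lei: "comp_sub C Z (ext C Z be) X (lift C Z U b e) (inst C Z be x) = gp"
    using comp_lift_sub_ext[OF Z Z U b e id_sub[OF Z], of x] x ty_sub_id[OF Z le(1)] comp_id_right[OF Z U e]
    unfolding inst_def gp_ext be_def X_def by simp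
  \<comment> \<open>Here \<open>h\<close> after \<open>g\<close> being the identity is used: it lets
    the variable of type A serve as the second component of the pair \<open>w\<close>.\<close>
  have hgp: "comp_sub C Z X G h gp = pr C G A"
    using comp_assoc[OF Z G X G pA g h] hg comp_id_left[OF Z G pA] unfolding gp_def by simp
  show Bx: "ty_sub C Z (ext C Z be) Be (inst C Z be x) = ty_sub C Z G A (pr C G A)"
    using ty_sub_comp[OF Z le(2) X ix le(5) B] lei ty_sub_comp[OF Z X G gp h A] hgp
    unfolding Be_def B_def by simp
  show y: "vr C G A \<in> Tm C Z (ty_sub C Z (ext C Z be) Be (inst C Z be x))"
    unfolding Bx by (rule qA)
  note w = pair_tm[OF Z le(1) Be x y, folded w_def]
  show Se: "ty_sub C Z U S e = sigma_ty C Z be Be"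
    using sigma_ty_sub[OF Z U e b B[unfolded X_def]] unfolding S_def be_def Be_def X_def .
  show w': "w \<in> Tm C Z (ty_sub C Z U S e)" unfolding Se by (rule w)
  note gc = sub_ext_char[OF Z U S e w', folded Y_def g'_def p_def]
  show g': "g' \<in> Sub C Z Y" by (rule gc(1))
  note Sp_in = ty_sub[OF Y U p S, unfolded Sp]
  have qg: "tm_sub C Z Y (sigma_ty C Y b' B') (vr C U S) g' = w"
    using gc(3) unfolding Sp .
  have bg: "ty_sub C Z Y b' g' = be"
    using ty_sub_comp[OF Z Y U g' p b] gc(2) unfolding b'_def be_def by simp
  have lg: "comp_sub C (ext C Z be) (ext C Y b') X (lift C Y U b p) (lift C Z Y b' g') = lift C Z U b e"
    using lift_comp[OF Z Y U b p g'] gc(2) bg unfolding b'_def be_def X_def by simp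
  note lgc = lift_char[OF Z Y lp(1) g', unfolded bg]
  have Bg: "ty_sub C (ext C Z be) (ext C Y b') B' (lift C Z Y b' g') = Be"
    using ty_sub_comp[OF le(2) lp(2) X lgc(5) lp(5) B] lg unfolding B'_def Be_def by simp
  have fg: "tm_sub C Z Y b' f g' = x"
    using fst_tm_sub[OF Z Y g' lp(1) B' q] fst_pair[OF Z le(1) Be x y]
    unfolding bg Bg qg f_def w_def by simp
  have sg: "tm_sub C Z Y (ty_sub C Y G A hk) s g' = vr C G A"
    using snd_tm_sub[OF Z Y g' lp(1) B' q] snd_pair[OF Z le(1) Be x y]
    unfolding bg Bg qg f_def[symmetric] Bi s_def[symmetric] w_def by simp
  have kg: "comp_sub C Z Y X k g' = gp"
    using sub_ext_comp[OF Z Y U b p f[unfolded b'_def] g'] gc(2) fg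
    unfolding k_def X_def[symmetric] gp_ext b'_def[symmetric] by simp
  have hkg: "comp_sub C Z Y G hk g' = pr C G A"
    using comp_assoc[OF Z Y X G g' k h] kg hgp unfolding hk_def by simp
  show "comp_sub C Z Y Z h' g' = id_sub C Z"
    using sub_ext_comp[OF Z Y G A hk s g'] hkg sg sub_ext_eta[OF Z G A, folded Z_def, OF id_sub[OF Z]]
      comp_id_right[OF Z G pA] tm_sub_id[OF Z ty_sub[OF Z G pA A] qA]
    unfolding h'_def Z_def[symmetric] by simp
  have ph: "comp_sub C Y Z G (pr C G A) h' = hk" by (rule hc(2))
  \<comment> \<open>Here \<open>g\<close> after \<open>h\<close> being the identity is used, for the
    other composite.\<close>
  have gph: "comp_sub C Y Z X gp h' = k"
    using comp_assoc[OF Y Z G X h' pA g] ph comp_assoc[OF Y X G X k h g] gh comp_id_left[OF Y X k]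
    unfolding gp_def hk_def by simp
  have eh: "comp_sub C Y Z U e h' = p"
    using to_unit_eq[OF Y, folded U_def, OF comp_sub[OF Y Z U h' e] p] .
  have xh: "tm_sub C Y Z be x h' = f"
    using tm_sub_comp[OF Y Z X h' gp Tb qb] gph kc(3) unfolding x_def xt by simp
  have beh: "ty_sub C Y Z be h' = b'"
    using ty_sub_comp[OF Y Z U h' e b] eh unfolding be_def b'_def by simp
  have lh: "comp_sub C (ext C Y b') (ext C Z be) X (lift C Z U b e) (lift C Y Z be h') = lift C Y U b p"
    using lift_comp[OF Y Z U b e h'] eh beh unfolding b'_def be_def X_def by simp
  note lhc = lift_char[OF Y Z le(1) h', unfolded beh]
  have Bh: "ty_sub C (ext C Y b') (ext C Z be) Be (lift C Y Z be h') = B'"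
    using ty_sub_comp[OF lp(2) le(2) X lhc(5) le(5) B] lh unfolding B'_def Be_def by simp
  have wh: "tm_sub C Y Z (ty_sub C Z U S e) w h' = vr C U S"
    using pair_tm_sub[OF Y Z h' le(1) Be x y] hc(3) pair_fst_snd[OF Y lp(1) B' q]
    unfolding beh Bh xh Bx f_def[symmetric] s_def[symmetric] Se w_def by simp
  show "comp_sub C Y Z Y g' h' = id_sub C Y"
    using sub_ext_comp[OF Y Z U S e w' h'] eh wh sub_ext_eta[OF Y U S, folded Y_def p_def, OF id_sub[OF Y]]
      comp_id_right[OF Y U p] tm_sub_id[OF Y Sp_in q] Sp
    unfolding g'_def Y_def[symmetric] by simp
qed

end

text \<open>Both components of a map into 1.N1 are forced: the first by terminality, the second by
  uniqueness of N1-terms over \<open>X\<close>.\<close>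

lemma (in model) to_n1_eq:
  assumes "u = Everywhere" "X \<in> Ctx C" "s \<in> Sub C X (ext C (unit_ctx C) (n1_ty C))"
    "t \<in> Sub C X (ext C (unit_ctx C) (n1_ty C))"
  shows "s = t"
proof -
  note E = ext[OF unit_ctx n1_ty] and p = pr[OF unit_ctx n1_ty] and q = vr[OF unit_ctx n1_ty]
  have "r = sub_ext C X (unit_ctx C) (n1_ty C) (bang_sub C X)
      (tm_sub C X (unit_ctx C) (n1_ty C) (zero_tm C) (bang_sub C X))"
    if r: "r \<in> Sub C X (ext C (unit_ctx C) (n1_ty C))" for r
  proof (rule sub_ext_eqI[OF assms(2) unit_ctx n1_ty r])
    show b: "comp_sub C X (ext C (unit_ctx C) (n1_ty C)) (unit_ctx C) (pr C (unit_ctx C) (n1_ty C)) r = bang_sub C X"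
      by (rule to_unit_eq[OF assms(2) comp_sub[OF assms(2) E unit_ctx r p] bang_sub[OF assms(2)]])
    show "tm_sub C X (ext C (unit_ctx C) (n1_ty C)) (ty_sub C (ext C (unit_ctx C) (n1_ty C)) (unit_ctx C)
      (n1_ty C) (pr C (unit_ctx C) (n1_ty C)))
        (vr C (unit_ctx C) (n1_ty C)) r = tm_sub C X (unit_ctx C) (n1_ty C) (zero_tm C) (bang_sub C X)"
      using n1_everywhere[OF assms(1,2) bang_sub[OF assms(2)]] tm_sub[OF assms(2) E r ty_sub[OF E unit_ctx p n1_ty] q]
        ty_sub_comp[OF assms(2) E unit_ctx r p n1_ty] b by simp
  qed
  then show ?thesis using assms(3,4) by metis
qed

lemma bang_syn: "ctxeq u G G \<Longrightarrow> bang_sub (syn_cwf u) (ctx_cls u G) = sub_cls u G (SBang G) CUnit"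
  by (rule cwf.to_unit_eq[OF cwf_syn _ cwf.bang_sub[OF cwf_syn]])
    (auto simp: unit_syn mem_syn unit_cong intro: bang_cong)

text \<open>Contexts have no conversion rules, so inversion is a plain induction. It is needed
  because \<open>rdem\<close> recurses on raw contexts and because the chosen representative of the
  empty context must be \<open>CUnit\<close> itself. The other judgments only accompany the
  simultaneous induction.\<close>

lemma ctxeq_inv:
  "ctxeq u G G' \<Longrightarrow> (G = CUnit \<and> G' = CUnit) \<or>
    (\<exists>D A D' A'. G = CExt D A \<and> G' = CExt D' A' \<and> ctxeq u D D' \<and> tyeq u D A A')"
  "subeq u D \<gamma> \<gamma>' G \<Longrightarrow> True"
  "tyeq u G A A' \<Longrightarrow> True"
  "tmeq u G a a' A \<Longrightarrow> True"
proof (induction rule: ctxeq_subeq_tyeq_tmeq.inducts)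
  case (ctx_sym G G')
  then show ?case
    using ctxeq_subeq_tyeq_tmeq.ctx_sym ctxeq_subeq_tyeq_tmeq.ty_sym ctxeq_subeq_tyeq_tmeq.ty_pres by blast
next
  case h: (ctx_trans G G' G'')
  show ?case
  proof (cases "G' = CUnit")
    case False
    with h(2,4) obtain D A D' A' D'' A'' where e: "G = CExt D A" "G' = CExt D' A'" "ctxeq u D D'" "tyeq u D A A'"
      "G'' = CExt D'' A''" "ctxeq u D' D''" "tyeq u D' A' A''" by auto
    show ?thesis
      using e ctx_trans[OF e(3,6)] ty_trans[OF e(4) ty_pres[OF ctx_sym[OF e(3)] e(7)]] by blast
  qed (use h in auto)
qed auto

text \<open>Democracy at one context, as derivable judgments on raw expressions. The type and both
  maps are parameters, so that a step of the recursion can be stated without unfolding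
  \<open>rbar\<close>, \<open>rdem\<close> and \<open>rdem_inv\<close>.\<close>

definition ctx_coded :: "n1_uniqueness \<Rightarrow> rctx \<Rightarrow> rty \<Rightarrow> rsub \<Rightarrow>
  rsub \<Rightarrow> bool" where
  "ctx_coded u G b g h \<longleftrightarrow> tyeq u CUnit b b \<and> subeq u G g g (CExt CUnit b) \<and> subeq
    u (CExt CUnit b) h h G \<and>
    subeq u (CExt CUnit b) (SComp g h) (SId (CExt CUnit b)) (CExt CUnit b) \<and> subeq u G (SComp h g) (SId G) G"

text \<open>\<open>iso_sigma\<close> in the syntactic cwf gives the inverse laws as equations of
  classes; the work lies in computing its maps as the classes of \<open>h'\<close> and
  \<open>g'\<close>. The step holds in either calculus.\<close>

lemma rdem_step:
  assumes G: "ctxeq u G G" and A: "tyeq u G A A" and coded: "ctx_coded u G b g h"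
  defines "S \<equiv> TSigma b (TSub A h)"
  defines "b' \<equiv> TSub b (SProj S)" and "B' \<equiv> TSub (TSub A h) (slift b (SProj S))"
  defines "h' \<equiv> SExt (SComp h (SExt (SProj S) (EFst b' (EVar S)) b)) (ESnd b' B' (EVar S)) A"
  defines "e \<equiv> SBang (CExt G A)"
  defines "g' \<equiv> SExt e (EPair (TSub b e) (TSub (TSub A h) (slift b e))
                   (ESub (EVar b) (SComp g (SProj A))) (EVar A)) S"
  shows "ctx_coded u (CExt G A) S g' h'"
proof -
  let ?K = "syn_cwf u"
  let ?X = "CExt CUnit b" and ?Y = "CExt CUnit S" and ?Z = "CExt G A"
  let ?f = "EFst b' (EVar S)"
  let ?k = "SExt (SProj S) ?f b"
  let ?hk = "SComp h ?k"
  let ?be = "TSub b e" and ?Be = "TSub (TSub A h) (slift b e)"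
  let ?gp = "SComp g (SProj A)"
  let ?x = "ESub (EVar b) ?gp"
  from coded have b: "tyeq u CUnit b b" and g: "subeq u G g g ?X" and h: "subeq u ?X h h G"
    and gh: "subeq u ?X (SComp g h) (SId ?X) ?X" and hg: "subeq u G (SComp h g) (SId G) G"
    unfolding ctx_coded_def by blast+
  note U = unit_cong[of u]
  note X = ext_cong[OF U b] and B = ty_sub_cong[OF A h]
  have S: "tyeq u CUnit S S" unfolding S_def by (rule sigma_cong[OF b B])
  note Y = ext_cong[OF U S] and p = proj_cong[OF S]
  have b': "tyeq u ?Y b' b'" unfolding b'_def by (rule ty_sub_cong[OF b p])
  have l: "subeq u (CExt ?Y b') (slift b (SProj S)) (slift b (SProj S)) ?X"
    unfolding b'_def by (rule slift_cong[OF Y b p])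
  note Yb' = ext_cong[OF Y b']
  have B': "tyeq u (CExt ?Y b') B' B'" unfolding B'_def by (rule ty_sub_cong[OF B l])
  have ss: "tyeq u ?Y (TSub S (SProj S)) (TSigma b' B')"
    using sigma_sub[OF b B p] unfolding S_def b'_def B'_def .
  note q = tm_conv[OF Y ss var_cong[OF S]] and qe = tm_cls_eq[OF Y ss var_cong[OF S]]
  note f = fst_cong[OF b' B' q]
  have k: "subeq u ?Y ?k ?k ?X" using sub_ext_cong[OF b p] f unfolding b'_def by blast
  note hk = comp_cong[OF k h]
  note s = snd_cong[OF b' B' q] and i = sinst_cong[OF Y b' f]
  have Z: "ctxeq u ?Z ?Z" by (rule ext_cong[OF G A])
  have e: "subeq u ?Z e e CUnit" unfolding e_def by (rule bang_cong[OF Z])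
  note pA = proj_cong[OF A] and qA = var_cong[OF A]
  note be = ty_sub_cong[OF b e] and le = slift_cong[OF Z b e]
  note Zbe = ext_cong[OF Z be] and Be = ty_sub_cong[OF B le]
  note gp = comp_cong[OF pA g]
  note pb = proj_cong[OF b] and qb = var_cong[OF b]
  note Tb = ty_sub_cong[OF b pb]
  note x0 = tm_sub_cong[OF qb gp]
  have ghc: "sub_cls u ?X (SComp g h) ?X = sub_cls u ?X (SId ?X) ?X" by (rule sub_cls_eq[OF X X gh])
  have hgc: "sub_cls u G (SComp h g) G = sub_cls u G (SId G) G" by (rule sub_cls_eq[OF G G hg])
  let ?E = "ext ?K (unit_ctx ?K) (ty_cls u CUnit b)"
  have sem: "ctx_cls u G \<in> Ctx ?K" "ty_cls u G A \<in> Ty ?K (ctx_cls u G)"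
    "ty_cls u CUnit b \<in> Ty ?K (unit_ctx ?K)"
    "sub_cls u G g ?X \<in> Sub ?K (ctx_cls u G) ?E"
    "sub_cls u ?X h G \<in> Sub ?K ?E (ctx_cls u G)"
    "comp_sub ?K ?E (ctx_cls u G)
      ?E (sub_cls u G g ?X) (sub_cls u ?X h G)
      = id_sub ?K ?E"
    "comp_sub ?K (ctx_cls u G) ?E
      (ctx_cls u G) (sub_cls u ?X h G) (sub_cls u G g ?X) = id_sub ?K (ctx_cls u G)"
    using G A b g h U X ghc hgc by (auto simp: mem_syn cls_syn)
  note I = supports_Sigma.iso_sigma[OF supports_Sigma_syn sem]
  note sig = sigma_ty_syn[OF U b B, folded S_def]
  \<comment> \<open>\<open>S\<close>, \<open>b'\<close> and \<open>B'\<close> are opaque names here,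
    so the computation rules producing these expressions are restated with the names folded.\<close>
  have l_eq: "lift ?K (ctx_cls u ?Y) (ctx_cls u CUnit) (ty_cls u CUnit b) (sub_cls u ?Y (SProj S) CUnit)
      = sub_cls u (CExt ?Y b') (slift b (SProj S)) ?X"
    using lift_syn[OF Y U b p] unfolding b'_def .
  have e_eq: "bang_sub ?K (ctx_cls u ?Z) = sub_cls u ?Z e CUnit"
    unfolding e_def by (rule bang_syn[OF Z])
  have b'_eq: "ty_sub ?K (ctx_cls u ?Y) (ctx_cls u CUnit) (ty_cls u CUnit b) (sub_cls u ?Y (SProj S) CUnit)
      = ty_cls u ?Y b'"
    using ty_sub_syn[OF Y b p] unfolding b'_def .
  have B'_eq: "ty_sub ?K (ctx_cls u (CExt ?Y b')) (ctx_cls u ?X) (ty_cls u ?X (TSub A h))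
      (sub_cls u (CExt ?Y b') (slift b (SProj S)) ?X) = ty_cls u (CExt ?Y b') B'"
    using ty_sub_syn[OF Yb' B l] unfolding B'_def .
  have k_eq: "sub_ext ?K (ctx_cls u ?Y) (ctx_cls u CUnit) (ty_cls u CUnit b) (sub_cls u ?Y (SProj S) CUnit)
      (tm_cls u ?Y ?f b') = sub_cls u ?Y ?k ?X"
    using sub_ext_syn[OF Y U b p] f unfolding b'_def by blast
  have le_eq: "lift ?K (ctx_cls u ?Z) (ctx_cls u CUnit) (ty_cls u CUnit b) (sub_cls u ?Z e CUnit)
      = sub_cls u (CExt ?Z ?be) (slift b e) ?X"
    by (rule lift_syn[OF Z U b e])
  note ev = le_eq unit_syn ext_syn pr_syn ty_sub_syn comp_syn e_eq sig l_eq b'_eq B'_eq k_eq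
  note facts = G A b g h U X B S Y p b' l Yb' B' q f k hk i Z e pA be le Zbe Be gp pb qb Tb
  \<comment> \<open>The type equations of \<open>iso_sigma\<close> become conversions one at a time,
    since later raw terms are well typed only after earlier conversions.\<close>
  have st: "tyeq u ?Y (TSub B' (sinst ?Y b' ?f)) (TSub A ?hk)"
    by (rule ty_clsD[OF _ ty_sub_cong[OF A hk]])
      (use I(5) facts in \<open>simp add: ev vr_syn qe fst_tm_syn inst_syn\<close>)
  note s' = tm_conv[OF Y st s] and se = tm_cls_eq[OF Y st s]
  have h': "subeq u ?Y h' h' ?Z" unfolding h'_def by (rule sub_ext_cong[OF A hk s'])
  have h'_eq: "sub_ext ?K (ctx_cls u ?Y) (ctx_cls u G) (ty_cls u G A) (sub_cls u ?Y ?hk G)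
      (tm_cls u ?Y (ESnd b' B' (EVar S)) (TSub A ?hk)) = sub_cls u ?Y h' ?Z"
    unfolding h'_def by (rule sub_ext_syn[OF Y G A hk s'])
  have xt: "tyeq u ?Z (TSub (TSub b (SProj b)) ?gp) ?be"
    by (rule ty_clsD[OF _ be]) (use I(9) facts in \<open>simp add: ev\<close>)
  note x = tm_conv[OF Z xt x0] and xe = tm_cls_eq[OF Z xt x0]
  note ix = sinst_cong[OF Z be x]
  have yt: "tyeq u ?Z (TSub A (SProj A)) (TSub ?Be (sinst ?Z ?be ?x))"
    by (rule ty_clsD[OF _ ty_sub_cong[OF Be ix]])
      (use I(8) facts x ix in \<open>simp add: ev vr_syn tm_sub_syn xe inst_syn\<close>)
  note y = tm_conv[OF Z yt qA] and ye = tm_cls_eq[OF Z yt qA]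
  note w0 = pair_cong[OF be Be x y]
  have wt: "tyeq u ?Z (TSigma ?be ?Be) (TSub S e)"
    using ty_sym[OF sigma_sub[OF b B e]] unfolding S_def .
  note w = tm_conv[OF Z wt w0] and we = tm_cls_eq[OF Z wt w0]
  have g': "subeq u ?Z g' g' ?Y" unfolding g'_def by (rule sub_ext_cong[OF S e w])
  have g'_eq: "sub_ext ?K (ctx_cls u ?Z) (ctx_cls u CUnit) (ty_cls u CUnit S) (sub_cls u ?Z e CUnit)
      (tm_cls u ?Z (EPair ?be ?Be ?x (EVar A)) (TSub S e)) = sub_cls u ?Z g' ?Y"
    unfolding g'_def by (rule sub_ext_syn[OF Z U S e w])
  have gh': "subeq u ?Y (SComp g' h') (SId ?Y) ?Y"
    by (rule sub_clsD[OF _ id_cong[OF Y]])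
      (use I(14) facts x ix y s s' h' g' w0 w in \<open>simp add: ev id_syn vr_syn qe fst_tm_syn snd_tm_syn
         se h'_eq tm_sub_syn xe ye pair_tm_syn we g'_eq\<close>)
  have hg': "subeq u ?Z (SComp h' g') (SId ?Z) ?Z"
    by (rule sub_clsD[OF _ id_cong[OF Z]])
      (use I(13) facts x ix y s s' h' g' w0 w in \<open>simp add: ev id_syn vr_syn qe fst_tm_syn snd_tm_syn
         se h'_eq tm_sub_syn xe ye pair_tm_syn we g'_eq\<close>)
  show ?thesis unfolding ctx_coded_def by (intro conjI S g' h' gh' hg')
qed

lemma rdem_iso: "ctxeq Everywhere G G \<Longrightarrow> ctx_coded Everywhere G (rbar G) (rdem G) (rdem_inv G)"
proof (induction G rule: rdem.induct)
  case 1
  let ?u = Everywhere and ?N = "CExt CUnit TN1" and ?z = "SExt (SId CUnit) EZero TN1"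
  note U = unit_cong[of ?u]
  note N = ext_cong[OF U n1_cong]
  have z: "subeq ?u CUnit ?z ?z ?N"
    by (rule sub_ext_cong[OF n1_cong id_cong[OF U] tm_conv[OF U ty_sym[OF ty_sub_id[OF n1_cong]] zero_cong]])
  note b = bang_cong[OF N]
  note zb = comp_cong[OF b z] and bz = comp_cong[OF z b] and id = id_cong[OF N]
  \<comment> \<open>The place where \<open>Everywhere\<close> is needed: over 1.N1 the variable and
    the zero term must coincide.\<close>
  have "subeq ?u ?N (SComp ?z (SBang ?N)) (SId ?N) ?N"
  proof (rule sub_clsD[OF model.to_n1_eq[OF model_syn refl] id])
    show "sub_cls ?u ?N (SComp ?z (SBang ?N)) ?N
        \<in> Sub (syn_cwf ?u) (ctx_cls ?u ?N) (ext (syn_cwf ?u) (unit_ctx (syn_cwf ?u)) (n1_ty (syn_cwf ?u)))"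
      "sub_cls ?u ?N (SId ?N) ?N
        \<in> Sub (syn_cwf ?u) (ctx_cls ?u ?N) (ext (syn_cwf ?u) (unit_ctx (syn_cwf ?u)) (n1_ty (syn_cwf ?u)))"
      using U N n1_cong zb id by (auto simp: unit_syn n1_ty_syn ext_syn Sub_syn)
  qed (use N in \<open>auto simp: Ctx_syn\<close>)
  moreover have "subeq ?u CUnit (SComp (SBang ?N) ?z) (SId CUnit) CUnit"
    by (rule sub_trans[OF bang_unique[OF bz] sub_sym[OF bang_unique[OF id_cong[OF U]]]])
  ultimately show ?case using z b n1_cong by (simp add: ctx_coded_def)
next
  case (2 G A)
  from ctxeq_inv(1)[OF 2(2)] have G: "ctxeq Everywhere G G" and A: "tyeq Everywhere G A A" by auto
  show ?case using rdem_step[OF G A 2(1)[OF refl refl G]] by (simp add: Let_def)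
qed

lemma is_iso_rdem:
  assumes "ctxeq Everywhere G G"
  shows "is_iso (syn_cwf Everywhere) (ctx_cls Everywhere G) (ctx_cls Everywhere (CExt CUnit (rbar G)))
    (sub_cls Everywhere G (rdem G) (CExt CUnit (rbar G)))"
proof -
  note i = rdem_iso[OF assms, unfolded ctx_coded_def]
  have E: "ctxeq Everywhere (CExt CUnit (rbar G)) (CExt CUnit (rbar G))"
    using i by (blast intro: ext_cong unit_cong)
  have "sub_cls Everywhere (CExt CUnit (rbar G)) (SComp (rdem G) (rdem_inv G)) (CExt CUnit (rbar G))
      = sub_cls Everywhere (CExt CUnit (rbar G)) (SId (CExt CUnit (rbar G))) (CExt CUnit (rbar G))"
    "sub_cls Everywhere G (SComp (rdem_inv G) (rdem G)) G = sub_cls Everywhere G (SId G) G"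
    using i by (auto intro!: sub_cls_eq[OF E E] sub_cls_eq[OF assms assms] simp del: rbar.simps)
  then show ?thesis
    unfolding is_iso_def using i E assms
    by (intro conjI bexI[of _ "sub_cls Everywhere (CExt CUnit (rbar G)) (rdem_inv G) G"])
      (auto simp: Sub_syn comp_syn id_syn)
qed

lemma democratic_syn:
  "democratic_cwf (syn_cwf Everywhere) (syn_bar Everywhere) (syn_dem Everywhere)"
proof (intro democratic_cwf.intro democratic_cwf_axioms.intro cwf_syn)
  let ?u = Everywhere
  note U = unit_cong[of ?u]
  fix X assume "X \<in> Ctx (syn_cwf ?u)"
  then obtain G' where X: "X = ctx_cls ?u G'" "ctxeq ?u G' G'" by (auto simp: Ctx_syn)
  let ?G = "rep X"
  have r: "ctxeq ?u G' ?G" using rep_ctx[OF X(2)] X(1) by simp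
  have G: "ctxeq ?u ?G ?G" "X = ctx_cls ?u ?G"
    by (rule ctx_trans[OF ctx_sym[OF r] r]) (rule trans[OF X(1) ctx_cls_eq[OF r]])
  note i = rdem_iso[OF G(1), unfolded ctx_coded_def]
  show "syn_bar ?u X \<in> Ty (syn_cwf ?u) (unit_ctx (syn_cwf ?u))"
    unfolding syn_bar_def using i U by (auto simp: unit_syn Ty_syn)
  have e: "ext (syn_cwf ?u) (unit_ctx (syn_cwf ?u)) (syn_bar ?u X) = ctx_cls ?u (CExt CUnit (rbar ?G))"
    unfolding syn_bar_def unit_syn using i U by (simp add: ext_syn)
  show "is_iso (syn_cwf ?u) X (ext (syn_cwf ?u) (unit_ctx (syn_cwf ?u)) (syn_bar ?u X)) (syn_dem ?u X)"
    unfolding e syn_dem_def using is_iso_rdem[OF G(1)] unfolding G(2)[symmetric] .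
next
  let ?u = Everywhere
  have "ctxeq ?u CUnit (rep (ctx_cls ?u CUnit))" by (rule rep_ctx[OF unit_cong])
  \<comment> \<open>By inversion the class of the empty context is a singleton, so
    \<open>syn_bar\<close> and \<open>syn_dem\<close> unfold there to the base case of the
    recursion.\<close>
  then have r: "rep (ctx_cls ?u CUnit) = CUnit" using ctxeq_inv(1) by blast
  have b: "syn_bar ?u (unit_ctx (syn_cwf ?u)) = ty_cls ?u CUnit TN1"
    unfolding syn_bar_def unit_syn r by simp
  show "n1_ty (syn_cwf ?u) = syn_bar ?u (unit_ctx (syn_cwf ?u))"
    unfolding b by (rule n1_ty_syn)
  let ?z = "SExt (SId CUnit) EZero TN1"
  note U = unit_cong[of ?u]
  note N = ext_cong[OF U n1_cong] and p = proj_cong[OF n1_cong] and q = var_cong[OF n1_cong]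
  note k = ty_sub_id[OF n1_cong]
  note z0 = tm_conv[OF U ty_sym[OF k] zero_cong]
  have z: "subeq ?u CUnit ?z ?z (CExt CUnit TN1)"
    by (rule sub_ext_cong[OF n1_cong id_cong[OF U] z0])
  note pz = proj_sub_ext[OF n1_cong id_cong[OF U] z0]
  have t: "tyeq ?u CUnit (TSub (TSub TN1 (SProj TN1)) ?z) TN1"
    by (rule ty_trans[OF conv_syn[OF n1_cong z pz] k])
  \<comment> \<open>This is the convention 0_1 = q[dem 1]; what follows only adjusts its
    type.\<close>
  have "tmeq ?u CUnit (ESub (EVar TN1) ?z) EZero TN1"
    by (rule tm_conv[OF U k var_sub_ext[OF n1_cong id_cong[OF U] z0]])
  then have v: "tmeq ?u CUnit (ESub (EVar TN1) ?z) EZero (TSub (TSub TN1 (SProj TN1)) ?z)"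
    by (rule tm_conv[OF U ty_sym[OF t]])
  show "zero_tm (syn_cwf ?u) =
      (let X = ext (syn_cwf ?u) (unit_ctx (syn_cwf ?u)) (syn_bar ?u (unit_ctx (syn_cwf ?u)));
           p = pr (syn_cwf ?u) (unit_ctx (syn_cwf ?u)) (syn_bar ?u (unit_ctx (syn_cwf ?u)))
       in tm_sub (syn_cwf ?u) (unit_ctx (syn_cwf ?u)) X
            (ty_sub (syn_cwf ?u) X (unit_ctx (syn_cwf ?u)) (syn_bar ?u (unit_ctx (syn_cwf ?u))) p)
            (vr (syn_cwf ?u) (unit_ctx (syn_cwf ?u)) (syn_bar ?u (unit_ctx (syn_cwf ?u))))
            (syn_dem ?u (unit_ctx (syn_cwf ?u))))"
    unfolding Let_def b unfolding syn_dem_def unit_syn r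
    using U n1_cong N p q z ty_sub_cong[OF n1_cong p] tm_cls_eq[OF U t v]
    by (simp add: ext_syn pr_syn vr_syn ty_sub_syn tm_sub_syn zero_tm_syn)
qed

section \<open>The free democratic cwf\<close>

text \<open>The universal property holds for either uniqueness rule, since a democratic target
  satisfies both; democracy of the source is obtained with \<open>Everywhere\<close>.\<close>

theorem theorem4p18:
  shows "(\<forall>u. cwf (syn_cwf u) \<and>
      supports_I (syn_cwf u) \<and> supports_N1 (syn_cwf u) \<and>
      supports_Sigma (syn_cwf u) \<and> supports_Pi (syn_cwf u) \<and>
      syn_base u \<in> Ty (syn_cwf u) (unit_ctx (syn_cwf u)) \<and>
      (\<forall>(C :: ('c, 's, 't, 'e) tcwf) bar dem o\<^sub>C.
        democratic_cwf C bar dem \<longrightarrow> supports_I C \<longrightarrow> supports_Sigma C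
          \<longrightarrow> supports_Pi C \<longrightarrow>
        o\<^sub>C \<in> Ty C (unit_ctx C) \<longrightarrow>
        (\<exists>!F. strict_cwf_morphism (syn_cwf u) C F \<and>
          preserves_I (syn_cwf u) C F \<and> preserves_N1 (syn_cwf u) C F \<and>
          preserves_Sigma (syn_cwf u) C F \<and> preserves_Pi (syn_cwf u) C F \<and>
          FTy F (unit_ctx (syn_cwf u)) (syn_base u) = o\<^sub>C)))
    \<and> democratic_cwf (syn_cwf Everywhere) (syn_bar Everywhere) (syn_dem Everywhere)"
proof (intro conjI allI impI cwf_syn supports_I_syn supports_N1_syn supports_Sigma_syn supports_Pi_syn
    syn_base_in democratic_syn)
  fix u and C :: "('c, 's, 't, 'e) tcwf" and bar dem o\<^sub>C
  assume "democratic_cwf C bar dem" "supports_I C" "supports_Sigma C" "supports_Pi C" "o\<^sub>C \<in> Ty C (unit_ctx C)"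
  then have "model C o\<^sub>C u" by (rule model_democratic)
  then show "\<exists>!F. strict_cwf_morphism (syn_cwf u) C F \<and>
      preserves_I (syn_cwf u) C F \<and> preserves_N1 (syn_cwf u) C F \<and>
      preserves_Sigma (syn_cwf u) C F \<and> preserves_Pi (syn_cwf u) C F \<and>
      FTy F (unit_ctx (syn_cwf u)) (syn_base u) = o\<^sub>C"
  proof (intro ex_ex1I syn_initial_exists)
    fix F G
    let ?P = "\<lambda>F. strict_cwf_morphism (syn_cwf u) C F \<and>
      preserves_I (syn_cwf u) C F \<and> preserves_N1 (syn_cwf u) C F \<and>
      preserves_Sigma (syn_cwf u) C F \<and> preserves_Pi (syn_cwf u) C F \<and>
      FTy F (unit_ctx (syn_cwf u)) (syn_base u) = o\<^sub>C"
    assume "?P F" "?P G"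
    then show "F = G" by (intro syn_initial_unique[of u C F G]) auto
  qed
qed

end
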